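(* Let $r,r'\in\mathbb{Z}_2$, $s\geq 1$ an integer and $\eta\in\mathbb{P}^1(k)$. The following isomorphisms of $D_4$-modules hold. (1) If $s$ is odd, then $V(2,r')\otimes\Omega^sV(r)\cong V(2,r')\otimes\Omega^{-s}V(r)\cong sV(2,r+r')\oplus(s+1)V(2,r+r'+1)$. (2) If $s$ is even, then $V(2,r')\otimes\Omega^sV(r)\cong V(2,r')\otimes\Omega^{-s}V(r)\cong sV(2,r+r'+1)\oplus(s+1)V(2,r+r')$. (3) $V(2,r')\otimes M_s(r,\eta)\cong sV(2,0)\oplus sV(2,1)$.
   Context: Let $k$ be an algebraically closed field with $\mathrm{char}(k)\neq 2$. All modules are finite-dimensional left modules; $\otimes=\otimes_k$; $\mathbb{Z}_2=\mathbb{Z}/2\mathbb{Z}$; $nM$ denotes the direct sum of $n$ copies of $M$; $\mathbb{P}^1(k)$ is identified with $k\cup\{\infty\}$; $l(M)$ is the length of $M$. $D_4$ is the $k$-algebra generated by $a,b,c,d$ subject to $ba=-ab$, $db=-bd$, $ca=-ac$, $dc=-cd$, $bc=cb$, $a^2=0$, $b^2=1$, $c^2=1$, $d^2=0$, $da+ad=1-bc$. It is a $16$-dimensional Hopf algebra (isomorphic to the Drinfeld double of Sweedler's 4-dimensional Hopf algebra) with comultiplication $\Delta(a)=a\otimes b+1\otimes a$, $\Delta(b)=b\otimes b$, $\Delta(c)=c\otimes c$, $\Delta(d)=d\otimes c+1\otimes d$, counit $\varepsilon(a)=\varepsilon(d)=0$, $\varepsilon(b)=\varepsilon(c)=1$,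 antipode $S(a)=-ab$, $S(b)=b$, $S(c)=c$, $S(d)=-dc$. Tensor products of $D_4$-modules are $D_4$-modules via $\Delta$. For $r\in\mathbb{Z}_2$: $V(r)$ is the one-dimensional simple module on which $a,d$ act as $0$ and $b,c$ act as $(-1)^r$. $V(2,r)$ is the simple module with basis $v_1,v_2$ and action $av_1=v_2$, $dv_1=0$, $bv_1=(-1)^rv_1$, $cv_1=(-1)^{r+1}v_1$, $av_2=0$, $dv_2=2v_1$, $bv_2=(-1)^{r+1}v_2$, $cv_2=(-1)^rv_2$. For a module $M$, $\Omega M$ is the kernel of a projective cover $P(M)\to M$ and $\Omega^{-1}M$ is the cokernel of an injective envelope $M\to I(M)$; for $s\geq1$, $\Omega^{s}$ and $\Omega^{-s}$ are the $s$-fold iterates of $\Omega$ and $\Omega^{-1}$. For $r\in\mathbb{Z}_2$, $\eta\in\mathbb{P}^1(k)$, $M_1(r,\eta)$ is the module with basis $v_1,v_2$ where $b,c$ act on $v_1$ as $(-1)^{r+1}$ and on $v_2$ as $(-1)^r$, $av_2=dv_2=0$, and $av_1=v_2$, $dv_1=-\eta v_2$ if $\eta\in k$, while $av_1=0$, $dv_1=v_2$ if $\eta=\infty$. An indecomposable module $M$ of Loewy length $2$ is of $(s,t)$-type if $l(M/\mathrm{soc}(M))=s$ and $l(\mathrm{soc}(M))=t$. For $s\geq1$, $M_s(r,\eta)$ denotes the (known to be unique up to isomorphism) indecomposable module of $(s,s)$-type containing a submodule isomorphic to $M_1(r,\eta)$. *)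

theory Defs
  imports
    "HOL-Computational_Algebra.Computational_Algebra"
    "HOL-Library.Z2"
    "Jordan_Normal_Form.Matrix"
    "Jordan_Normal_Form.Matrix_Kernel"
begin

(* A finite-dimensional left D_4-module is given by its dimension n and the matrices by which the
   generators a, b, c, d act on the column vectors k^n.  Since D_4 is presented by generators
   and relations, module structures on k^n are exactly the quadruples of matrices satisfying the
   relations.  Working on k^n lets "for all modules" range over all finite-dimensional modules
   (up to isomorphism) within a single HOL type. *)

record 'k d4_rep =
  rdim :: nat
  op_a :: "'k mat"
  op_b :: "'k mat"
  op_c :: "'k mat"
  op_d :: "'k mat"

definition d4_module :: "('k::field) d4_rep \<Rightarrow> bool" where
  "d4_module M \<longleftrightarrow>
     (let n = rdim M; a = op_a M; b = op_b M; c = op_c M; d = op_d M in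
      a \<in> carrier_mat n n \<and> b \<in> carrier_mat n n \<and> c \<in> carrier_mat n n \<and> d \<in> carrier_mat n n \<and>
      b * a = - (a * b) \<and> d * b = - (b * d) \<and> c * a = - (a * c) \<and> d * c = - (c * d) \<and>
      b * c = c * b \<and> a * a = 0\<^sub>m n n \<and> b * b = 1\<^sub>m n \<and> c * c = 1\<^sub>m n \<and> d * d = 0\<^sub>m n n \<and>
      d * a + a * d = 1\<^sub>m n - b * c)"

abbreviation mspace :: "('k::field) d4_rep \<Rightarrow> 'k vec set" where
  "mspace M \<equiv> carrier_vec (rdim M)"


section \<open>Homomorphisms, submodules, quotients\<close>

definition d4_hom :: "('k::field) d4_rep \<Rightarrow> 'k d4_rep \<Rightarrow> 'k mat \<Rightarrow> bool" where
  "d4_hom M N F \<longleftrightarrow> F \<in> carrier_mat (rdim N) (rdim M) \<and>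
     F * op_a M = op_a N * F \<and> F * op_b M = op_b N * F \<and>
     F * op_c M = op_c N * F \<and> F * op_d M = op_d N * F"

definition d4_iso :: "('k::field) d4_rep \<Rightarrow> 'k d4_rep \<Rightarrow> bool" (infix "\<cong>\<^sub>D" 50) where
  "M \<cong>\<^sub>D N \<longleftrightarrow> (\<exists>F G. d4_hom M N F \<and> d4_hom N M G \<and> G * F = 1\<^sub>m (rdim M) \<and> F * G = 1\<^sub>m (rdim N))"

definition mat_image :: "('k::field) mat \<Rightarrow> 'k vec set" where
  "mat_image F = (\<lambda>v. F *\<^sub>v v) ` carrier_vec (dim_col F)"

definition d4_mono :: "('k::field) d4_rep \<Rightarrow> 'k d4_rep \<Rightarrow> 'k mat \<Rightarrow> bool" where
  "d4_mono M N F \<longleftrightarrow> d4_hom M N F \<and> inj_on (\<lambda>v. F *\<^sub>v v) (mspace M)"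

definition d4_epi :: "('k::field) d4_rep \<Rightarrow> 'k d4_rep \<Rightarrow> 'k mat \<Rightarrow> bool" where
  "d4_epi M N F \<longleftrightarrow> d4_hom M N F \<and> mat_image F = mspace N"

definition submodule :: "('k::field) d4_rep \<Rightarrow> 'k vec set \<Rightarrow> bool" where
  "submodule M W \<longleftrightarrow> W \<subseteq> mspace M \<and> 0\<^sub>v (rdim M) \<in> W \<and>
     (\<forall>v\<in>W. \<forall>w\<in>W. v + w \<in> W) \<and> (\<forall>x. \<forall>v\<in>W. x \<cdot>\<^sub>v v \<in> W) \<and>
     (\<forall>v\<in>W. op_a M *\<^sub>v v \<in> W \<and> op_b M *\<^sub>v v \<in> W \<and> op_c M *\<^sub>v v \<in> W \<and> op_d M *\<^sub>v v \<in> W)"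

(* S is isomorphic to the submodule W of M *)
definition represents_sub :: "('k::field) d4_rep \<Rightarrow> 'k vec set \<Rightarrow> 'k d4_rep \<Rightarrow> bool" where
  "represents_sub M W S \<longleftrightarrow> d4_module S \<and> (\<exists>i. d4_mono S M i \<and> mat_image i = W)"

(* Q is isomorphic to the quotient module M / W *)
definition represents_quot :: "('k::field) d4_rep \<Rightarrow> 'k vec set \<Rightarrow> 'k d4_rep \<Rightarrow> bool" where
  "represents_quot M W Q \<longleftrightarrow> d4_module Q \<and> (\<exists>p. d4_epi M Q p \<and> mat_kernel p = W)"

(* X is a maximal proper submodule of the submodule W, i.e. W / X is simple *)
definition max_sub :: "('k::field) d4_rep \<Rightarrow> 'k vec set \<Rightarrow> 'k vec set \<Rightarrow> bool" where
  "max_sub M X W \<longleftrightarrow> submodule M X \<and> submodule M W \<and> X \<subset> W \<and>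
     (\<forall>Y. submodule M Y \<and> X \<subseteq> Y \<and> Y \<subseteq> W \<longrightarrow> Y = X \<or> Y = W)"

(* M has a composition series with l factors; l is unique by Jordan-Hoelder *)
definition has_length :: "('k::field) d4_rep \<Rightarrow> nat \<Rightarrow> bool" where
  "has_length M l \<longleftrightarrow> (\<exists>W :: nat \<Rightarrow> 'k vec set.
     W 0 = {0\<^sub>v (rdim M)} \<and> W l = mspace M \<and> (\<forall>i<l. max_sub M (W i) (W (Suc i))))"

definition simple_sub :: "('k::field) d4_rep \<Rightarrow> 'k vec set \<Rightarrow> bool" where
  "simple_sub M S \<longleftrightarrow> max_sub M {0\<^sub>v (rdim M)} S"

(* the sum of all simple submodules, as the least submodule containing them *)
definition soc :: "('k::field) d4_rep \<Rightarrow> 'k vec set" where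
  "soc M = \<Inter> {W. submodule M W \<and> (\<forall>S. simple_sub M S \<longrightarrow> S \<subseteq> W)}"

(* the radical of the submodule W of M, i.e. the intersection of its maximal submodules *)
definition rad :: "('k::field) d4_rep \<Rightarrow> 'k vec set \<Rightarrow> 'k vec set" where
  "rad M W = W \<inter> \<Inter> {X. max_sub M X W}"

definition loewy_length :: "('k::field) d4_rep \<Rightarrow> nat" where
  "loewy_length M = (LEAST n. (rad M ^^ n) (mspace M) = {0\<^sub>v (rdim M)})"


section \<open>Direct sums and tensor products\<close>

definition zero_rep :: "('k::field) d4_rep" where
  "zero_rep = \<lparr>rdim = 0, op_a = 0\<^sub>m 0 0, op_b = 0\<^sub>m 0 0, op_c = 0\<^sub>m 0 0, op_d = 0\<^sub>m 0 0\<rparr>"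

definition block_diag :: "('k::field) mat \<Rightarrow> 'k mat \<Rightarrow> 'k mat" where
  "block_diag A B = four_block_mat A (0\<^sub>m (dim_row A) (dim_col B)) (0\<^sub>m (dim_row B) (dim_col A)) B"

definition dsum :: "('k::field) d4_rep \<Rightarrow> 'k d4_rep \<Rightarrow> 'k d4_rep" (infixr "\<oplus>\<^sub>D" 65) where
  "M \<oplus>\<^sub>D N = \<lparr>rdim = rdim M + rdim N,
     op_a = block_diag (op_a M) (op_a N), op_b = block_diag (op_b M) (op_b N),
     op_c = block_diag (op_c M) (op_c N), op_d = block_diag (op_d M) (op_d N)\<rparr>"

primrec copies :: "nat \<Rightarrow> ('k::field) d4_rep \<Rightarrow> 'k d4_rep" where
  "copies 0 M = zero_rep"
| "copies (Suc n) M = M \<oplus>\<^sub>D copies n M"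

(* Kronecker product: the matrix of the tensor product of two linear maps with respect to the
   lexicographically ordered basis of the vectors e_i (x) f_j. *)
definition kron :: "('k::field) mat \<Rightarrow> 'k mat \<Rightarrow> 'k mat" where
  "kron A B = mat (dim_row A * dim_row B) (dim_col A * dim_col B)
     (\<lambda>(i, j). A $$ (i div dim_row B, j div dim_col B) * B $$ (i mod dim_row B, j mod dim_col B))"

(* The action is through the comultiplication
   a |-> a (x) b + 1 (x) a,   b |-> b (x) b,   c |-> c (x) c,   d |-> d (x) c + 1 (x) d. *)
definition tensor :: "('k::field) d4_rep \<Rightarrow> 'k d4_rep \<Rightarrow> 'k d4_rep" (infixr "\<otimes>\<^sub>D" 70) where
  "M \<otimes>\<^sub>D N = \<lparr>rdim = rdim M * rdim N,
     op_a = kron (op_a M) (op_b N) + kron (1\<^sub>m (rdim M)) (op_a N),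
     op_b = kron (op_b M) (op_b N),
     op_c = kron (op_c M) (op_c N),
     op_d = kron (op_d M) (op_c N) + kron (1\<^sub>m (rdim M)) (op_d N)\<rparr>"

definition indecomposable :: "('k::field) d4_rep \<Rightarrow> bool" where
  "indecomposable M \<longleftrightarrow> d4_module M \<and> rdim M \<noteq> 0 \<and>
     (\<forall>X Y. d4_module X \<and> d4_module Y \<and> M \<cong>\<^sub>D X \<oplus>\<^sub>D Y \<longrightarrow> rdim X = 0 \<or> rdim Y = 0)"


section \<open>Projective covers, injective envelopes and syzygies\<close>

definition projective :: "('k::field) d4_rep \<Rightarrow> bool" where
  "projective P \<longleftrightarrow> d4_module P \<and>
     (\<forall>M N g f. d4_module M \<and> d4_module N \<and> d4_epi M N g \<and> d4_hom P N f \<longrightarrow>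
        (\<exists>h. d4_hom P M h \<and> g * h = f))"

definition injective :: "('k::field) d4_rep \<Rightarrow> bool" where
  "injective I \<longleftrightarrow> d4_module I \<and>
     (\<forall>M N g f. d4_module M \<and> d4_module N \<and> d4_mono M N g \<and> d4_hom M I f \<longrightarrow>
        (\<exists>h. d4_hom N I h \<and> h * g = f))"

definition superfluous :: "('k::field) d4_rep \<Rightarrow> 'k vec set \<Rightarrow> bool" where
  "superfluous P K \<longleftrightarrow> submodule P K \<and>
     (\<forall>W. submodule P W \<and> {w + u | w u. w \<in> W \<and> u \<in> K} = mspace P \<longrightarrow> W = mspace P)"

definition essential :: "('k::field) d4_rep \<Rightarrow> 'k vec set \<Rightarrow> bool" where
  "essential I K \<longleftrightarrow> submodule I K \<and>
     (\<forall>W. submodule I W \<and> W \<inter> K = {0\<^sub>v (rdim I)} \<longrightarrow> W = {0\<^sub>v (rdim I)})"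

definition projective_cover :: "('k::field) d4_rep \<Rightarrow> 'k d4_rep \<Rightarrow> 'k mat \<Rightarrow> bool" where
  "projective_cover M P p \<longleftrightarrow> projective P \<and> d4_epi P M p \<and> superfluous P (mat_kernel p)"

definition injective_envelope :: "('k::field) d4_rep \<Rightarrow> 'k d4_rep \<Rightarrow> 'k mat \<Rightarrow> bool" where
  "injective_envelope M I j \<longleftrightarrow> injective I \<and> d4_mono M I j \<and> essential I (mat_image j)"

(* As Omega is defined only up to isomorphism, it is a relation: "N is a kernel of a projective
   cover of M", resp. "N is a cokernel of an injective envelope of M".  The s-fold iterates are
   the relation powers. *)
definition is_Omega :: "('k::field) d4_rep \<Rightarrow> 'k d4_rep \<Rightarrow> bool" where
  "is_Omega M N \<longleftrightarrow> (\<exists>P p. projective_cover M P p \<and> represents_sub P (mat_kernel p) N)"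

definition is_Omega_inv :: "('k::field) d4_rep \<Rightarrow> 'k d4_rep \<Rightarrow> bool" where
  "is_Omega_inv M N \<longleftrightarrow> (\<exists>I j. injective_envelope M I j \<and> represents_quot I (mat_image j) N)"


section \<open>The modules in question\<close>

(* (-1)^r for r in Z_2 *)
definition zsgn :: "bit \<Rightarrow> 'k::field" where
  "zsgn r = (if r = 0 then 1 else - 1)"

definition V1 :: "bit \<Rightarrow> ('k::field) d4_rep" where
  "V1 r = \<lparr>rdim = 1, op_a = 0\<^sub>m 1 1, op_b = zsgn r \<cdot>\<^sub>m 1\<^sub>m 1, op_c = zsgn r \<cdot>\<^sub>m 1\<^sub>m 1, op_d = 0\<^sub>m 1 1\<rparr>"

definition V2 :: "bit \<Rightarrow> ('k::field) d4_rep" where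
  "V2 r = \<lparr>rdim = 2,
     op_a = mat_of_rows_list 2 [[0, 0], [1, 0]],
     op_b = mat_of_rows_list 2 [[zsgn r, 0], [0, zsgn (r + 1)]],
     op_c = mat_of_rows_list 2 [[zsgn (r + 1), 0], [0, zsgn r]],
     op_d = mat_of_rows_list 2 [[0, 2], [0, 0]]\<rparr>"

datatype 'k proj_line = Finite 'k | Infinity

definition M1 :: "bit \<Rightarrow> 'k proj_line \<Rightarrow> ('k::field) d4_rep" where
  "M1 r \<eta> = \<lparr>rdim = 2,
     op_a = mat_of_rows_list 2 [[0, 0], [case \<eta> of Finite x \<Rightarrow> 1 | Infinity \<Rightarrow> 0, 0]],
     op_b = mat_of_rows_list 2 [[zsgn (r + 1), 0], [0, zsgn r]],
     op_c = mat_of_rows_list 2 [[zsgn (r + 1), 0], [0, zsgn r]],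
     op_d = mat_of_rows_list 2 [[0, 0], [case \<eta> of Finite x \<Rightarrow> - x | Infinity \<Rightarrow> 1, 0]]\<rparr>"

definition st_type :: "nat \<Rightarrow> nat \<Rightarrow> ('k::field) d4_rep \<Rightarrow> bool" where
  "st_type s t M \<longleftrightarrow> indecomposable M \<and> loewy_length M = 2 \<and>
     (\<exists>Q. represents_quot M (soc M) Q \<and> has_length Q s) \<and>
     (\<exists>S. represents_sub M (soc M) S \<and> has_length S t)"

(* M is (a copy of) the module M_s(r, eta), which is unique up to isomorphism *)
definition is_Ms :: "nat \<Rightarrow> bit \<Rightarrow> 'k proj_line \<Rightarrow> ('k::field) d4_rep \<Rightarrow> bool" where
  "is_Ms s r \<eta> M \<longleftrightarrow> st_type s s M \<and> (\<exists>W. submodule M W \<and> represents_sub M W (M1 r \<eta>))"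

end

(* The element b c is central with square 1. On V(2,r') it acts as -1, and on every module N in the
   statement as 1, so that it acts as -1 on V(2,r') (x) N. Where b c = -1, the relations for a and d
   become those of a 2x2 matrix algebra: such modules are sums of copies of V(2,0) and V(2,1), and the
   multiplicities are the dimensions of the b-eigenspaces on the kernel of d. On V(2,r') (x) N that
   kernel is isomorphic to N, with b twisted by the sign (-1)^r'. Hence only the dimensions of the
   b-eigenspaces of N matter.

   For Omega^s V(r) they are read off from the Koszul resolution over the exterior algebra in a and d,
   using that syzygies are unique up to isomorphism. Transposing all matrices exchanges Omega and
   Omega^-1 and does not change the eigenspace dimensions. For M_s(r,eta), indecomposability and
   Loewy length 2 force b to act by one sign on the socle and by the other one on the quotient by it,
   and both have dimension s. *)

theory Submission
  imports Defs
begin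

section \<open>Matrix identities under dimension conditions\<close>

text \<open>The right tensor factors are not given by formulas: the statement ranges over all
  projective covers, all injective envelopes and all modules of the type of M_s. For syzygies an
  explicit model is compared with an arbitrary cover at every step; for M_s no model is built, and
  only its socle and its top are measured. The hypothesis on the characteristic enters through
  inverses of powers of 2: 1/2 in the projections to the eigenspaces of b and to the block on which
  b c acts as 1; 1/4 in the average over the group generated by b and c, which makes induced modules
  projective; and 1/2 in the intertwiner for the tensor product, where d v_2 = 2 v_1 has to be
  undone. Exact sequences are handled through linear splittings wherever possible: these are matrix
  identities, which can be checked blockwise and can be transposed.\<close>

lemma mult_mat_assoc:
  fixes A :: "'a::comm_ring_1 mat"
  shows "dim_col A = dim_row B \<Longrightarrow> dim_col B = dim_row C \<Longrightarrow> A * B * C = A * (B * C)"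
  by (metis assoc_mult_mat carrier_matI)

lemma mult_mat_vec_assoc:
  fixes A :: "'a::comm_ring_1 mat"
  shows "dim_col A = dim_row B \<Longrightarrow> dim_col B = dim_vec v \<Longrightarrow> A * B *\<^sub>v v = A *\<^sub>v (B *\<^sub>v v)"
  by (metis assoc_mult_mat_vec carrier_matI carrier_vecI)

lemma mult_mat_add:
  fixes A :: "'a::comm_ring_1 mat"
  shows "dim_col A = dim_row B \<Longrightarrow> dim_row B = dim_row C \<Longrightarrow> dim_col B = dim_col C
    \<Longrightarrow> A * (B + C) = A * B + A * C"
  by (metis mult_add_distrib_mat carrier_matI)

lemma add_mult_mat:
  fixes A :: "'a::comm_ring_1 mat"
  shows "dim_row A = dim_row B \<Longrightarrow> dim_col A = dim_col B \<Longrightarrow> dim_col A = dim_row C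
    \<Longrightarrow> (A + B) * C = A * C + B * C"
  by (metis add_mult_distrib_mat carrier_matI)

lemma mult_mat_minus:
  fixes A :: "'a::comm_ring_1 mat"
  shows "dim_col A = dim_row B \<Longrightarrow> dim_row B = dim_row C \<Longrightarrow> dim_col B = dim_col C
    \<Longrightarrow> A * (B - C) = A * B - A * C"
  by (metis mult_minus_distrib_mat carrier_matI)

lemma minus_mult_mat:
  fixes A :: "'a::comm_ring_1 mat"
  shows "dim_row A = dim_row B \<Longrightarrow> dim_col A = dim_col B \<Longrightarrow> dim_col A = dim_row C
    \<Longrightarrow> (A - B) * C = A * C - B * C"
  by (metis minus_mult_distrib_mat carrier_matI)

lemma mult_mat_smult:
  fixes A :: "'a::comm_ring_1 mat"
  shows "dim_col A = dim_row B \<Longrightarrow> A * (k \<cdot>\<^sub>m B) = k \<cdot>\<^sub>m (A * B)"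
  by (metis mult_smult_distrib carrier_matI)

lemma smult_mult_mat:
  fixes A :: "'a::comm_ring_1 mat"
  shows "dim_col A = dim_row B \<Longrightarrow> (k \<cdot>\<^sub>m A) * B = k \<cdot>\<^sub>m (A * B)"
  by (metis mult_smult_assoc_mat carrier_matI)

lemma smult_add_mat:
  fixes A :: "'a::comm_ring_1 mat"
  shows "dim_row A = dim_row B \<Longrightarrow> dim_col A = dim_col B \<Longrightarrow> k \<cdot>\<^sub>m (A + B) = k \<cdot>\<^sub>m A + k \<cdot>\<^sub>m B"
  by (metis add_smult_distrib_left_mat carrier_matI)

lemma smult_minus_mat:
  fixes A :: "'a::comm_ring_1 mat"
  shows "dim_row A = dim_row B \<Longrightarrow> dim_col A = dim_col B \<Longrightarrow> k \<cdot>\<^sub>m (A - B) = k \<cdot>\<^sub>m A - k \<cdot>\<^sub>m B"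
  by (rule eq_matI) (auto simp: algebra_simps)

lemma smult_uminus_mat:
  fixes A :: "'a::comm_ring_1 mat"
  shows "k \<cdot>\<^sub>m (- A) = - (k \<cdot>\<^sub>m A)"
  by (rule eq_matI) auto

lemma smult_smult_mat:
  fixes A :: "'a::comm_ring_1 mat"
  shows "k \<cdot>\<^sub>m (l \<cdot>\<^sub>m A) = (k * l) \<cdot>\<^sub>m A"
  by (rule eq_matI) (auto simp: algebra_simps)

lemma smult_one_mat: "1 \<cdot>\<^sub>m (A :: 'a::comm_ring_1 mat) = A"
  by (rule eq_matI) auto

lemma smult_zero_mat: "k \<cdot>\<^sub>m 0\<^sub>m n m = (0\<^sub>m n m :: 'a::comm_ring_1 mat)"
  by (rule eq_matI) auto

lemma zero_smult_mat: "0 \<cdot>\<^sub>m A = (0\<^sub>m (dim_row A) (dim_col A) :: 'a::comm_ring_1 mat)"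
  by (rule eq_matI) auto

lemma uminus_uminus_mat: "- (- A) = (A :: 'a::comm_ring_1 mat)"
  by (rule eq_matI) auto

lemma uminus_zero_mat: "- 0\<^sub>m n m = (0\<^sub>m n m :: 'a::comm_ring_1 mat)"
  by (rule eq_matI) auto

lemma zero_add_mat:
  fixes A :: "'a::comm_ring_1 mat"
  shows "dim_row A = n \<Longrightarrow> dim_col A = m \<Longrightarrow> 0\<^sub>m n m + A = A"
    "dim_row A = n \<Longrightarrow> dim_col A = m \<Longrightarrow> A + 0\<^sub>m n m = A"
    "dim_row A = n \<Longrightarrow> dim_col A = m \<Longrightarrow> A - 0\<^sub>m n m = A"
    "dim_row A = n \<Longrightarrow> dim_col A = m \<Longrightarrow> 0\<^sub>m n m - A = - A"
    "dim_row A = n \<Longrightarrow> dim_col A = m \<Longrightarrow> A - A = 0\<^sub>m n m"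
  by (auto intro!: eq_matI)

lemma transpose_mult_dim:
  fixes A :: "'a::comm_ring_1 mat"
  shows "dim_col A = dim_row B \<Longrightarrow> transpose_mat (A * B) = transpose_mat B * transpose_mat A"
  by (metis transpose_mult carrier_matI)

text \<open>These rules lead to a normal form: sums of right-nested products with the scalars
  outside. Their conditions are equations between dimensions, which contain no variable absent from
  the conclusion. Sums are not reordered; identities are therefore finished entrywise, where the
  entries of products are atoms and field arithmetic applies.\<close>

lemmas mat_simps = mult_mat_assoc mult_mat_add add_mult_mat mult_mat_minus minus_mult_mat
  mult_mat_smult smult_mult_mat smult_add_mat smult_minus_mat smult_uminus_mat smult_smult_mat
  smult_one_mat smult_zero_mat zero_smult_mat uminus_uminus_mat uminus_zero_mat zero_add_mat

text \<open>In right-nested products a relation between two factors is visible only together with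
  what follows them; this form applies it there.\<close>

lemma mult_mat_cong:
  fixes A :: "'a::comm_ring_1 mat"
  shows "A * B = C \<Longrightarrow> dim_col A = dim_row B \<Longrightarrow> dim_col B = dim_row X \<Longrightarrow> A * (B * X) = C * X"
  by (metis mult_mat_assoc)


section \<open>Injections and projections of direct sums of coordinate spaces\<close>

definition inl :: "nat \<Rightarrow> nat \<Rightarrow> 'a::comm_ring_1 mat" where
  "inl n m = mat (n + m) n (\<lambda>(i, j). if i = j then 1 else 0)"

definition inr :: "nat \<Rightarrow> nat \<Rightarrow> 'a::comm_ring_1 mat" where
  "inr n m = mat (n + m) m (\<lambda>(i, j). if i = n + j then 1 else 0)"

definition prl :: "nat \<Rightarrow> nat \<Rightarrow> 'a::comm_ring_1 mat" where
  "prl n m = transpose_mat (inl n m)"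

definition prr :: "nat \<Rightarrow> nat \<Rightarrow> 'a::comm_ring_1 mat" where
  "prr n m = transpose_mat (inr n m)"

lemma dim_in_pr [simp]:
  "dim_row (inl n m) = n + m" "dim_col (inl n m) = n"
  "dim_row (inr n m) = n + m" "dim_col (inr n m) = m"
  "dim_row (prl n m) = n" "dim_col (prl n m) = n + m"
  "dim_row (prr n m) = m" "dim_col (prr n m) = n + m"
  by (auto simp: inl_def inr_def prl_def prr_def)

lemma transpose_in_pr [simp]:
  "transpose_mat (inl n m) = prl n m" "transpose_mat (inr n m) = prr n m"
  "transpose_mat (prl n m) = inl n m" "transpose_mat (prr n m) = inr n m"
  by (auto simp: prl_def prr_def)

lemma pr_in [simp]:
  "prl n m * inl n m = (1\<^sub>m n :: 'a::comm_ring_1 mat)" "prr n m * inr n m = (1\<^sub>m m :: 'a mat)"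
  "prl n m * inr n m = (0\<^sub>m n m :: 'a mat)" "prr n m * inl n m = (0\<^sub>m m n :: 'a mat)"
proof -
  have *: "(\<Sum>k = 0..<N. (if k = i then 1 else 0) * (if k = j then 1 else 0))
      = (if i = j \<and> i < N then 1 else (0::'a))" for i j N :: nat
    by (simp add: if_distrib[where f = "\<lambda>x. x * _"] sum.delta' cong: if_cong)
  show "prl n m * inl n m = (1\<^sub>m n :: 'a mat)" "prr n m * inr n m = (1\<^sub>m m :: 'a mat)"
    "prl n m * inr n m = (0\<^sub>m n m :: 'a mat)" "prr n m * inl n m = (0\<^sub>m m n :: 'a mat)"
    by (rule eq_matI; simp add: prl_def prr_def inl_def inr_def scalar_prod_def *)+
qed

lemma pr_in_mult [simp]:
  "dim_row X = n \<Longrightarrow> prl n m * (inl n m * X) = X"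
  "dim_row X = m \<Longrightarrow> prr n m * (inr n m * X) = X"
  "dim_row X = m \<Longrightarrow> prl n m * (inr n m * X) = 0\<^sub>m n (dim_col X)"
  "dim_row X = n \<Longrightarrow> prr n m * (inl n m * X) = 0\<^sub>m m (dim_col X)"
  by (simp_all flip: mult_mat_assoc)

lemma in_pr: "inl n m * prl n m + inr n m * prr n m = (1\<^sub>m (n + m) :: 'a::comm_ring_1 mat)"
proof (rule eq_matI)
  fix i j assume ij: "i < dim_row (1\<^sub>m (n + m) :: 'a mat)" "j < dim_col (1\<^sub>m (n + m) :: 'a mat)"
  have 1: "(\<Sum>k = 0..<n. (if i = k then 1 else 0) * (if j = k then 1 else 0))
      = (if i = j \<and> i < n then 1 else (0::'a))"
    by (simp add: if_distrib[where f = "\<lambda>x. x * _"] sum.delta cong: if_cong)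
  have "(\<Sum>k = 0..<m. (if i = n + k then 1 else 0) * (if j = n + k then 1 else 0))
      = (\<Sum>k = 0..<m. if k = i - n then (if i = j \<and> i \<ge> n then 1 else 0) else (0::'a))"
    by (intro sum.cong) auto
  then have 2: "(\<Sum>k = 0..<m. (if i = n + k then 1 else 0) * (if j = n + k then 1 else 0))
      = (if i = j \<and> i \<ge> n then 1 else (0::'a))"
    using ij by (auto simp: sum.delta')
  show "(inl n m * prl n m + inr n m * prr n m) $$ (i, j) = (1\<^sub>m (n + m) :: 'a mat) $$ (i, j)"
    using ij by (simp add: prl_def prr_def inl_def inr_def scalar_prod_def 1 2)
qed auto

lemma index_in_mult:
  fixes A :: "'a::comm_ring_1 mat"
  assumes "i < n + m" "j < dim_col A"
  shows "dim_row A = n \<Longrightarrow> (inl n m * A) $$ (i, j) = (if i < n then A $$ (i, j) else 0)"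
    and "dim_row A = m \<Longrightarrow> (inr n m * A) $$ (i, j) = (if i < n then 0 else A $$ (i - n, j))"
proof -
  show "(inl n m * A) $$ (i, j) = (if i < n then A $$ (i, j) else 0)" if "dim_row A = n"
    using assms that
    by (simp add: inl_def scalar_prod_def if_distrib[where f = "\<lambda>x. x * _"] sum.delta cong: if_cong)
  show "(inr n m * A) $$ (i, j) = (if i < n then 0 else A $$ (i - n, j))" if "dim_row A = m"
  proof -
    have "(\<Sum>k = 0..<m. (if i = n + k then 1 else 0) * A $$ (k, j))
        = (\<Sum>k = 0..<m. if k = i - n then (if i < n then 0 else A $$ (i - n, j)) else 0)"
      by (intro sum.cong) auto
    then show ?thesis
      using assms that by (auto simp: inr_def scalar_prod_def sum.delta')
  qed
qed

lemma index_mult_pr: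
  fixes A :: "'a::comm_ring_1 mat"
  assumes "i < dim_row A" "j < n + m"
  shows "dim_col A = n \<Longrightarrow> (A * prl n m) $$ (i, j) = (if j < n then A $$ (i, j) else 0)"
    and "dim_col A = m \<Longrightarrow> (A * prr n m) $$ (i, j) = (if j < n then 0 else A $$ (i, j - n))"
proof -
  \<comment> \<open>Transposition turns a projection on the right into an injection on the
    left.\<close>
  have T: "(A * B) $$ (i, j) = (transpose_mat B * transpose_mat A) $$ (j, i)"
    if "dim_col A = dim_row B" "dim_col B = n + m" for B
    using assms that by (simp flip: transpose_mult_dim)
  show "(A * prl n m) $$ (i, j) = (if j < n then A $$ (i, j) else 0)" if "dim_col A = n"
    using assms that by (simp add: T index_in_mult del: index_mult_mat(1))
  show "(A * prr n m) $$ (i, j) = (if j < n then 0 else A $$ (i, j - n))" if "dim_col A = m"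
    using assms that by (simp add: T index_in_mult del: index_mult_mat(1))
qed

text \<open>With blocks written as sums of products, block computations reduce to the four
  identities \<open>pr_in\<close>, and no case distinction on indices is left.\<close>

lemma block_diag_in_pr:
  "block_diag A B = inl (dim_row A) (dim_row B) * (A * prl (dim_col A) (dim_col B))
     + inr (dim_row A) (dim_row B) * (B * prr (dim_col A) (dim_col B))"
  by (rule eq_matI) (auto simp: block_diag_def index_in_mult index_mult_pr simp del: index_mult_mat(1))

section \<open>Linear algebra over a field\<close>

lemma add_mult_mat_vec:
  fixes A :: "'a::comm_ring_1 mat"
  shows "dim_row A = dim_row B \<Longrightarrow> dim_col A = dim_col B \<Longrightarrow> dim_col A = dim_vec v
    \<Longrightarrow> (A + B) *\<^sub>v v = A *\<^sub>v v + B *\<^sub>v v"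
  by (metis add_mult_distrib_mat_vec carrier_matI carrier_vecI)

lemma minus_mult_mat_vec:
  fixes A :: "'a::comm_ring_1 mat"
  shows "dim_row A = dim_row B \<Longrightarrow> dim_col A = dim_col B \<Longrightarrow> dim_col A = dim_vec v
    \<Longrightarrow> (A - B) *\<^sub>v v = A *\<^sub>v v - B *\<^sub>v v"
  by (metis minus_mult_distrib_mat_vec carrier_matI carrier_vecI)

lemma mult_mat_vec_add:
  fixes A :: "'a::comm_ring_1 mat"
  shows "dim_col A = dim_vec v \<Longrightarrow> dim_vec v = dim_vec w \<Longrightarrow> A *\<^sub>v (v + w) = A *\<^sub>v v + A *\<^sub>v w"
  by (metis mult_add_distrib_mat_vec carrier_matI carrier_vecI)

lemma mult_mat_vec_minus:
  fixes A :: "'a::comm_ring_1 mat"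
  shows "dim_col A = dim_vec v \<Longrightarrow> dim_vec v = dim_vec w \<Longrightarrow> A *\<^sub>v (v - w) = A *\<^sub>v v - A *\<^sub>v w"
  by (metis mult_minus_distrib_mat_vec carrier_matI carrier_vecI)

lemma mult_mat_vec_smult:
  fixes A :: "'a::comm_ring_1 mat"
  shows "dim_col A = dim_vec v \<Longrightarrow> A *\<^sub>v (k \<cdot>\<^sub>v v) = k \<cdot>\<^sub>v (A *\<^sub>v v)"
  by (rule eq_vecI) (auto simp: scalar_prod_def sum_distrib_left algebra_simps)

lemma smult_mult_mat_vec:
  fixes A :: "'a::comm_ring_1 mat"
  shows "dim_col A = dim_vec v \<Longrightarrow> (k \<cdot>\<^sub>m A) *\<^sub>v v = k \<cdot>\<^sub>v (A *\<^sub>v v)"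
  by (rule eq_vecI) (auto simp: scalar_prod_def sum_distrib_left algebra_simps)

lemma mult_mat_zero_vec:
  fixes A :: "'a::comm_ring_1 mat"
  shows "dim_col A = n \<Longrightarrow> A *\<^sub>v 0\<^sub>v n = 0\<^sub>v (dim_row A)"
  by (rule eq_vecI) auto

lemma zero_mat_mult_vec:
  "dim_vec v = m \<Longrightarrow> 0\<^sub>m n m *\<^sub>v (v :: 'a::comm_ring_1 vec) = 0\<^sub>v n"
  by (rule eq_vecI) (auto simp: scalar_prod_def)

lemma one_mult_mat_vec':
  "dim_vec v = n \<Longrightarrow> 1\<^sub>m n *\<^sub>v (v :: 'a::comm_ring_1 vec) = v"
  by (metis one_mult_mat_vec carrier_vecI)

lemmas mat_vec_simps = mult_mat_vec_assoc add_mult_mat_vec minus_mult_mat_vec mult_mat_vec_add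
  mult_mat_vec_minus mult_mat_vec_smult smult_mult_mat_vec mult_mat_zero_vec zero_mat_mult_vec
  one_mult_mat_vec'

lemma mat_eq_by_vec:
  fixes A :: "'a::comm_ring_1 mat"
  assumes "dim_row A = dim_row B" "dim_col A = dim_col B"
    and "\<And>v. v \<in> carrier_vec (dim_col A) \<Longrightarrow> A *\<^sub>v v = B *\<^sub>v v"
  shows "A = B"
proof (rule eq_matI)
  fix i j assume ij: "i < dim_row B" "j < dim_col B"
  have "A *\<^sub>v unit_vec (dim_col A) j = B *\<^sub>v unit_vec (dim_col A) j"
    using assms(3) by simp
  then have "(A *\<^sub>v unit_vec (dim_col A) j) $ i = (B *\<^sub>v unit_vec (dim_col B) j) $ i"
    using assms by simp
  then show "A $$ (i, j) = B $$ (i, j)"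
    using ij assms(1,2) by simp
qed (use assms in auto)

lemma mult_mat_vec_cong:
  fixes A :: "'a::comm_ring_1 mat"
  shows "A * B = C \<Longrightarrow> dim_col A = dim_row B \<Longrightarrow> dim_col B = dim_vec v \<Longrightarrow> A *\<^sub>v (B *\<^sub>v v) = C *\<^sub>v v"
  by (metis mult_mat_vec_assoc)

section \<open>Injective, surjective and invertible matrices\<close>

definition mat_inj :: "'a::field mat \<Rightarrow> bool" where
  "mat_inj F \<longleftrightarrow> (\<forall>v\<in>carrier_vec (dim_col F). F *\<^sub>v v = 0\<^sub>v (dim_row F) \<longrightarrow> v = 0\<^sub>v (dim_col F))"

lemma mat_injD:
  "mat_inj F \<Longrightarrow> F *\<^sub>v v = 0\<^sub>v (dim_row F) \<Longrightarrow> dim_vec v = dim_col F \<Longrightarrow> v = 0\<^sub>v (dim_col F)"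
  unfolding mat_inj_def using carrier_vecI by blast

lemma minus_vec_eq_zero:
  fixes v :: "'a::comm_ring_1 vec"
  assumes "v - w = 0\<^sub>v n" "dim_vec v = n" "dim_vec w = n"
  shows "v = w"
proof (rule eq_vecI)
  fix i assume i: "i < dim_vec w"
  have "(v - w) $ i = 0" using i assms by simp
  then show "v $ i = w $ i" using i by simp
qed (use assms in simp)

lemma mat_inj_iff_inj_on: "mat_inj F \<longleftrightarrow> inj_on (\<lambda>v. F *\<^sub>v v) (carrier_vec (dim_col F))"
proof
  assume inj: "mat_inj F"
  show "inj_on (\<lambda>v. F *\<^sub>v v) (carrier_vec (dim_col F))"
  proof (rule inj_onI)
    fix v w assume vw: "v \<in> carrier_vec (dim_col F)" "w \<in> carrier_vec (dim_col F)" "F *\<^sub>v v = F *\<^sub>v w"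
    then have "F *\<^sub>v (v - w) = 0\<^sub>v (dim_row F)"
      by (simp add: mat_vec_simps minus_cancel_vec[OF carrier_vecI])
    then have "v - w = 0\<^sub>v (dim_col F)"
      using inj vw by (auto intro: mat_injD)
    then show "v = w"
      using vw by (auto intro: minus_vec_eq_zero)
  qed
next
  assume inj: "inj_on (\<lambda>v. F *\<^sub>v v) (carrier_vec (dim_col F))"
  show "mat_inj F"
    unfolding mat_inj_def
  proof (intro ballI impI)
    fix v assume "v \<in> carrier_vec (dim_col F)" "F *\<^sub>v v = 0\<^sub>v (dim_row F)"
    then show "v = 0\<^sub>v (dim_col F)"
      using mult_mat_zero_vec[of F] inj_onD[OF inj, of v "0\<^sub>v (dim_col F)"] by simp
  qed
qed

lemma mat_inj_cancel:
  assumes "mat_inj F" "F * X = F * Y" "dim_row X = dim_col F" "dim_row Y = dim_col F" "dim_col X = dim_col Y"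
  shows "X = Y"
proof (rule mat_eq_by_vec)
  fix v :: "'a vec" assume v: "v \<in> carrier_vec (dim_col X)"
  then have "F *\<^sub>v (X *\<^sub>v v) = F *\<^sub>v (Y *\<^sub>v v)"
    using assms by (simp flip: mult_mat_vec_assoc)
  then show "X *\<^sub>v v = Y *\<^sub>v v"
    using assms v unfolding mat_inj_iff_inj_on by (elim inj_onD) (auto intro!: carrier_vecI)
qed (use assms in auto)

lemma mat_inj_if_left_inverse:
  assumes "G * F = 1\<^sub>m (dim_col F)" "dim_col G = dim_row F"
  shows "mat_inj F"
  unfolding mat_inj_def
proof (intro ballI impI)
  fix v :: "'a vec" assume v: "v \<in> carrier_vec (dim_col F)" "F *\<^sub>v v = 0\<^sub>v (dim_row F)"
  have d: "dim_row G = dim_col F"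
    using assms(1) by (metis index_mult_mat(2) index_one_mat(2))
  have "v = (G * F) *\<^sub>v v" using assms v by simp
  also have "\<dots> = G *\<^sub>v (F *\<^sub>v v)"
    using assms(2) v(1) by (simp add: mult_mat_vec_assoc del: assoc_mult_mat_vec)
  finally show "v = 0\<^sub>v (dim_col F)"
    using assms(2) v(2) d by (simp add: mult_mat_zero_vec)
qed

text \<open>With more columns than rows, padding \<open>F\<close> by zero rows gives a square matrix
  whose last row is zero. Its determinant vanishes, and a nonzero vector in its kernel is killed by
  \<open>F\<close> too.\<close>

lemma mat_inj_dim:
  fixes F :: "'a::field mat"
  assumes "mat_inj F"
  shows "dim_col F \<le> dim_row F"
proof (rule ccontr)
  assume "\<not> ?thesis"
  then have lt: "dim_row F < dim_col F" by simp
  define k where "k = dim_col F"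
  define A where "A = mat k k (\<lambda>(i, j). if i < dim_row F then F $$ (i, j) else 0)"
  have A: "A \<in> carrier_mat k k" by (simp add: A_def)
  have "transpose_mat A *\<^sub>v unit_vec k (k - 1) = 0\<^sub>v k"
    using lt by (intro eq_vecI) (auto simp: A_def k_def)
  moreover have "unit_vec k (k - 1) \<noteq> (0\<^sub>v k :: 'a vec)"
    using lt by (intro unit_vec_nonzero) (simp add: k_def)
  ultimately have "det (transpose_mat A) = 0"
    using A by (subst det_0_iff_vec_prod_zero_field[of _ k]) (auto intro!: exI[of _ "unit_vec k (k - 1)"])
  then have "det A = 0"
    using A by (simp add: det_transpose)
  then obtain v where v: "v \<in> carrier_vec k" "v \<noteq> 0\<^sub>v k" "A *\<^sub>v v = 0\<^sub>v k"
    using A det_0_iff_vec_prod_zero_field by blast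
  have "F *\<^sub>v v = 0\<^sub>v (dim_row F)"
  proof (rule eq_vecI)
    fix i assume "i < dim_vec (0\<^sub>v (dim_row F) :: 'a vec)"
    then have i: "i < dim_row F" by simp
    then have "row A i = row F i"
      using lt by (intro eq_vecI) (auto simp: A_def k_def)
    moreover have "(A *\<^sub>v v) $ i = 0"
      using v i lt by (simp add: k_def)
    ultimately show "(F *\<^sub>v v) $ i = 0\<^sub>v (dim_row F) $ i"
      using i lt by (simp add: A_def k_def)
  qed auto
  then show False
    using assms v by (auto simp: mat_inj_def k_def)
qed

lemma mat_image_iff: "v \<in> mat_image F \<longleftrightarrow> (\<exists>u\<in>carrier_vec (dim_col F). v = F *\<^sub>v u)"
  by (auto simp: mat_image_def)

text \<open>The columns of \<open>X\<close> are preimages under \<open>F\<close> of the columns of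
  \<open>B\<close>, chosen one at a time.\<close>

lemma mat_image_factor:
  fixes F :: "'a::field mat"
  assumes "mat_image B \<subseteq> mat_image F" "dim_row B = dim_row F"
  obtains X where "X \<in> carrier_mat (dim_col F) (dim_col B)" "F * X = B"
proof -
  have "\<exists>u. u \<in> carrier_vec (dim_col F) \<and> F *\<^sub>v u = B *\<^sub>v unit_vec (dim_col B) j" for j
  proof -
    have "B *\<^sub>v unit_vec (dim_col B) j \<in> mat_image F"
      using assms(1) by (auto simp: mat_image_def)
    then show ?thesis by (auto simp: mat_image_iff)
  qed
  then obtain u where u: "\<And>j. u j \<in> carrier_vec (dim_col F)"
      "\<And>j. F *\<^sub>v u j = B *\<^sub>v unit_vec (dim_col B) j"
    by metis
  define X where "X = mat (dim_col F) (dim_col B) (\<lambda>(i, j). u j $ i)"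
  have X: "col X j = u j" if "j < dim_col B" for j
    using u(1)[of j] that by (intro eq_vecI) (auto simp: X_def)
  have "F * X = B"
  proof (rule eq_matI)
    fix i j assume ij: "i < dim_row B" "j < dim_col B"
    then have "(F * X) $$ (i, j) = (F *\<^sub>v u j) $ i"
      using assms X by (simp add: X_def)
    also have "\<dots> = B $$ (i, j)"
      using ij u(2)[of j] by simp
    finally show "(F * X) $$ (i, j) = B $$ (i, j)" .
  qed (use assms in \<open>auto simp: X_def\<close>)
  then show ?thesis
    by (rule that[rotated]) (simp add: X_def)
qed

lemma right_inverse_if_surj:
  fixes F :: "'a::field mat"
  assumes "mat_image F = carrier_vec (dim_row F)"
  obtains G where "G \<in> carrier_mat (dim_col F) (dim_row F)" "F * G = 1\<^sub>m (dim_row F)"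
proof -
  have "mat_image (1\<^sub>m (dim_row F) :: 'a mat) \<subseteq> mat_image F"
    using assms by (auto simp: mat_image_def)
  then show ?thesis
    using that by (auto elim: mat_image_factor)
qed

lemma surj_if_right_inverse:
  fixes F :: "'a::field mat"
  assumes "F * G = 1\<^sub>m (dim_row F)" "dim_col F = dim_row G"
  shows "mat_image F = carrier_vec (dim_row F)"
proof -
  have c: "dim_col G = dim_row F"
    using assms by (metis index_mult_mat(3) index_one_mat(3))
  have "v \<in> mat_image F" if "v \<in> carrier_vec (dim_row F)" for v
  proof -
    have "F *\<^sub>v (G *\<^sub>v v) = v"
      using that assms c by (simp flip: mult_mat_vec_assoc)
    then show ?thesis
      using assms by (auto simp: mat_image_iff intro!: bexI[of _ "G *\<^sub>v v"] carrier_vecI)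
  qed
  then show ?thesis
    by (auto simp: mat_image_def intro!: carrier_vecI)
qed

lemma surj_dim:
  fixes F :: "'a::field mat"
  assumes "mat_image F = carrier_vec (dim_row F)"
  shows "dim_row F \<le> dim_col F"
proof -
  obtain G where "G \<in> carrier_mat (dim_col F) (dim_row F)" "F * G = 1\<^sub>m (dim_row F)"
    using assms by (rule right_inverse_if_surj)
  then have "mat_inj G"
    by (intro mat_inj_if_left_inverse[of F]) auto
  then show ?thesis
    using mat_inj_dim[of G] \<open>G \<in> _\<close> by simp
qed

lemma bij_mat_inverse:
  fixes F :: "'a::field mat"
  assumes "mat_inj F" "mat_image F = carrier_vec (dim_row F)"
  obtains G where "G \<in> carrier_mat (dim_col F) (dim_row F)" "F * G = 1\<^sub>m (dim_row F)"
    "G * F = 1\<^sub>m (dim_col F)"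
proof -
  obtain G where G: "G \<in> carrier_mat (dim_col F) (dim_row F)" "F * G = 1\<^sub>m (dim_row F)"
    using assms(2) by (rule right_inverse_if_surj)
  have d: "dim_row G = dim_col F" "dim_col G = dim_row F"
    using G(1) by blast+
  have "F * (G * F) = F * 1\<^sub>m (dim_col F)"
    using G(2) d by (simp flip: mult_mat_assoc)
  from mat_inj_cancel[OF assms(1) this] have "G * F = 1\<^sub>m (dim_col F)"
    using d by simp
  then show ?thesis
    using that G by blast
qed

section \<open>Subspaces, extension to bases and separating functionals\<close>

definition subsp :: "nat \<Rightarrow> 'a::field vec set \<Rightarrow> bool" where
  "subsp n W \<longleftrightarrow> W \<subseteq> carrier_vec n \<and> 0\<^sub>v n \<in> W \<and> (\<forall>v\<in>W. \<forall>w\<in>W. v + w \<in> W) \<and> (\<forall>x. \<forall>v\<in>W. x \<cdot>\<^sub>v v \<in> W)"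

lemma subsp_carrier: "subsp n (carrier_vec n)"
  by (auto simp: subsp_def)

lemma subsp_minus:
  assumes "subsp n W" "v \<in> W" "w \<in> W"
  shows "v - w \<in> W"
proof -
  have "v - w = v + (- 1) \<cdot>\<^sub>v w"
    using assms by (intro eq_vecI) (auto simp: subsp_def)
  then show ?thesis
    using assms by (simp add: subsp_def)
qed

definition colmat :: "'a vec \<Rightarrow> 'a mat" where
  "colmat v = mat (dim_vec v) 1 (\<lambda>(i, j). v $ i)"

lemma dim_colmat [simp]: "dim_row (colmat v) = dim_vec v" "dim_col (colmat v) = Suc 0"
  by (auto simp: colmat_def)

lemma colmat_mult_vec:
  "dim_vec y = 1 \<Longrightarrow> colmat v *\<^sub>v y = y $ 0 \<cdot>\<^sub>v (v :: 'a::comm_ring_1 vec)"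
  by (rule eq_vecI) (auto simp: colmat_def scalar_prod_def mult.commute)

definition append_col :: "'a::field mat \<Rightarrow> 'a vec \<Rightarrow> 'a mat" where
  "append_col T v = T * prl (dim_col T) (Suc 0) + colmat v * prr (dim_col T) (Suc 0)"

lemma dim_append_col [simp]:
  "dim_col (append_col T v) = Suc (dim_col T)"
  "dim_row (append_col T v) = dim_vec v"
  by (auto simp: append_col_def)

lemma append_col_mult_vec:
  assumes "dim_vec x = Suc (dim_col T)" "dim_row T = dim_vec v"
  shows "append_col T v *\<^sub>v x = T *\<^sub>v (prl (dim_col T) (Suc 0) *\<^sub>v x) + (prr (dim_col T) (Suc 0) *\<^sub>v x) $ 0 \<cdot>\<^sub>v v"
  using assms by (simp add: append_col_def mat_vec_simps colmat_mult_vec)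

lemma append_col_in [simp]:
  assumes "dim_row T = dim_vec v"
  shows "append_col T v * inl (dim_col T) (Suc 0) = T" "append_col T v * inr (dim_col T) (Suc 0) = colmat v"
  using assms by (simp_all add: append_col_def mat_simps)

lemma vec_split:
  assumes "dim_vec x = n + m"
  shows "x = inl n m *\<^sub>v (prl n m *\<^sub>v x) + inr n m *\<^sub>v (prr n m *\<^sub>v (x :: 'a::comm_ring_1 vec))"
proof -
  have "x = (inl n m * prl n m + inr n m * prr n m) *\<^sub>v x"
    using assms by (simp add: in_pr one_mult_mat_vec')
  then show ?thesis
    using assms by (simp add: mat_vec_simps)
qed

lemma mat_inj_append_col:
  assumes T: "mat_inj T" "v \<notin> mat_image T" "dim_row T = dim_vec v"
  shows "mat_inj (append_col T v)"
  unfolding mat_inj_def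
proof (intro ballI impI)
  fix x assume x: "x \<in> carrier_vec (dim_col (append_col T v))"
    "append_col T v *\<^sub>v x = 0\<^sub>v (dim_row (append_col T v))"
  define y where "y = prl (dim_col T) (Suc 0) *\<^sub>v x"
  define z where "z = prr (dim_col T) (Suc 0) *\<^sub>v x"
  have dims: "dim_vec y = dim_col T" "dim_vec z = 1" by (auto simp: y_def z_def)
  have dx: "dim_vec x = Suc (dim_col T)" using x(1) by simp
  have eq: "T *\<^sub>v y + z $ 0 \<cdot>\<^sub>v v = 0\<^sub>v (dim_vec v)"
    using x dx T by (simp add: append_col_mult_vec y_def z_def)
  have z0: "z $ 0 = 0"
  proof (rule ccontr)
    \<comment> \<open>Otherwise dividing by the last coordinate would express \<open>v\<close>
      through the columns of \<open>T\<close>.\<close>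
    assume nz: "z $ 0 \<noteq> 0"
    have "v = T *\<^sub>v ((- inverse (z $ 0)) \<cdot>\<^sub>v y)"
    proof (rule eq_vecI)
      fix i assume "i < dim_vec (T *\<^sub>v ((- inverse (z $ 0)) \<cdot>\<^sub>v y))"
      then have i: "i < dim_row T" by simp
      have "(T *\<^sub>v y + z $ 0 \<cdot>\<^sub>v v) $ i = 0"
        using eq i T by simp
      then have "(T *\<^sub>v y) $ i = - (z $ 0 * v $ i)"
        using i T by (simp add: eq_neg_iff_add_eq_0 del: index_mult_mat_vec)
      moreover have "(T *\<^sub>v ((- inverse (z $ 0)) \<cdot>\<^sub>v y)) $ i = - inverse (z $ 0) * (T *\<^sub>v y) $ i"
        using i dims by (simp add: mult_mat_vec_smult del: index_mult_mat_vec)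
      ultimately show "v $ i = (T *\<^sub>v ((- inverse (z $ 0)) \<cdot>\<^sub>v y)) $ i"
        using nz by (simp del: index_mult_mat_vec)
    qed (use T in simp)
    then show False
      using T dims by (auto simp: mat_image_iff intro!: carrier_vecI bexI[of _ "(- inverse (z $ 0)) \<cdot>\<^sub>v y"])
  qed
  then have "z = 0\<^sub>v 1"
    using dims by (intro eq_vecI) auto
  moreover have "T *\<^sub>v y = 0\<^sub>v (dim_row T)"
  proof (rule eq_vecI)
    fix i assume "i < dim_vec (0\<^sub>v (dim_row T) :: 'a vec)"
    then show "(T *\<^sub>v y) $ i = 0\<^sub>v (dim_row T) $ i"
      using arg_cong[OF eq, of "\<lambda>w. vec_index w i"] z0 T by (simp del: index_mult_mat_vec)
  qed simp
  then have "y = 0\<^sub>v (dim_col T)"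
    using T dims mat_injD by blast
  moreover have "x = inl (dim_col T) (Suc 0) *\<^sub>v y + inr (dim_col T) (Suc 0) *\<^sub>v z"
    unfolding y_def z_def by (rule vec_split) (simp add: dx)
  ultimately show "x = 0\<^sub>v (dim_col (append_col T v))"
    by (simp add: mult_mat_zero_vec)
qed

text \<open>The matrices \<open>R\<close> and \<open>L\<close> record that the columns of \<open>F\<close> are among those of \<open>T\<close>.\<close>

lemma subsp_extend:
  fixes F :: "'a::field mat"
  assumes W: "subsp n W" and F: "mat_inj F" "F \<in> carrier_mat n c" "mat_image F \<subseteq> W"
  obtains k T R L where "mat_inj T" "T \<in> carrier_mat n k" "mat_image T = W"
    "R \<in> carrier_mat k c" "L \<in> carrier_mat c k" "F = T * R" "L * R = 1\<^sub>m c"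
proof -
  define P where "P k \<longleftrightarrow> (\<exists>T R L. mat_inj T \<and> T \<in> carrier_mat n k \<and> mat_image T \<subseteq> W \<and>
    R \<in> carrier_mat k c \<and> L \<in> carrier_mat c k \<and> F = T * R \<and> L * R = 1\<^sub>m c)" for k
  have P0: "P c"
    unfolding P_def using F
    by (intro exI[of _ F] exI[of _ "1\<^sub>m c"]) auto
  have Pn: "P k \<Longrightarrow> k \<le> n" for k
    unfolding P_def using mat_inj_dim by blast
  \<comment> \<open>The longest injective extension of \<open>F\<close> inside \<open>W\<close>; its
    number of columns is at most \<open>n\<close>. A vector of \<open>W\<close> outside its image
    could be appended, so the image is all of \<open>W\<close>.\<close>
  define g where "g = Greatest P"
  have "P g"
    unfolding g_def using P0 Pn by (rule GreatestI_nat)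
  then obtain T R L where T: "mat_inj T" "T \<in> carrier_mat n g" "mat_image T \<subseteq> W"
    and RL: "R \<in> carrier_mat g c" "L \<in> carrier_mat c g" "F = T * R" "L * R = 1\<^sub>m c"
    unfolding P_def by blast
  have d: "dim_row T = n" "dim_col T = g" "dim_row R = g" "dim_col R = c" "dim_row L = c" "dim_col L = g"
    using T RL by auto
  have "v \<in> mat_image T" if v: "v \<in> W" for v
  proof (rule ccontr)
    assume nv: "v \<notin> mat_image T"
    have dv: "dim_vec v = n" using v W by (auto simp: subsp_def)
    have "append_col T v *\<^sub>v x \<in> W" if "dim_vec x = Suc g" for x
    proof -
      have "T *\<^sub>v (prl g (Suc 0) *\<^sub>v x) \<in> mat_image T"
        unfolding mat_image_def by (intro imageI carrier_vecI) (simp add: d)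
      then have "T *\<^sub>v (prl g (Suc 0) *\<^sub>v x) \<in> W"
        using T(3) by blast
      then show ?thesis
        using W v d dv that by (simp add: append_col_mult_vec subsp_def)
    qed
    then have "mat_image (append_col T v) \<subseteq> W"
      by (auto simp: mat_image_def d)
    moreover have "F = append_col T v * (inl g (Suc 0) * R)"
    proof -
      have "append_col T v * (inl g (Suc 0) * R) = (append_col T v * inl (dim_col T) (Suc 0)) * R"
        using d dv by (simp add: mult_mat_assoc)
      also have "\<dots> = T * R"
        using d dv by (subst append_col_in) simp_all
      finally show ?thesis using RL(3) by simp
    qed
    moreover have "(L * prl g (Suc 0)) * (inl g (Suc 0) * R) = 1\<^sub>m c"
      using d RL(4) by (simp add: mat_simps)
    moreover have "inl g (Suc 0) * R \<in> carrier_mat (Suc g) c" "L * prl g (Suc 0) \<in> carrier_mat c (Suc g)"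
      "append_col T v \<in> carrier_mat n (Suc g)"
      using d dv by (auto intro!: carrier_matI)
    moreover have "mat_inj (append_col T v)"
      using T(1) nv d dv by (intro mat_inj_append_col) simp_all
    ultimately have "P (Suc g)"
      unfolding P_def by blast
    then have "Suc g \<le> g"
      unfolding g_def using Pn by (rule Greatest_le_nat)
    then show False by simp
  qed
  then have "mat_image T = W"
    using T(3) by blast
  then show ?thesis
    using T RL that by blast
qed

lemma subsp_basis:
  assumes "subsp n (W :: 'a::field vec set)"
  obtains F where "mat_inj F" "dim_row F = n" "mat_image F = W"
proof -
  have "mat_inj (0\<^sub>m n 0 :: 'a mat)"
    by (auto simp: mat_inj_def intro!: eq_vecI)
  moreover have "mat_image (0\<^sub>m n 0 :: 'a mat) \<subseteq> W"
    using assms by (auto simp: mat_image_def zero_mat_mult_vec subsp_def)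
  ultimately show ?thesis
    using subsp_extend[OF assms, of "0\<^sub>m n 0" 0] that by (metis carrier_matD(1) zero_carrier_mat)
qed

text \<open>Complete the columns of \<open>F\<close> to a basis \<open>T\<close> of the whole space.
  With \<open>F = T * R\<close> and \<open>L * R = 1\<close>, the product of \<open>L\<close> and
  the inverse of \<open>T\<close> is a left inverse.\<close>

lemma left_inverse_if_inj:
  fixes F :: "'a::field mat"
  assumes "mat_inj F" "F \<in> carrier_mat n c"
  obtains G where "G \<in> carrier_mat c n" "G * F = 1\<^sub>m c"
proof -
  have "mat_image F \<subseteq> carrier_vec n"
    using assms(2) by (auto simp: mat_image_def intro!: carrier_vecI)
  then obtain k T R L where T: "mat_inj T" "T \<in> carrier_mat n k" "mat_image T = carrier_vec n"
    and RL: "R \<in> carrier_mat k c" "L \<in> carrier_mat c k" "F = T * R" "L * R = 1\<^sub>m c"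
    using subsp_extend[OF subsp_carrier assms] by metis
  have d: "dim_row T = n" "dim_col T = k" "dim_row R = k" "dim_col R = c" "dim_row L = c" "dim_col L = k"
    using T RL by auto
  obtain S where S: "S \<in> carrier_mat k n" "S * T = 1\<^sub>m k"
    using bij_mat_inverse[of T] T d by metis
  have dS: "dim_row S = k" "dim_col S = n" using S by auto
  have "S * F = (S * T) * R"
    unfolding RL(3) by (simp add: mult_mat_assoc d dS)
  then have "S * F = R"
    by (simp add: S(2) d)
  moreover have "dim_row F = n" using assms by simp
  ultimately have "(L * S) * F = 1\<^sub>m c"
    using RL(4) by (simp add: mult_mat_assoc d dS)
  moreover have "L * S \<in> carrier_mat c n"
    by (rule carrier_matI) (simp_all add: d dS)
  ultimately show ?thesis
    using that by blast
qed

text \<open>Append \<open>v\<close> to a basis of \<open>W\<close>; the last row of a left inverse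
  of the resulting matrix is the functional. It serves twice: to produce maximal submodules and to
  recover a subspace from its annihilator.\<close>

lemma separating_functional:
  assumes W: "subsp n (W :: 'a::field vec set)" and v: "v \<in> carrier_vec n" "v \<notin> W"
  obtains f where "f \<in> carrier_vec n" "\<And>w. w \<in> W \<Longrightarrow> f \<bullet> w = 0" "f \<bullet> v = 1"
proof -
  obtain F where F: "mat_inj F" "dim_row F = n" "mat_image F = W"
    using W by (rule subsp_basis)
  have "mat_inj (append_col F v)"
    using F v by (intro mat_inj_append_col) auto
  then obtain G where G: "G \<in> carrier_mat (Suc (dim_col F)) n" "G * append_col F v = 1\<^sub>m (Suc (dim_col F))"
    by (rule left_inverse_if_inj) (use v in \<open>auto intro!: carrier_matI\<close>)
  define H where "H = prr (dim_col F) (Suc 0) * G"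
  have H: "H \<in> carrier_mat 1 n" "H * append_col F v = prr (dim_col F) (Suc 0)"
    using G v by (auto simp: H_def mult_mat_assoc)
  have dv: "dim_row F = dim_vec v" using F v by simp
  have HF: "H * F = 0\<^sub>m 1 (dim_col F)" and Hv: "H * colmat v = 1\<^sub>m 1"
  proof -
    have "H * F = (H * append_col F v) * inl (dim_col F) (Suc 0)"
      using H(1) v dv by (simp add: mult_mat_assoc)
    then show "H * F = 0\<^sub>m 1 (dim_col F)" by (simp add: H(2))
    have "H * colmat v = (H * append_col F v) * inr (dim_col F) (Suc 0)"
      using H(1) v dv by (simp add: mult_mat_assoc)
    then show "H * colmat v = 1\<^sub>m 1" by (simp add: H(2))
  qed
  show ?thesis
  proof
    show "row H 0 \<in> carrier_vec n"
      using H by auto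
    show "row H 0 \<bullet> w = 0" if w: "w \<in> W" for w
    proof -
      obtain u where u: "u \<in> carrier_vec (dim_col F)" "w = F *\<^sub>v u"
        using w F by (auto simp: mat_image_iff)
      have "H *\<^sub>v w = 0\<^sub>v 1"
        using H(1) F u HF by (simp add: zero_mat_mult_vec flip: mult_mat_vec_assoc)
      then have "(H *\<^sub>v w) $ 0 = 0" by simp
      then show ?thesis using H by simp
    qed
    have "(H * colmat v) $$ (0, 0) = 1" by (simp add: Hv)
    moreover have "col (colmat v) 0 = v"
      by (intro eq_vecI) (auto simp: colmat_def)
    ultimately show "row H 0 \<bullet> v = 1"
      using H by simp
  qed
qed

section \<open>Modules, homomorphisms and direct sums\<close>

text \<open>Only the shapes are recorded. Composing and inverting homomorphisms uses nothing else,
  and for direct sums and tensor products the shapes are immediate.\<close>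

definition wf_rep :: "'k::field d4_rep \<Rightarrow> bool" where
  "wf_rep M \<longleftrightarrow> op_a M \<in> carrier_mat (rdim M) (rdim M) \<and> op_b M \<in> carrier_mat (rdim M) (rdim M)
     \<and> op_c M \<in> carrier_mat (rdim M) (rdim M) \<and> op_d M \<in> carrier_mat (rdim M) (rdim M)"

lemma wf_rep_dims [simp]:
  assumes "wf_rep M"
  shows "dim_row (op_a M) = rdim M" "dim_col (op_a M) = rdim M"
    "dim_row (op_b M) = rdim M" "dim_col (op_b M) = rdim M"
    "dim_row (op_c M) = rdim M" "dim_col (op_c M) = rdim M"
    "dim_row (op_d M) = rdim M" "dim_col (op_d M) = rdim M"
  using assms by (auto simp: wf_rep_def)

lemma wf_repI:
  assumes "dim_row (op_a M) = rdim M" "dim_col (op_a M) = rdim M"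
    "dim_row (op_b M) = rdim M" "dim_col (op_b M) = rdim M"
    "dim_row (op_c M) = rdim M" "dim_col (op_c M) = rdim M"
    "dim_row (op_d M) = rdim M" "dim_col (op_d M) = rdim M"
  shows "wf_rep M"
  unfolding wf_rep_def using assms by (intro conjI carrier_matI)

lemma d4_module_wf: "d4_module M \<Longrightarrow> wf_rep M"
  by (simp add: d4_module_def wf_rep_def Let_def)

lemma d4_moduleI:
  assumes "wf_rep M"
    "op_b M * op_a M = - (op_a M * op_b M)" "op_d M * op_b M = - (op_b M * op_d M)"
    "op_c M * op_a M = - (op_a M * op_c M)" "op_d M * op_c M = - (op_c M * op_d M)"
    "op_b M * op_c M = op_c M * op_b M" "op_a M * op_a M = 0\<^sub>m (rdim M) (rdim M)"
    "op_b M * op_b M = 1\<^sub>m (rdim M)" "op_c M * op_c M = 1\<^sub>m (rdim M)"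
    "op_d M * op_d M = 0\<^sub>m (rdim M) (rdim M)"
    "op_d M * op_a M + op_a M * op_d M = 1\<^sub>m (rdim M) - op_b M * op_c M"
  shows "d4_module M"
  using assms by (simp add: d4_module_def wf_rep_def Let_def)

text \<open>The relations are oriented towards the ordered monomials in b, c, a, d, each with
  exponent 0 or 1. These 16 monomials are the standard basis of the algebra.\<close>

lemma d4_relations:
  assumes "d4_module M"
  shows "op_a M * op_b M = - (op_b M * op_a M)" "op_d M * op_b M = - (op_b M * op_d M)"
    "op_a M * op_c M = - (op_c M * op_a M)" "op_d M * op_c M = - (op_c M * op_d M)"
    "op_c M * op_b M = op_b M * op_c M" "op_a M * op_a M = 0\<^sub>m (rdim M) (rdim M)"
    "op_b M * op_b M = 1\<^sub>m (rdim M)" "op_c M * op_c M = 1\<^sub>m (rdim M)"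
    "op_d M * op_d M = 0\<^sub>m (rdim M) (rdim M)"
    "op_d M * op_a M = 1\<^sub>m (rdim M) - op_b M * op_c M - op_a M * op_d M"
proof -
  note wf = wf_rep_dims[OF d4_module_wf[OF assms]]
  have eqs: "op_b M * op_a M = - (op_a M * op_b M)" "op_c M * op_a M = - (op_a M * op_c M)"
    "op_d M * op_a M + op_a M * op_d M = 1\<^sub>m (rdim M) - op_b M * op_c M"
    using assms by (simp_all add: d4_module_def Let_def)
  show "op_d M * op_b M = - (op_b M * op_d M)" "op_d M * op_c M = - (op_c M * op_d M)"
    "op_c M * op_b M = op_b M * op_c M" "op_a M * op_a M = 0\<^sub>m (rdim M) (rdim M)"
    "op_b M * op_b M = 1\<^sub>m (rdim M)" "op_c M * op_c M = 1\<^sub>m (rdim M)"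
    "op_d M * op_d M = 0\<^sub>m (rdim M) (rdim M)"
    using assms by (simp_all add: d4_module_def Let_def)
  show "op_a M * op_b M = - (op_b M * op_a M)" "op_a M * op_c M = - (op_c M * op_a M)"
    by (simp_all add: eqs uminus_uminus_mat)
  have "op_d M * op_a M = (op_d M * op_a M + op_a M * op_d M) - op_a M * op_d M"
    by (rule eq_matI) (auto simp: wf simp del: index_mult_mat(1))
  then show "op_d M * op_a M = 1\<^sub>m (rdim M) - op_b M * op_c M - op_a M * op_d M"
    by (simp add: eqs)
qed

lemma d4_relations_mult:
  assumes M: "d4_module M" and X: "dim_row X = rdim M"
  shows "op_a M * (op_b M * X) = - (op_b M * (op_a M * X))"
    "op_d M * (op_b M * X) = - (op_b M * (op_d M * X))"
    "op_a M * (op_c M * X) = - (op_c M * (op_a M * X))"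
    "op_d M * (op_c M * X) = - (op_c M * (op_d M * X))"
    "op_c M * (op_b M * X) = op_b M * (op_c M * X)"
    "op_a M * (op_a M * X) = 0\<^sub>m (rdim M) (dim_col X)"
    "op_b M * (op_b M * X) = X" "op_c M * (op_c M * X) = X"
    "op_d M * (op_d M * X) = 0\<^sub>m (rdim M) (dim_col X)"
    "op_d M * (op_a M * X) = X - op_b M * (op_c M * X) - op_a M * (op_d M * X)"
  using wf_rep_dims[OF d4_module_wf[OF M]] X
  by (simp_all add: mult_mat_cong[OF d4_relations(1)[OF M]] mult_mat_cong[OF d4_relations(2)[OF M]]
      mult_mat_cong[OF d4_relations(3)[OF M]] mult_mat_cong[OF d4_relations(4)[OF M]]
      mult_mat_cong[OF d4_relations(5)[OF M]] mult_mat_cong[OF d4_relations(6)[OF M]]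
      mult_mat_cong[OF d4_relations(7)[OF M]] mult_mat_cong[OF d4_relations(8)[OF M]]
      mult_mat_cong[OF d4_relations(9)[OF M]] mult_mat_cong[OF d4_relations(10)[OF M]] mat_simps)

lemma d4_homD:
  assumes "d4_hom M N F"
  shows "dim_row F = rdim N" "dim_col F = rdim M"
    "F * op_a M = op_a N * F" "F * op_b M = op_b N * F" "F * op_c M = op_c N * F" "F * op_d M = op_d N * F"
  using assms by (auto simp: d4_hom_def)

lemma d4_homI:
  assumes "dim_row F = rdim N" "dim_col F = rdim M"
    "F * op_a M = op_a N * F" "F * op_b M = op_b N * F" "F * op_c M = op_c N * F" "F * op_d M = op_d N * F"
  shows "d4_hom M N F"
  unfolding d4_hom_def using assms by (intro conjI carrier_matI)

lemma d4_hom_mult: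
  assumes F: "d4_hom M N F" and wf: "wf_rep M" "wf_rep N" and X: "dim_row X = rdim M"
  shows "F * (op_a M * X) = op_a N * (F * X)" "F * (op_b M * X) = op_b N * (F * X)"
    "F * (op_c M * X) = op_c N * (F * X)" "F * (op_d M * X) = op_d N * (F * X)"
  using d4_homD[OF F] wf X
  by (simp_all add: mult_mat_cong[OF d4_homD(3)[OF F]] mult_mat_cong[OF d4_homD(4)[OF F]]
      mult_mat_cong[OF d4_homD(5)[OF F]] mult_mat_cong[OF d4_homD(6)[OF F]] mult_mat_assoc)

lemma d4_hom_comp:
  assumes "d4_hom M N F" "d4_hom N L G" "wf_rep M" "wf_rep N" "wf_rep L"
  shows "d4_hom M L (G * F)"
  using d4_homD[OF assms(1)] d4_homD[OF assms(2)] assms(3-5) d4_hom_mult[OF assms(2,4,5)]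
  by (intro d4_homI) (simp_all add: mult_mat_assoc)

lemma d4_hom_id: "wf_rep M \<Longrightarrow> d4_hom M M (1\<^sub>m (rdim M))"
  by (intro d4_homI) simp_all

lemma d4_hom_inverse:
  assumes F: "d4_hom M N F" and wf: "wf_rep M" "wf_rep N"
    and G: "G \<in> carrier_mat (rdim M) (rdim N)" "G * F = 1\<^sub>m (rdim M)" "F * G = 1\<^sub>m (rdim N)"
  shows "d4_hom N M G"
proof -
  have dG: "dim_row G = rdim M" "dim_col G = rdim N" using G by auto
  note dF = d4_homD(1,2)[OF F]
  have *: "G * Y = X * G" if "F * X = Y * F" "X \<in> carrier_mat (rdim M) (rdim M)" "Y \<in> carrier_mat (rdim N) (rdim N)"
    for X Y
  proof -
    have d: "dim_row X = rdim M" "dim_col X = rdim M" "dim_row Y = rdim N" "dim_col Y = rdim N"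
      using that by auto
    have "G * Y = G * (Y * (F * G))" using d by (simp add: G)
    also have "\<dots> = G * ((F * X) * G)" using d dG dF by (simp add: that(1) mult_mat_assoc)
    also have "\<dots> = (G * F) * (X * G)" using d dG dF by (simp add: mult_mat_assoc)
    also have "\<dots> = X * G" using d dG by (simp add: G)
    finally show ?thesis .
  qed
  show ?thesis
    using wf d4_homD[OF F] by (intro d4_homI * dG) (simp_all add: wf_rep_def)
qed

lemma d4_isoI:
  assumes "d4_hom M N F" "wf_rep M" "wf_rep N"
    and "G \<in> carrier_mat (rdim M) (rdim N)" "G * F = 1\<^sub>m (rdim M)" "F * G = 1\<^sub>m (rdim N)"
  shows "M \<cong>\<^sub>D N"
  unfolding d4_iso_def using assms d4_hom_inverse[OF assms] by blast

lemma d4_iso_refl: "wf_rep M \<Longrightarrow> M \<cong>\<^sub>D M"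
  by (rule d4_isoI[OF d4_hom_id, of M "1\<^sub>m (rdim M)"]) auto

lemma d4_iso_sym: "M \<cong>\<^sub>D N \<Longrightarrow> N \<cong>\<^sub>D M"
  by (auto simp: d4_iso_def)

lemma d4_iso_trans:
  assumes "M \<cong>\<^sub>D N" "N \<cong>\<^sub>D L" "wf_rep M" "wf_rep N" "wf_rep L"
  shows "M \<cong>\<^sub>D L"
proof -
  obtain F G where FG: "d4_hom M N F" "d4_hom N M G" "G * F = 1\<^sub>m (rdim M)" "F * G = 1\<^sub>m (rdim N)"
    using assms(1) by (auto simp: d4_iso_def)
  obtain F' G' where FG': "d4_hom N L F'" "d4_hom L N G'" "G' * F' = 1\<^sub>m (rdim N)" "F' * G' = 1\<^sub>m (rdim L)"
    using assms(2) by (auto simp: d4_iso_def)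
  note d = d4_homD(1,2)[OF FG(1)] d4_homD(1,2)[OF FG(2)] d4_homD(1,2)[OF FG'(1)] d4_homD(1,2)[OF FG'(2)]
  have "d4_hom M L (F' * F)" "d4_hom L M (G * G')"
    using FG FG' assms by (auto intro: d4_hom_comp)
  moreover have "(G * G') * (F' * F) = 1\<^sub>m (rdim M)" "(F' * F) * (G * G') = 1\<^sub>m (rdim L)"
    using d FG FG' by (simp_all add: mult_mat_assoc mult_mat_cong[OF FG(4)] mult_mat_cong[OF FG'(3)])
  ultimately show ?thesis
    unfolding d4_iso_def by blast
qed

section \<open>Direct sums of modules\<close>

lemma dim_block_diag [simp]:
  "dim_row (block_diag A B) = dim_row A + dim_row B"
  "dim_col (block_diag A B) = dim_col A + dim_col B"
  by (simp_all add: block_diag_def)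

lemma block_diag_mult:
  fixes A :: "'k::field mat"
  assumes "dim_col A = dim_row C" "dim_col B = dim_row D"
  shows "block_diag A B * block_diag C D = block_diag (A * C) (B * D)"
  using assms by (simp add: block_diag_in_pr mat_simps)

lemma block_diag_one: "block_diag (1\<^sub>m n) (1\<^sub>m m) = (1\<^sub>m (n + m) :: 'k::field mat)"
  by (simp add: block_diag_in_pr in_pr)

lemma wf_dsum: "wf_rep M \<Longrightarrow> wf_rep N \<Longrightarrow> wf_rep (M \<oplus>\<^sub>D N)"
  by (rule wf_repI) (simp_all add: dsum_def)

lemma d4_iso_dsum:
  assumes "M \<cong>\<^sub>D M'" "N \<cong>\<^sub>D N'" "wf_rep M" "wf_rep M'" "wf_rep N" "wf_rep N'"
  shows "M \<oplus>\<^sub>D N \<cong>\<^sub>D M' \<oplus>\<^sub>D N'"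
proof -
  obtain F G where FG: "d4_hom M M' F" "d4_hom M' M G" "G * F = 1\<^sub>m (rdim M)" "F * G = 1\<^sub>m (rdim M')"
    using assms(1) by (auto simp: d4_iso_def)
  obtain F' G' where FG': "d4_hom N N' F'" "d4_hom N' N G'" "G' * F' = 1\<^sub>m (rdim N)" "F' * G' = 1\<^sub>m (rdim N')"
    using assms(2) by (auto simp: d4_iso_def)
  note d = d4_homD[OF FG(1)] d4_homD[OF FG(2)] d4_homD[OF FG'(1)] d4_homD[OF FG'(2)]
  have "d4_hom (M \<oplus>\<^sub>D N) (M' \<oplus>\<^sub>D N') (block_diag F F')"
    using d assms(3-6) by (intro d4_homI) (simp_all add: dsum_def block_diag_mult)
  moreover have "d4_hom (M' \<oplus>\<^sub>D N') (M \<oplus>\<^sub>D N) (block_diag G G')"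
    using d assms(3-6) by (intro d4_homI) (simp_all add: dsum_def block_diag_mult)
  moreover have "block_diag G G' * block_diag F F' = 1\<^sub>m (rdim (M \<oplus>\<^sub>D N))"
    "block_diag F F' * block_diag G G' = 1\<^sub>m (rdim (M' \<oplus>\<^sub>D N'))"
    using d FG FG' by (simp_all add: dsum_def block_diag_mult block_diag_one)
  ultimately show ?thesis
    unfolding d4_iso_def by blast
qed

lemma wf_zero_rep: "wf_rep zero_rep"
  by (rule wf_repI) (simp_all add: zero_rep_def)

lemma wf_copies: "wf_rep M \<Longrightarrow> wf_rep (copies n M)"
  by (induction n) (simp_all add: wf_dsum wf_zero_rep)

lemma dim_mat_of_rows_list [simp]:
  "dim_row (mat_of_rows_list n xs) = length xs" "dim_col (mat_of_rows_list n xs) = n"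
  by (simp_all add: mat_of_rows_list_def)

lemma wf_V2: "wf_rep (V2 r)"
  by (rule wf_repI) (simp_all add: V2_def)

section \<open>Tensor products with the two-dimensional simple modules\<close>

lemma zsgn_simps [simp]:
  "zsgn r * zsgn r = (1::'k::field)" "zsgn (r + 1) = (- zsgn r :: 'k)" "zsgn 0 = (1::'k)" "zsgn 1 = (-1::'k)"
  "zsgn r * (zsgn r * x) = (x::'k)"
  by (cases r; simp add: zsgn_def)+

lemma zsgn_add: "zsgn (r + e) = zsgn r * (zsgn e :: 'k::field)"
  by (cases r; cases e) (simp_all add: zsgn_def)

text \<open>\<open>V2mult r b\<close> is the sum of copies of \<open>V2 r\<close> and \<open>V2 (r + 1)\<close>
  with multiplicity space \<open>k\<^sup>n\<close>, an eigenvector of \<open>b\<close> with eigenvalue \<open>zsgn e\<close>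
  spanning the multiplicity space of a copy of \<open>V2 (r + e)\<close>.\<close>

definition V2mult :: "bit \<Rightarrow> 'k::field mat \<Rightarrow> 'k d4_rep" where
  "V2mult r b = (let n = dim_row b in \<lparr>rdim = n + n,
     op_a = inr n n * prl n n,
     op_b = zsgn r \<cdot>\<^sub>m block_diag b (- b),
     op_c = zsgn r \<cdot>\<^sub>m block_diag (- b) b,
     op_d = 2 \<cdot>\<^sub>m (inl n n * prr n n)\<rparr>)"

lemma wf_V2mult: "dim_col b = dim_row b \<Longrightarrow> wf_rep (V2mult r b)"
  by (rule wf_repI) (simp_all add: V2mult_def Let_def)

lemma kron_two:
  fixes A B :: "'k::field mat"
  assumes "A \<in> carrier_mat 2 2" "B \<in> carrier_mat n m"
  shows "kron A B = A $$ (0, 0) \<cdot>\<^sub>m (inl n n * (B * prl m m)) + A $$ (0, 1) \<cdot>\<^sub>m (inl n n * (B * prr m m))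
    + A $$ (1, 0) \<cdot>\<^sub>m (inr n n * (B * prl m m)) + A $$ (1, 1) \<cdot>\<^sub>m (inr n n * (B * prr m m))"
proof -
  have q: "i div n = (if i < n then 0 else 1)" "i mod n = (if i < n then i else i - n)" if "i < n + n" for i n :: nat
    using that by (auto simp: div_if mod_if)
  show ?thesis
    using assms
    by (intro eq_matI) (auto simp: kron_def q index_in_mult index_mult_pr mult_2 numeral_2_eq_2 simp del: index_mult_mat(1))
qed

lemma kron_dims [simp]:
  "dim_row (kron A B) = dim_row A * dim_row B" "dim_col (kron A B) = dim_col A * dim_col B"
  by (simp_all add: kron_def)

lemma wf_tensor: "wf_rep M \<Longrightarrow> wf_rep N \<Longrightarrow> wf_rep (M \<otimes>\<^sub>D N)"
  by (rule wf_repI) (simp_all add: tensor_def)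

lemma tensor_V2_simps:
  fixes N :: "'k::field d4_rep"
  assumes "wf_rep N"
  defines "n \<equiv> rdim N"
  shows "op_a (V2 r \<otimes>\<^sub>D N) = inr n n * (op_b N * prl n n) + inl n n * (op_a N * prl n n) + inr n n * (op_a N * prr n n)"
    "op_d (V2 r \<otimes>\<^sub>D N) = 2 \<cdot>\<^sub>m (inl n n * (op_c N * prr n n)) + inl n n * (op_d N * prl n n) + inr n n * (op_d N * prr n n)"
    "op_b (V2 r \<otimes>\<^sub>D N) = zsgn r \<cdot>\<^sub>m (inl n n * (op_b N * prl n n)) - zsgn r \<cdot>\<^sub>m (inr n n * (op_b N * prr n n))"
    "op_c (V2 r \<otimes>\<^sub>D N) = zsgn r \<cdot>\<^sub>m (inr n n * (op_c N * prr n n)) - zsgn r \<cdot>\<^sub>m (inl n n * (op_c N * prl n n))"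
    "rdim (V2 r \<otimes>\<^sub>D N) = n + n"
proof -
  have C: "op_a (V2 r) \<in> carrier_mat 2 2" "op_b (V2 r) \<in> carrier_mat 2 2" "op_c (V2 r) \<in> carrier_mat 2 2"
    "op_d (V2 r) \<in> carrier_mat 2 2" "1\<^sub>m 2 \<in> carrier_mat 2 2"
    using wf_V2[of r] by (auto simp: wf_rep_def V2_def)
  have E: "op_a (V2 r) $$ (0, 0) = (0::'k)" "op_a (V2 r) $$ (0, Suc 0) = (0::'k)"
    "op_a (V2 r) $$ (Suc 0, 0) = (1::'k)" "op_a (V2 r) $$ (Suc 0, Suc 0) = (0::'k)"
    "op_d (V2 r) $$ (0, 0) = (0::'k)" "op_d (V2 r) $$ (0, Suc 0) = (2::'k)"
    "op_d (V2 r) $$ (Suc 0, 0) = (0::'k)" "op_d (V2 r) $$ (Suc 0, Suc 0) = (0::'k)"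
    "op_b (V2 r) $$ (0, 0) = (zsgn r::'k)" "op_b (V2 r) $$ (0, Suc 0) = (0::'k)"
    "op_b (V2 r) $$ (Suc 0, 0) = (0::'k)" "op_b (V2 r) $$ (Suc 0, Suc 0) = (- zsgn r::'k)"
    "op_c (V2 r) $$ (0, 0) = (- zsgn r::'k)" "op_c (V2 r) $$ (0, Suc 0) = (0::'k)"
    "op_c (V2 r) $$ (Suc 0, 0) = (0::'k)" "op_c (V2 r) $$ (Suc 0, Suc 0) = (zsgn r::'k)"
    by (simp_all add: V2_def mat_of_rows_list_def)
  have O: "op_a N \<in> carrier_mat n n" "op_b N \<in> carrier_mat n n" "op_c N \<in> carrier_mat n n" "op_d N \<in> carrier_mat n n"
    using assms by (auto simp: wf_rep_def)
  have r2: "rdim (V2 r :: 'k d4_rep) = 2" by (simp add: V2_def)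
  have d: "dim_row (op_a N) = n" "dim_col (op_a N) = n" "dim_row (op_b N) = n" "dim_col (op_b N) = n"
    "dim_row (op_c N) = n" "dim_col (op_c N) = n" "dim_row (op_d N) = n" "dim_col (op_d N) = n"
    using O by auto
  show "op_a (V2 r \<otimes>\<^sub>D N) = inr n n * (op_b N * prl n n) + inl n n * (op_a N * prl n n) + inr n n * (op_a N * prr n n)"
    unfolding tensor_def d4_rep.simps r2 kron_two[OF C(1) O(2)] kron_two[OF C(5) O(1)]
    by (rule eq_matI) (simp_all add: E d del: index_mult_mat(1))
  show "op_d (V2 r \<otimes>\<^sub>D N) = 2 \<cdot>\<^sub>m (inl n n * (op_c N * prr n n)) + inl n n * (op_d N * prl n n) + inr n n * (op_d N * prr n n)"
    unfolding tensor_def d4_rep.simps r2 kron_two[OF C(4) O(3)] kron_two[OF C(5) O(4)]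
    by (rule eq_matI) (simp_all add: E d del: index_mult_mat(1))
  show "op_b (V2 r \<otimes>\<^sub>D N) = zsgn r \<cdot>\<^sub>m (inl n n * (op_b N * prl n n)) - zsgn r \<cdot>\<^sub>m (inr n n * (op_b N * prr n n))"
    unfolding tensor_def d4_rep.simps r2 kron_two[OF C(2) O(2)]
    by (rule eq_matI) (simp_all add: E d del: index_mult_mat(1))
  show "op_c (V2 r \<otimes>\<^sub>D N) = zsgn r \<cdot>\<^sub>m (inr n n * (op_c N * prr n n)) - zsgn r \<cdot>\<^sub>m (inl n n * (op_c N * prl n n))"
    unfolding tensor_def d4_rep.simps r2 kron_two[OF C(3) O(3)]
    by (rule eq_matI) (simp_all add: E d del: index_mult_mat(1))
  show "rdim (V2 r \<otimes>\<^sub>D N) = n + n"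
    by (simp add: tensor_def r2 n_def)
qed

text \<open>The kernel of \<open>d\<close> on \<open>V(2,r) \<otimes> N\<close> consists of the vectors
  \<open>v\<^sub>1 \<otimes> x - v\<^sub>2 \<otimes> b d x / 2\<close>; these are the first columns of \<open>F\<close>, and \<open>a\<close> maps them to the second ones.\<close>

lemma tensor_V2_iso_V2mult:
  fixes N :: "'k::field d4_rep"
  assumes two: "(2::'k) \<noteq> 0" and N: "d4_module N" "op_c N = op_b N"
  shows "V2 r \<otimes>\<^sub>D N \<cong>\<^sub>D V2mult r (op_b N)"
proof -
  define n a b d where "n = rdim N" and "a = op_a N" and "b = op_b N" and "d = op_d N"
  note wfN = d4_module_wf[OF N(1)]
  have dims: "dim_row a = n" "dim_col a = n" "dim_row b = n" "dim_col b = n" "dim_row d = n" "dim_col d = n"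
    using wfN by (simp_all add: n_def a_def b_def d_def)
  note T = tensor_V2_simps[OF wfN, of r, folded n_def a_def d_def, unfolded N(2), folded b_def]
  note rel = d4_relations(1-4,6-)[OF N(1), folded n_def a_def d_def, unfolded N(2), folded b_def]
    d4_relations_mult(1-4,6-)[OF N(1), folded n_def a_def d_def, unfolded N(2), folded b_def]
  define F where "F = inl n n * prl n n + inl n n * (a * prr n n)
    + inr n n * ((- (1/2) \<cdot>\<^sub>m (b * d)) * prl n n) + inr n n * ((b - (1/2) \<cdot>\<^sub>m (a * (b * d))) * prr n n)"
  \<comment> \<open>As c = b gives d a = - a d, \<open>F\<close> factors as a unitriangular matrix
    with the block - b d / 2 below the diagonal, times the upper triangular matrix with first row 1,
    a and second row 0, b. \<open>G\<close> is the product of the two inverses in reverse order, b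
    being its own inverse.\<close>
  define G where "G = (inl n n * prl n n - inl n n * (a * (b * prr n n)) + inr n n * (b * prr n n))
    * (1\<^sub>m (n + n) + (1/2) \<cdot>\<^sub>m (inr n n * (b * (d * prl n n))))"
  let ?D = "V2mult r b"
  have D: "op_a ?D = inr n n * prl n n" "op_d ?D = 2 \<cdot>\<^sub>m (inl n n * prr n n)"
    "op_b ?D = zsgn r \<cdot>\<^sub>m (inl n n * (b * prl n n)) - zsgn r \<cdot>\<^sub>m (inr n n * (b * prr n n))"
    "op_c ?D = zsgn r \<cdot>\<^sub>m (inr n n * (b * prr n n)) - zsgn r \<cdot>\<^sub>m (inl n n * (b * prl n n))"
    "rdim ?D = n + n"
    using dims by (auto simp: V2mult_def Let_def block_diag_in_pr mat_simps intro!: eq_matI simp del: index_mult_mat(1))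
  note S = mat_simps dims rel
  have "d4_hom ?D (V2 r \<otimes>\<^sub>D N) F"
  proof (rule d4_homI)
    show "F * op_a ?D = op_a (V2 r \<otimes>\<^sub>D N) * F"
      unfolding T D F_def
      by (rule eq_matI; simp add: S del: index_mult_mat(1); simp add: field_simps two)
    show "F * op_b ?D = op_b (V2 r \<otimes>\<^sub>D N) * F"
      unfolding T D F_def
      by (rule eq_matI; simp add: S del: index_mult_mat(1); simp add: field_simps two)
    show "F * op_c ?D = op_c (V2 r \<otimes>\<^sub>D N) * F"
      unfolding T D F_def
      by (rule eq_matI; simp add: S del: index_mult_mat(1); simp add: field_simps two)
    show "F * op_d ?D = op_d (V2 r \<otimes>\<^sub>D N) * F"
      unfolding T D F_def
      by (rule eq_matI; simp add: S del: index_mult_mat(1); simp add: field_simps two)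
  qed (simp_all add: T D F_def dims)
  moreover have "G * F = 1\<^sub>m (rdim ?D)"
    unfolding D in_pr[symmetric] F_def G_def
    by (rule eq_matI; simp add: S del: index_mult_mat(1); simp add: field_simps two)
  moreover have "F * G = 1\<^sub>m (rdim (V2 r \<otimes>\<^sub>D N))"
    unfolding T in_pr[symmetric] F_def G_def
    by (rule eq_matI; simp add: S del: index_mult_mat(1); simp add: field_simps two)
  moreover have "wf_rep ?D" "wf_rep (V2 r \<otimes>\<^sub>D N)"
    using wfN dims by (simp_all add: wf_V2mult wf_tensor wf_V2)
  moreover have "G \<in> carrier_mat (rdim ?D) (rdim (V2 r \<otimes>\<^sub>D N))"
    by (rule carrier_matI) (simp_all add: D T G_def dims)
  ultimately have "?D \<cong>\<^sub>D V2 r \<otimes>\<^sub>D N"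
    by (blast intro: d4_isoI)
  then show ?thesis
    unfolding b_def by (rule d4_iso_sym)
qed


text \<open>A change of basis of the multiplicity space acts in the same way on its two copies, so
  it commutes with a and d. Hence only the similarity class of \<open>b\<close> matters, and
  \<open>b\<close> may be diagonalized.\<close>

lemma V2mult_similar:
  fixes b :: "'k::field mat"
  assumes b: "b \<in> carrier_mat n n" "b' \<in> carrier_mat m m" "b * F = F * b'"
    and F: "F \<in> carrier_mat n m" "G \<in> carrier_mat m n" "G * F = 1\<^sub>m m" "F * G = 1\<^sub>m n"
  shows "V2mult r b \<cong>\<^sub>D V2mult r b'"
proof -
  have d: "dim_row b = n" "dim_col b = n" "dim_row b' = m" "dim_col b' = m"
    "dim_row F = n" "dim_col F = m" "dim_row G = m" "dim_col G = n"
    using b F by auto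
  have "d4_hom (V2mult r b') (V2mult r b) (block_diag F F)"
    by (intro d4_homI)
      (simp_all add: V2mult_def Let_def d block_diag_in_pr mat_simps b(3) mult_mat_cong[OF b(3)])
  moreover have "block_diag G G * block_diag F F = 1\<^sub>m (rdim (V2mult r b'))"
    "block_diag F F * block_diag G G = 1\<^sub>m (rdim (V2mult r b))"
    by (simp_all add: V2mult_def Let_def d block_diag_mult F block_diag_one)
  moreover have "block_diag G G \<in> carrier_mat (rdim (V2mult r b')) (rdim (V2mult r b))"
    by (rule carrier_matI) (simp_all add: V2mult_def Let_def d)
  moreover have "wf_rep (V2mult r b)" "wf_rep (V2mult r b')"
    using d by (simp_all add: wf_V2mult)
  ultimately have "V2mult r b' \<cong>\<^sub>D V2mult r b"
    by (blast intro: d4_isoI)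
  then show ?thesis
    by (rule d4_iso_sym)
qed

lemma V2mult_block_diag:
  fixes b1 :: "'k::field mat"
  assumes "b1 \<in> carrier_mat n n" "b2 \<in> carrier_mat m m"
  shows "V2mult r (block_diag b1 b2) \<cong>\<^sub>D V2mult r b1 \<oplus>\<^sub>D V2mult r b2"
proof -
  have d: "dim_row b1 = n" "dim_col b1 = n" "dim_row b2 = m" "dim_col b2 = m"
    using assms by auto
  \<comment> \<open>\<open>T\<close> rearranges blocks of sizes n, n, m, m into the order n, m, n,
    m, and \<open>T'\<close> undoes this.\<close>
  define T :: "'k mat" where "T =
      inl (n + m) (n + m) * (inl n m * (prl n n * prl (n + n) (m + m)))
    + inl (n + m) (n + m) * (inr n m * (prl m m * prr (n + n) (m + m)))
    + inr (n + m) (n + m) * (inl n m * (prr n n * prl (n + n) (m + m)))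
    + inr (n + m) (n + m) * (inr n m * (prr m m * prr (n + n) (m + m)))"
  define T' :: "'k mat" where "T' =
      inl (n + n) (m + m) * (inl n n * (prl n m * prl (n + m) (n + m)))
    + inr (n + n) (m + m) * (inl m m * (prr n m * prl (n + m) (n + m)))
    + inl (n + n) (m + m) * (inr n n * (prl n m * prr (n + m) (n + m)))
    + inr (n + n) (m + m) * (inr m m * (prr n m * prr (n + m) (n + m)))"
  have dT: "dim_row T = (n + m) + (n + m)" "dim_col T = (n + n) + (m + m)"
    "dim_row T' = (n + n) + (m + m)" "dim_col T' = (n + m) + (n + m)"
    by (simp_all add: T_def T'_def)
  have c: "T \<in> carrier_mat (2 * (n + m)) (2 * (n + m))" "T' \<in> carrier_mat (2 * (n + m)) (2 * (n + m))"
    by (auto intro!: carrier_matI simp: dT)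
  have "T * T' = inl (n + m) (n + m) * ((inl n m * prl n m + inr n m * prr n m) * prl (n + m) (n + m))
    + inr (n + m) (n + m) * ((inl n m * prl n m + inr n m * prr n m) * prr (n + m) (n + m))"
    unfolding T_def T'_def
    by (rule eq_matI; simp add: mat_simps del: index_mult_mat(1))
  also have "\<dots> = 1\<^sub>m (2 * (n + m))"
    by (simp only: right_mult_one_mat' left_mult_one_mat' dim_in_pr in_pr mult_2[symmetric])
  finally have TT: "T * T' = 1\<^sub>m (2 * (n + m))" .
  then have TT': "T' * T = 1\<^sub>m (2 * (n + m))"
    using mat_mult_left_right_inverse c by blast
  have "d4_hom (V2mult r b1 \<oplus>\<^sub>D V2mult r b2) (V2mult r (block_diag b1 b2)) T"
    unfolding T_def
    by (intro d4_homI; (rule eq_matI)?;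
        simp add: V2mult_def Let_def dsum_def d block_diag_in_pr mat_simps del: index_mult_mat(1))
  moreover have "rdim (V2mult r b1 \<oplus>\<^sub>D V2mult r b2) = 2 * (n + m)"
    "rdim (V2mult r (block_diag b1 b2)) = 2 * (n + m)"
    by (simp_all add: V2mult_def Let_def dsum_def d)
  moreover have "wf_rep (V2mult r b1 \<oplus>\<^sub>D V2mult r b2)" "wf_rep (V2mult r (block_diag b1 b2))"
    using d by (simp_all add: wf_V2mult wf_dsum)
  ultimately have "V2mult r b1 \<oplus>\<^sub>D V2mult r b2 \<cong>\<^sub>D V2mult r (block_diag b1 b2)"
    using TT TT' c by (intro d4_isoI[of _ _ T T']) simp_all
  then show ?thesis
    by (rule d4_iso_sym)
qed

lemma V2mult_scalar:
  "V2mult r (zsgn e \<cdot>\<^sub>m 1\<^sub>m n :: 'k::field mat) \<cong>\<^sub>D copies n (V2 (r + e))"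
proof (induction n)
  case 0
  have "V2mult r (zsgn e \<cdot>\<^sub>m 1\<^sub>m 0 :: 'k mat) = zero_rep"
    by (auto simp: V2mult_def zero_rep_def Let_def intro!: eq_matI)
  then show ?case
    by (simp add: d4_iso_refl wf_zero_rep)
next
  case (Suc n)
  \<comment> \<open>For a one-dimensional multiplicity space the two sides are equal as records, so
    a summand can be split off by rewriting.\<close>
  have 1: "V2mult r (zsgn e \<cdot>\<^sub>m 1\<^sub>m 1 :: 'k mat) = V2 (r + e)"
  proof -
    have "block_diag (zsgn e \<cdot>\<^sub>m 1\<^sub>m 1 :: 'k mat) (- (zsgn e \<cdot>\<^sub>m 1\<^sub>m 1)) = mat_of_rows_list 2 [[zsgn e, 0], [0, - zsgn e]]"
      "block_diag (- (zsgn e \<cdot>\<^sub>m 1\<^sub>m 1 :: 'k mat)) (zsgn e \<cdot>\<^sub>m 1\<^sub>m 1) = mat_of_rows_list 2 [[- zsgn e, 0], [0, zsgn e]]"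
      by (rule eq_matI; auto simp: block_diag_def mat_of_rows_list_def less_2_cases_iff)+
    moreover have "inr 1 1 * prl 1 1 = (mat_of_rows_list 2 [[0, 0], [1, 0]] :: 'k mat)"
      "inl 1 1 * prr 1 1 = (mat_of_rows_list 2 [[0, 1], [0, 0]] :: 'k mat)"
      by (rule eq_matI; auto simp: inr_def inl_def prl_def prr_def scalar_prod_def mat_of_rows_list_def
          numeral_2_eq_2 less_Suc_eq)+
    ultimately show ?thesis
      by (auto simp: V2mult_def V2_def Let_def zsgn_add mat_of_rows_list_def numeral_2_eq_2 less_Suc_eq
          intro!: eq_matI)
  qed
  have 2: "(zsgn e \<cdot>\<^sub>m 1\<^sub>m (Suc n) :: 'k mat) = block_diag (zsgn e \<cdot>\<^sub>m 1\<^sub>m 1) (zsgn e \<cdot>\<^sub>m 1\<^sub>m n)"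
    by (rule eq_matI) (auto simp: block_diag_def)
  have "V2mult r (zsgn e \<cdot>\<^sub>m 1\<^sub>m (Suc n) :: 'k mat) \<cong>\<^sub>D V2 (r + e) \<oplus>\<^sub>D V2mult r (zsgn e \<cdot>\<^sub>m 1\<^sub>m n)"
    unfolding 2 1[symmetric] by (intro V2mult_block_diag) auto
  moreover have "V2 (r + e) \<oplus>\<^sub>D V2mult r (zsgn e \<cdot>\<^sub>m 1\<^sub>m n :: 'k mat) \<cong>\<^sub>D V2 (r + e) \<oplus>\<^sub>D copies n (V2 (r + e))"
    by (intro d4_iso_dsum Suc.IH d4_iso_refl wf_V2mult wf_copies wf_V2) simp_all
  ultimately show ?case
    unfolding copies.simps
    by (rule d4_iso_trans) (simp_all add: wf_V2mult wf_dsum wf_copies wf_V2)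
qed

text \<open>The columns of \<open>F\<close> are a basis of \<open>N\<close> of eigenvectors of b,
  and such a basis diagonalizes the multiplicity space. All three parts of the theorem end with this
  lemma; what remains in each case is to find the basis.\<close>

lemma tensor_V2_decomposition:
  fixes N :: "'k::field d4_rep"
  assumes two: "(2::'k) \<noteq> 0" and N: "d4_module N" "op_c N = op_b N"
    and F: "F \<in> carrier_mat (rdim N) (p + q)" "G \<in> carrier_mat (p + q) (rdim N)"
      "G * F = 1\<^sub>m (p + q)" "F * G = 1\<^sub>m (rdim N)"
    and b: "op_b N * F = F * block_diag (zsgn e \<cdot>\<^sub>m 1\<^sub>m p) (zsgn (e + 1) \<cdot>\<^sub>m 1\<^sub>m q)"
  shows "V2 r \<otimes>\<^sub>D N \<cong>\<^sub>D copies p (V2 (r + e)) \<oplus>\<^sub>D copies q (V2 (r + e + 1))"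
proof -
  let ?b1 = "zsgn e \<cdot>\<^sub>m 1\<^sub>m p :: 'k mat" and ?b2 = "zsgn (e + 1) \<cdot>\<^sub>m 1\<^sub>m q :: 'k mat"
  note wf = wf_V2 wf_tensor wf_dsum wf_copies wf_V2mult d4_module_wf[OF N(1)]
  have w: "wf_rep (V2mult r (op_b N))" "wf_rep (V2 r \<otimes>\<^sub>D N)" "wf_rep (V2mult r (block_diag ?b1 ?b2))"
    "wf_rep (V2mult r ?b1 \<oplus>\<^sub>D V2mult r ?b2)"
    "wf_rep (copies p (V2 (r + e)) \<oplus>\<^sub>D copies q (V2 (r + (e + 1))) :: 'k d4_rep)"
    by (simp_all add: wf)
  have 1: "V2 r \<otimes>\<^sub>D N \<cong>\<^sub>D V2mult r (op_b N)"
    using two N by (rule tensor_V2_iso_V2mult)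
  have 2: "V2mult r (op_b N) \<cong>\<^sub>D V2mult r (block_diag ?b1 ?b2)"
    using d4_module_wf[OF N(1)]
    by (intro V2mult_similar[OF _ _ b F(1,2,3,4)]) (auto simp: wf_rep_def intro!: carrier_matI)
  have 3: "V2mult r (block_diag ?b1 ?b2) \<cong>\<^sub>D V2mult r ?b1 \<oplus>\<^sub>D V2mult r ?b2"
    by (rule V2mult_block_diag) auto
  have 4: "V2mult r ?b1 \<oplus>\<^sub>D V2mult r ?b2 \<cong>\<^sub>D copies p (V2 (r + e)) \<oplus>\<^sub>D copies q (V2 (r + (e + 1)))"
    by (intro d4_iso_dsum V2mult_scalar wf) simp_all
  have "V2 r \<otimes>\<^sub>D N \<cong>\<^sub>D copies p (V2 (r + e)) \<oplus>\<^sub>D copies q (V2 (r + (e + 1)))"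
    using d4_iso_trans[OF d4_iso_trans[OF d4_iso_trans[OF 1 2] 3] 4] w by blast
  then show ?thesis
    by (simp add: add.assoc)
qed

section \<open>Uniqueness of syzygies\<close>

lemma mat_kernel_iff: "v \<in> mat_kernel F \<longleftrightarrow> v \<in> carrier_vec (dim_col F) \<and> F *\<^sub>v v = 0\<^sub>v (dim_row F)"
  by (auto simp: mat_kernel_def)

lemma d4_mono_iff: "d4_mono M N F \<longleftrightarrow> d4_hom M N F \<and> mat_inj F"
  by (auto simp: d4_mono_def mat_inj_iff_inj_on d4_homD)

lemma submodule_subsp: "submodule M W \<Longrightarrow> subsp (rdim M) W"
  by (auto simp: submodule_def subsp_def)

lemma submoduleI:
  assumes "subsp (rdim M) W" "\<And>v. v \<in> W \<Longrightarrow> op_a M *\<^sub>v v \<in> W" "\<And>v. v \<in> W \<Longrightarrow> op_b M *\<^sub>v v \<in> W"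
    "\<And>v. v \<in> W \<Longrightarrow> op_c M *\<^sub>v v \<in> W" "\<And>v. v \<in> W \<Longrightarrow> op_d M *\<^sub>v v \<in> W"
  shows "submodule M W"
  using assms by (simp add: submodule_def subsp_def)

lemma submodule_closed:
  assumes "submodule M W"
  shows "v \<in> W \<Longrightarrow> op_a M *\<^sub>v v \<in> W" "v \<in> W \<Longrightarrow> op_b M *\<^sub>v v \<in> W"
    "v \<in> W \<Longrightarrow> op_c M *\<^sub>v v \<in> W" "v \<in> W \<Longrightarrow> op_d M *\<^sub>v v \<in> W"
    "v \<in> W \<Longrightarrow> w \<in> W \<Longrightarrow> v + w \<in> W" "v \<in> W \<Longrightarrow> w \<in> W \<Longrightarrow> v - w \<in> W"
    "v \<in> W \<Longrightarrow> x \<cdot>\<^sub>v v \<in> W" "0\<^sub>v (rdim M) \<in> W" "v \<in> W \<Longrightarrow> dim_vec v = rdim M"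
  using assms subsp_minus[OF submodule_subsp[OF assms]] by (auto simp: submodule_def)

lemma subsp_mat_image: "subsp (dim_row F) (mat_image F)"
proof -
  have "0\<^sub>v (dim_row F) = F *\<^sub>v 0\<^sub>v (dim_col F)"
    by (simp add: mult_mat_zero_vec)
  then have "0\<^sub>v (dim_row F) \<in> mat_image F"
    unfolding mat_image_iff by (metis zero_carrier_vec)
  moreover have "F *\<^sub>v u + F *\<^sub>v u' = F *\<^sub>v (u + u')" "x \<cdot>\<^sub>v (F *\<^sub>v u) = F *\<^sub>v (x \<cdot>\<^sub>v u)"
    if "u \<in> carrier_vec (dim_col F)" "u' \<in> carrier_vec (dim_col F)" for u u' x
    using that by (simp_all add: mat_vec_simps)
  ultimately show ?thesis
    unfolding subsp_def mat_image_def by (auto intro!: carrier_vecI)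
qed

lemma submodule_image:
  assumes F: "d4_hom M N F" and wf: "wf_rep M" "wf_rep N"
  shows "submodule N (mat_image F)"
proof (rule submoduleI)
  show "subsp (rdim N) (mat_image F)"
    using subsp_mat_image[of F] d4_homD(1)[OF F] by simp
  have *: "Y *\<^sub>v v \<in> mat_image F"
    if v: "v \<in> mat_image F" and FX: "F * X = Y * F" "dim_row X = rdim M" "dim_col X = rdim M" "dim_col Y = rdim N"
    for v X Y
  proof -
    obtain u where u: "u \<in> carrier_vec (dim_col F)" "v = F *\<^sub>v u"
      using v unfolding mat_image_iff by blast
    have "Y *\<^sub>v v = (Y * F) *\<^sub>v u"
      using u FX(4) d4_homD[OF F] by (simp add: mult_mat_vec_assoc)
    also have "\<dots> = F *\<^sub>v (X *\<^sub>v u)"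
      using u FX(2,3) d4_homD[OF F] unfolding FX(1)[symmetric] by (simp add: mult_mat_vec_assoc)
    finally have "Y *\<^sub>v v = F *\<^sub>v (X *\<^sub>v u)" .
    moreover have "X *\<^sub>v u \<in> carrier_vec (dim_col F)"
      using FX(2) d4_homD(2)[OF F] by (intro carrier_vecI) simp
    ultimately show ?thesis
      unfolding mat_image_iff by blast
  qed
  show "op_a N *\<^sub>v v \<in> mat_image F" "op_b N *\<^sub>v v \<in> mat_image F"
    "op_c N *\<^sub>v v \<in> mat_image F" "op_d N *\<^sub>v v \<in> mat_image F" if "v \<in> mat_image F" for v
    using that wf by (auto intro: *[OF _ d4_homD(3)[OF F]] *[OF _ d4_homD(4)[OF F]]
      *[OF _ d4_homD(5)[OF F]] *[OF _ d4_homD(6)[OF F]])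
qed

lemma hom_on_kernel:
  assumes F: "d4_hom M N F" and wf: "wf_rep M" "wf_rep N"
    and v: "dim_vec v = rdim M" "F *\<^sub>v v = 0\<^sub>v (rdim N)"
  shows "F *\<^sub>v (op_a M *\<^sub>v v) = 0\<^sub>v (rdim N)" "F *\<^sub>v (op_b M *\<^sub>v v) = 0\<^sub>v (rdim N)"
    "F *\<^sub>v (op_c M *\<^sub>v v) = 0\<^sub>v (rdim N)" "F *\<^sub>v (op_d M *\<^sub>v v) = 0\<^sub>v (rdim N)"
  using v wf d4_homD(1,2)[OF F]
  by (simp_all add: mult_mat_vec_cong[OF d4_homD(3)[OF F]] mult_mat_vec_cong[OF d4_homD(4)[OF F]]
      mult_mat_vec_cong[OF d4_homD(5)[OF F]] mult_mat_vec_cong[OF d4_homD(6)[OF F]]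
      mult_mat_vec_assoc mult_mat_zero_vec)

lemma submodule_kernel:
  assumes F: "d4_hom M N F" and wf: "wf_rep M" "wf_rep N"
  shows "submodule M (mat_kernel F)"
proof (rule submoduleI)
  show "subsp (rdim M) (mat_kernel F)"
    unfolding subsp_def mat_kernel_def using d4_homD(1,2)[OF F]
    by (auto simp: mat_vec_simps)
qed (use hom_on_kernel[OF F wf] d4_homD(1,2)[OF F] wf in \<open>auto simp: mat_kernel_iff intro!: carrier_vecI\<close>)

lemma projective_cover_lift:
  assumes P: "projective P" "d4_epi P M f" and M: "d4_module M" and Q: "projective_cover M Q q"
  obtains h where "d4_hom P Q h" "q * h = f" "mat_image h = mspace Q"
proof -
  have Q': "d4_module Q" "d4_epi Q M q" "superfluous Q (mat_kernel q)"
    using Q by (auto simp: projective_cover_def projective_def)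
  have f: "d4_hom P M f" "mat_image f = mspace M" and q: "d4_hom Q M q" "mat_image q = mspace M"
    using P(2) Q'(2) by (auto simp: d4_epi_def)
  obtain h where h: "d4_hom P Q h" "q * h = f"
    using P(1) M Q' f unfolding projective_def by blast
  have wf: "wf_rep P" "wf_rep Q" "wf_rep M"
    using P(1) Q' M by (auto simp: projective_def d4_module_wf)
  have "submodule Q (mat_image h)"
    using h(1) wf by (intro submodule_image)
  moreover have "{w + u | w u. w \<in> mat_image h \<and> u \<in> mat_kernel q} = mspace Q"
  proof (intro equalityI subsetI)
    fix v assume "v \<in> {w + u | w u. w \<in> mat_image h \<and> u \<in> mat_kernel q}"
    then show "v \<in> mspace Q"
      using d4_homD(2)[OF q(1)] by (auto simp: mat_kernel_iff intro!: carrier_vecI)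
  next
    fix v assume v: "v \<in> mspace Q"
    have "q *\<^sub>v v \<in> mat_image f"
      unfolding f(2) using d4_homD(1)[OF q(1)] by (intro carrier_vecI) simp
    then obtain u where u: "u \<in> carrier_vec (dim_col f)" "q *\<^sub>v v = f *\<^sub>v u"
      unfolding mat_image_iff by blast
    have du: "dim_vec u = rdim P" using u(1) d4_homD(2)[OF f(1)] by simp
    have "q *\<^sub>v (h *\<^sub>v u) = f *\<^sub>v u"
      using du d4_homD(1,2)[OF h(1)] d4_homD(1,2)[OF q(1)] by (simp flip: h(2) add: mult_mat_vec_assoc)
    then have "v - h *\<^sub>v u \<in> mat_kernel q"
      using v u(2) d4_homD(1,2)[OF h(1)] d4_homD(1,2)[OF q(1)] d4_homD(1,2)[OF f(1)]
      by (auto simp: mat_kernel_iff mat_vec_simps intro!: carrier_vecI eq_vecI)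
    moreover have "h *\<^sub>v u \<in> mat_image h"
      unfolding mat_image_def using du d4_homD(2)[OF h(1)] by (intro imageI carrier_vecI) simp
    moreover have "v = h *\<^sub>v u + (v - h *\<^sub>v u)"
      using v d4_homD(1)[OF h(1)] by (intro eq_vecI) auto
    ultimately show "v \<in> {w + u | w u. w \<in> mat_image h \<and> u \<in> mat_kernel q}"
      by blast
  qed
  ultimately have "mat_image h = mspace Q"
    using Q'(3) by (auto simp: superfluous_def)
  then show ?thesis
    using h that by blast
qed

lemma d4_hom_cancel_mono:
  assumes i: "d4_hom N Q i" "mat_inj i" and h: "d4_hom L Q (i * t)" "t \<in> carrier_mat (rdim N) (rdim L)"
    and wf: "wf_rep L" "wf_rep N" "wf_rep Q"
  shows "d4_hom L N t"
proof -
  have d: "dim_row t = rdim N" "dim_col t = rdim L" using h(2) by auto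
  note di = d4_homD[OF i(1)]
  have *: "t * X = Y * t" if "i * t * X = Z * (i * t)" "i * Y = Z * i" "dim_row X = rdim L" "dim_col X = rdim L"
    "dim_row Y = rdim N" "dim_col Y = rdim N" "dim_col Z = rdim Q" for X Y Z
  proof (rule mat_inj_cancel[OF i(2)])
    have "i * (t * X) = Z * (i * t)"
      using that(1,3) d di by (simp add: mult_mat_assoc)
    also have "\<dots> = i * (Y * t)"
      using that d di by (simp add: mult_mat_cong[OF that(2)] mult_mat_assoc)
    finally show "i * (t * X) = i * (Y * t)" .
  qed (use that d di in simp_all)
  show ?thesis
    using wf by (intro d4_homI d *[OF d4_homD(3)[OF h(1)] di(3)] *[OF d4_homD(4)[OF h(1)] di(4)]
      *[OF d4_homD(5)[OF h(1)] di(5)] *[OF d4_homD(6)[OF h(1)] di(6)]) simp_all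
qed

lemma mono_factor:
  assumes i: "d4_mono N Q i" and F: "d4_hom L Q F" and im: "mat_image F \<subseteq> mat_image i"
    and wf: "wf_rep L" "wf_rep N" "wf_rep Q"
  obtains t where "d4_hom L N t" "i * t = F"
proof -
  have i': "d4_hom N Q i" "mat_inj i" using i by (auto simp: d4_mono_iff)
  obtain t where t: "t \<in> carrier_mat (dim_col i) (dim_col F)" "i * t = F"
    using mat_image_factor[OF im] d4_homD(1)[OF i'(1)] d4_homD(1)[OF F] by metis
  have "d4_hom L N t"
    using F t d4_homD(2)[OF i'(1)] d4_homD(2)[OF F]
    by (intro d4_hom_cancel_mono[OF i' _ _ wf]) simp_all
  then show ?thesis using t that by blast
qed

lemma surj_square_inverse:
  fixes h :: "'k::field mat"
  assumes "mat_image h = carrier_vec n" "dim_row h = n" "dim_col h = n"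
  obtains g where "g \<in> carrier_mat n n" "h * g = 1\<^sub>m n" "g * h = 1\<^sub>m n"
proof -
  obtain g where g: "g \<in> carrier_mat n n" "h * g = 1\<^sub>m n"
    using right_inverse_if_surj[of h] assms by metis
  moreover have "h \<in> carrier_mat n n"
    using assms by (intro carrier_matI) auto
  ultimately show ?thesis
    using mat_mult_left_right_inverse that by blast
qed

lemma iso_epi:
  assumes "d4_hom M M0 \<phi>" "\<psi> * \<phi> = 1\<^sub>m (rdim M)" "\<phi> * \<psi> = 1\<^sub>m (rdim M0)" "d4_hom M0 M \<psi>"
    and p: "d4_epi P M p" and wf: "wf_rep P" "wf_rep M" "wf_rep M0"
  shows "d4_epi P M0 (\<phi> * p)"
proof -
  have p': "d4_hom P M p" "mat_image p = mspace M" using p by (auto simp: d4_epi_def)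
  note d = d4_homD(1,2)[OF assms(1)] d4_homD(1,2)[OF p'(1)] d4_homD(1,2)[OF assms(4)]
  obtain g where g: "g \<in> carrier_mat (dim_col p) (dim_row p)" "p * g = 1\<^sub>m (dim_row p)"
    using right_inverse_if_surj[of p] p'(2) d by auto
  have "(\<phi> * p) * (g * \<psi>) = 1\<^sub>m (rdim M0)"
    using g(1) d by (simp add: mult_mat_assoc mult_mat_cong[OF g(2)] assms(3))
  then have "mat_image (\<phi> * p) = mspace M0"
    using surj_if_right_inverse[of "\<phi> * p" "g * \<psi>"] d g(1) by simp
  then show ?thesis
    using d4_hom_comp[OF p'(1) assms(1) wf] by (simp add: d4_epi_def)
qed

text \<open>Both lifts \<open>h\<close> and \<open>k\<close> are onto, so the two covers have the
  same dimension and \<open>h\<close> is invertible. It restricts to the kernels, and so does its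
  inverse. Isomorphic rather than equal modules are allowed because iterated syzygies are known only
  up to isomorphism.\<close>

lemma syzygy_unique:
  assumes iso: "M \<cong>\<^sub>D M0" and M: "d4_module M" "d4_module M0"
    and P: "projective_cover M P p" "represents_sub P (mat_kernel p) N"
    and Q: "projective_cover M0 Q q" "represents_sub Q (mat_kernel q) L"
  shows "N \<cong>\<^sub>D L"
proof -
  obtain \<phi> \<psi> where iso': "d4_hom M M0 \<phi>" "d4_hom M0 M \<psi>" "\<psi> * \<phi> = 1\<^sub>m (rdim M)" "\<phi> * \<psi> = 1\<^sub>m (rdim M0)"
    using iso by (auto simp: d4_iso_def)
  have P': "projective P" "d4_epi P M p" "d4_module P" and Q': "projective Q" "d4_epi Q M0 q" "d4_module Q"
    using P(1) Q(1) by (auto simp: projective_cover_def projective_def)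
  obtain i where N: "d4_module N" "d4_mono N P i" "mat_image i = mat_kernel p"
    using P(2) by (auto simp: represents_sub_def)
  obtain j where L: "d4_module L" "d4_mono L Q j" "mat_image j = mat_kernel q"
    using Q(2) by (auto simp: represents_sub_def)
  have wf: "wf_rep M" "wf_rep M0" "wf_rep P" "wf_rep Q" "wf_rep N" "wf_rep L"
    using M P' Q' N L by (auto intro: d4_module_wf)
  have p: "d4_hom P M p" and q: "d4_hom Q M0 q" using P' Q' by (auto simp: d4_epi_def)
  have i: "d4_hom N P i" "mat_inj i" and j: "d4_hom L Q j" "mat_inj j"
    using N L by (auto simp: d4_mono_iff)
  obtain h where h: "d4_hom P Q h" "q * h = \<phi> * p" "mat_image h = mspace Q"
    using projective_cover_lift[OF P'(1) iso_epi[OF iso'(1,3,4,2) P'(2)] M(2) Q(1)] wf by blast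
  obtain k where k: "d4_hom Q P k" "p * k = \<psi> * q" "mat_image k = mspace P"
    using projective_cover_lift[OF Q'(1) iso_epi[OF iso'(2,4,3,1) Q'(2)] M(1) P(1)] wf by blast
  note d = d4_homD(1,2)[OF iso'(1)] d4_homD(1,2)[OF iso'(2)] d4_homD(1,2)[OF p] d4_homD(1,2)[OF q]
    d4_homD(1,2)[OF h(1)] d4_homD(1,2)[OF k(1)] d4_homD(1,2)[OF i(1)] d4_homD(1,2)[OF j(1)]
  have "rdim Q \<le> rdim P" "rdim P \<le> rdim Q"
    using surj_dim[of h] surj_dim[of k] h(3) k(3) d by auto
  then have PQ: "rdim P = rdim Q" by simp
  obtain g where g: "g \<in> carrier_mat (rdim Q) (rdim Q)" "h * g = 1\<^sub>m (rdim Q)" "g * h = 1\<^sub>m (rdim Q)"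
    using surj_square_inverse[OF h(3)] d PQ by auto
  have dg: "dim_row g = rdim Q" "dim_col g = rdim Q" using g by auto
  have g_hom: "d4_hom Q P g"
    using d4_hom_inverse[OF h(1) wf(3,4), of g] g PQ by simp
  have pg: "p * g = \<psi> * q"
  proof -
    have "p * g = (\<psi> * \<phi>) * (p * g)" using d dg PQ by (simp add: iso')
    also have "\<dots> = \<psi> * ((\<phi> * p) * g)" using d dg PQ by (simp add: mult_mat_assoc)
    also have "\<dots> = \<psi> * (q * (h * g))" unfolding h(2)[symmetric] using d dg PQ by (simp add: mult_mat_assoc)
    also have "\<dots> = \<psi> * q" using d by (simp add: g)
    finally show ?thesis .
  qed
  have restrict: "mat_image (F * i') \<subseteq> mat_kernel q'"
    if R: "q' * F = \<chi> * p'" "mat_image i' = mat_kernel p'" "dim_col F = dim_row i'" "dim_col q' = dim_row F"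
      "dim_col \<chi> = dim_row p'" "dim_col p' = dim_row i'" "dim_row q' = dim_row \<chi>"
    for F i' q' p' and \<chi> :: "'a mat"
  proof
    fix v assume "v \<in> mat_image (F * i')"
    then obtain u where "u \<in> carrier_vec (dim_col (F * i'))" "v = (F * i') *\<^sub>v u"
      unfolding mat_image_iff by blast
    then have u: "dim_vec u = dim_col i'" "v = F *\<^sub>v (i' *\<^sub>v u)"
      using R(3) by (simp_all add: mult_mat_vec_assoc)
    have "i' *\<^sub>v u \<in> mat_kernel p'"
      unfolding R(2)[symmetric] mat_image_def using u by (intro imageI carrier_vecI) simp
    then have z: "p' *\<^sub>v (i' *\<^sub>v u) = 0\<^sub>v (dim_row p')" by (simp add: mat_kernel_iff)
    have "q' *\<^sub>v v = \<chi> *\<^sub>v (p' *\<^sub>v (i' *\<^sub>v u))"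
      unfolding u(2) using R u by (simp add: mult_mat_vec_cong[OF R(1)] mult_mat_vec_assoc)
    then have "q' *\<^sub>v v = 0\<^sub>v (dim_row q')"
      using R by (simp add: z mult_mat_zero_vec)
    then show "v \<in> mat_kernel q'"
      unfolding mat_kernel_iff using R(4) u(2) by (auto intro!: carrier_vecI)
  qed
  obtain t where t: "d4_hom N L t" "j * t = h * i"
  proof (rule mono_factor[OF L(2) d4_hom_comp[OF i(1) h(1)]])
    show "mat_image (h * i) \<subseteq> mat_image j"
      unfolding L(3) by (rule restrict[OF h(2) N(3)]) (use d in simp_all)
  qed (use wf in auto)
  obtain t' where t': "d4_hom L N t'" "i * t' = g * j"
  proof (rule mono_factor[OF N(2) d4_hom_comp[OF j(1) g_hom]])
    show "mat_image (g * j) \<subseteq> mat_image i"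
      unfolding N(3) by (rule restrict[OF pg L(3)]) (use d dg PQ in simp_all)
  qed (use wf in auto)
  note dt = d4_homD(1,2)[OF t(1)] d4_homD(1,2)[OF t'(1)]
  have it: "i * (t' * t) = i * 1\<^sub>m (rdim N)"
    using d dt dg PQ by (simp add: mult_mat_cong[OF t'(2)] mult_mat_assoc t(2) mult_mat_cong[OF g(3)])
  have tt: "t' * t = 1\<^sub>m (rdim N)"
    by (rule mat_inj_cancel[OF i(2) it]) (simp_all add: d dt)
  have jt: "j * (t * t') = j * 1\<^sub>m (rdim L)"
    using d dt dg PQ by (simp add: mult_mat_cong[OF t(2)] mult_mat_assoc t'(2) mult_mat_cong[OF g(2)])
  have "t * t' = 1\<^sub>m (rdim L)"
    by (rule mat_inj_cancel[OF j(2) jt]) (simp_all add: d dt)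
  then show ?thesis
    unfolding d4_iso_def using t t' tt by blast
qed

section \<open>Syzygies of the one-dimensional modules\<close>

text \<open>\<open>jn n x y\<close> embeds \<open>k\<^sup>n\<close> into the direct sum of four copies of it,
  which are indexed by the exponents of \<open>d\<close> and \<open>a\<close> in the basis \<open>1, a, d, a d\<close>.\<close>

definition jn :: "nat \<Rightarrow> bool \<Rightarrow> bool \<Rightarrow> 'k::comm_ring_1 mat" where
  "jn n x y = (if x then inr (n + n) (n + n) else inl (n + n) (n + n)) * (if y then inr n n else inl n n)"

definition en :: "nat \<Rightarrow> bool \<Rightarrow> bool \<Rightarrow> 'k::comm_ring_1 mat" where
  "en n x y = transpose_mat (jn n x y)"

abbreviation "j_1 n \<equiv> jn n False False"
abbreviation "j_a n \<equiv> jn n False True"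
abbreviation "j_d n \<equiv> jn n True False"
abbreviation "j_ad n \<equiv> jn n True True"
abbreviation "e_1 n \<equiv> en n False False"
abbreviation "e_a n \<equiv> en n False True"
abbreviation "e_d n \<equiv> en n True False"
abbreviation "e_ad n \<equiv> en n True True"

lemma dim_jn_en [simp]:
  "dim_row (jn n x y) = n + n + (n + n)" "dim_col (jn n x y) = n"
  "dim_row (en n x y) = n" "dim_col (en n x y) = n + n + (n + n)"
  by (simp_all add: jn_def en_def)

lemma en_jn [simp]:
  "en n x y * jn n x' y' = (if x = x' \<and> y = y' then 1\<^sub>m n else 0\<^sub>m n n :: 'k::comm_ring_1 mat)"
  by (cases x; cases y; cases x'; cases y')
    (simp_all add: jn_def en_def transpose_mult_dim mat_simps)

lemma en_jn_mult [simp]: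
  fixes X :: "'k::comm_ring_1 mat"
  assumes "dim_row X = n"
  shows "en n x y * (jn n x' y' * X) = (if x = x' \<and> y = y' then X else 0\<^sub>m n (dim_col X))"
  using assms by (simp flip: mult_mat_assoc)

lemma jn_en_sum:
  "j_1 n * e_1 n + j_a n * e_a n
    + j_d n * e_d n + j_ad n * e_ad n
    = (1\<^sub>m (n + n + (n + n)) :: 'k::comm_ring_1 mat)"
proof -
  have "j_1 n * e_1 n + j_a n * e_a n
      + j_d n * e_d n + j_ad n * e_ad n
    = inl (n + n) (n + n) * ((inl n n * prl n n + inr n n * prr n n) * prl (n + n) (n + n))
      + inr (n + n) (n + n) * ((inl n n * prl n n + inr n n * prr n n) * prr (n + n) (n + n) :: 'k mat)"
    by (rule eq_matI; simp add: jn_def en_def transpose_mult_dim mat_simps del: index_mult_mat(1))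
  also have "\<dots> = 1\<^sub>m (n + n + (n + n))"
    by (simp only: in_pr left_mult_one_mat' dim_in_pr)
  finally show ?thesis .
qed

text \<open>The module induced from \<open>n\<close> copies of the character of the group generated
  by b and c that sends both to (-1)^e. Since b c acts on it as 1, a and d anticommute, and it is
  free over the exterior algebra; the minus sign in \<open>op_d\<close> is d a = - a d.\<close>

definition free_mod :: "bit \<Rightarrow> nat \<Rightarrow> 'k::field d4_rep" where
  "free_mod e n = \<lparr>rdim = n + n + (n + n),
     op_a = j_a n * e_1 n + j_ad n * e_d n,
     op_b = zsgn e \<cdot>\<^sub>m (j_1 n * e_1 n - j_a n * e_a n
       - j_d n * e_d n + j_ad n * e_ad n),
     op_c = zsgn e \<cdot>\<^sub>m (j_1 n * e_1 n - j_a n * e_a n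
       - j_d n * e_d n + j_ad n * e_ad n),
     op_d = j_d n * e_1 n - j_ad n * e_a n\<rparr>"

lemma wf_free_mod: "wf_rep (free_mod e n)"
  by (rule wf_repI) (simp_all add: free_mod_def)

lemma d4_module_free_mod: "d4_module (free_mod e n :: 'k::field d4_rep)"
proof (rule d4_moduleI[OF wf_free_mod])
  have "op_b (free_mod e n :: 'k d4_rep) * op_b (free_mod e n)
    = j_1 n * e_1 n + j_a n * e_a n
    + j_d n * e_d n + j_ad n * e_ad n"
    by (rule eq_matI; simp add: free_mod_def mat_simps del: index_mult_mat(1))
  then show bb: "op_b (free_mod e n :: 'k d4_rep) * op_b (free_mod e n) = 1\<^sub>m (rdim (free_mod e n :: 'k d4_rep))"
    by (simp add: jn_en_sum free_mod_def)
  have bc: "op_c (free_mod e n :: 'k d4_rep) = op_b (free_mod e n)"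
    by (simp add: free_mod_def)
  show "op_c (free_mod e n :: 'k d4_rep) * op_c (free_mod e n) = 1\<^sub>m (rdim (free_mod e n :: 'k d4_rep))"
    using bb bc by simp
  show "op_d (free_mod e n :: 'k d4_rep) * op_a (free_mod e n) + op_a (free_mod e n) * op_d (free_mod e n)
    = 1\<^sub>m (rdim (free_mod e n :: 'k d4_rep)) - op_b (free_mod e n) * op_c (free_mod e n)"
    unfolding bc bb
    by (rule eq_matI; simp add: free_mod_def mat_simps del: index_mult_mat(1))
qed (rule eq_matI; simp add: free_mod_def mat_simps del: index_mult_mat(1))+

lemma d4_relations_mult_rev:
  assumes M: "d4_module M" and X: "dim_row X = rdim M"
  shows "op_b M * (op_a M * X) = - (op_a M * (op_b M * X))"
    "op_b M * (op_d M * X) = - (op_d M * (op_b M * X))"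
    "op_c M * (op_a M * X) = - (op_a M * (op_c M * X))"
    "op_c M * (op_d M * X) = - (op_d M * (op_c M * X))"
  using d4_relations_mult[OF M X] by (simp_all add: uminus_uminus_mat)

text \<open>Frobenius reciprocity: the generators may go to any vectors on which b and c act by
  (-1)^e. The columns of \<open>X\<close> are these vectors, and the formula extends the choice
  along the basis 1, a, d, a d.\<close>

lemma free_mod_hom:
  fixes M :: "'k::field d4_rep"
  assumes M: "d4_module M" and X: "X \<in> carrier_mat (rdim M) n"
    and e: "op_b M * X = zsgn e \<cdot>\<^sub>m X" "op_c M * X = zsgn e \<cdot>\<^sub>m X"
  shows "d4_hom (free_mod e n) M (X * e_1 n + op_a M * (X * e_a n)
    + op_d M * (X * e_d n) + op_a M * (op_d M * (X * e_ad n)))"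
proof -
  note d = wf_rep_dims[OF d4_module_wf[OF M]]
  have dX: "dim_row X = rdim M" "dim_col X = n" using X by auto
  note S = mat_simps d dX d4_relations(6-)[OF M] d4_relations_mult(6-)[OF M] d4_relations_mult_rev[OF M]
    e mult_mat_cong[OF e(1)] mult_mat_cong[OF e(2)]
  show ?thesis
    by (rule d4_homI; (rule eq_matI)?; simp add: free_mod_def S del: index_mult_mat(1))
qed

lemma free_mod_op_jn:
  "op_a (free_mod e n) * j_1 n = (j_a n :: 'k::field mat)"
  "op_d (free_mod e n) * j_1 n = (j_d n :: 'k mat)"
  "op_a (free_mod e n) * j_d n = (j_ad n :: 'k mat)"
  "op_b (free_mod e n) * j_1 n = (zsgn e \<cdot>\<^sub>m j_1 n :: 'k mat)"
  "op_c (free_mod e n) * j_1 n = (zsgn e \<cdot>\<^sub>m j_1 n :: 'k mat)"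
  by (rule eq_matI; simp add: free_mod_def mat_simps del: index_mult_mat(1))+

lemma power_two_nonzero:
  assumes "(2::'k::field) \<noteq> 0"
  shows "(4::'k) \<noteq> 0" "(16::'k) \<noteq> 0"
proof -
  have "(4::'k) = 2 * 2" "(16::'k) = (2 * 2) * (2 * 2)" by simp_all
  then show "(4::'k) \<noteq> 0" "(16::'k) \<noteq> 0"
    using assms by (metis no_zero_divisors)+
qed

text \<open>Maschke's argument: lift the generators linearly, then restore the eigenvalue conditions
  by averaging over the group generated by b and c, whose order 4 is invertible.\<close>

lemma free_mod_projective:
  assumes two: "(2::'k::field) \<noteq> 0"
  shows "projective (free_mod e n :: 'k d4_rep)"
  unfolding projective_def
proof (intro conjI allI impI d4_module_free_mod, elim conjE)
  let ?P = "free_mod e n :: 'k d4_rep"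
  fix M N :: "'k d4_rep" and g f
  assume M: "d4_module M" and N: "d4_module N" and g: "d4_epi M N g" and f: "d4_hom ?P N f"
  have g': "d4_hom M N g" "mat_image g = mspace N" using g by (auto simp: d4_epi_def)
  note wf = d4_module_wf[OF M] d4_module_wf[OF N]
  note dM = wf_rep_dims[OF wf(1)] and dN = wf_rep_dims[OF wf(2)]
  have r: "rdim ?P = n + n + (n + n)" by (simp add: free_mod_def)
  note dg = d4_homD(1,2)[OF g'(1)] and df = d4_homD(1,2)[OF f, unfolded r]
  obtain g1 where g1: "g1 \<in> carrier_mat (rdim M) (rdim N)" "g * g1 = 1\<^sub>m (rdim N)"
    using right_inverse_if_surj[of g] g'(2) dg by auto
  have dg1: "dim_row g1 = rdim M" "dim_col g1 = rdim N" using g1 by auto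
  define Z where "Z = g1 * (f * j_1 n)"
  \<comment> \<open>The projection to the eigenspace of the character: 1, b, c and b c get the
    weights 1, (-1)^e, (-1)^e and 1.\<close>
  define X where "X = (1/4) \<cdot>\<^sub>m (Z + zsgn e \<cdot>\<^sub>m (op_b M * Z) + zsgn e \<cdot>\<^sub>m (op_c M * Z) + op_b M * (op_c M * Z))"
  have dZ: "dim_row Z = rdim M" "dim_col Z = n" by (simp_all add: Z_def dg1)
  have dX: "dim_row X = rdim M" "dim_col X = n" by (simp_all add: X_def dM dZ)
  note four = power_two_nonzero(1)[OF two]
  have gZ: "g * Z = f * j_1 n"
    unfolding Z_def using dg dg1 df by (simp add: mult_mat_cong[OF g1(2)])
  have hb: "f * (op_b ?P * j_1 n) = op_b N * (f * j_1 n)"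
    "f * (op_c ?P * j_1 n) = op_c N * (f * j_1 n)"
    "f * (op_a ?P * j_1 n) = op_a N * (f * j_1 n)"
    "f * (op_d ?P * j_1 n) = op_d N * (f * j_1 n)"
    "f * (op_a ?P * j_d n) = op_a N * (f * j_d n)"
    using d4_hom_mult[OF f wf_free_mod wf(2)] r by simp_all
  have fJ: "op_b N * (f * j_1 n) = zsgn e \<cdot>\<^sub>m (f * j_1 n)"
    "op_c N * (f * j_1 n) = zsgn e \<cdot>\<^sub>m (f * j_1 n)"
    "op_a N * (f * j_1 n) = f * j_a n"
    "op_d N * (f * j_1 n) = f * j_d n"
    "op_a N * (f * j_d n) = f * j_ad n"
    unfolding hb[symmetric] free_mod_op_jn using df by (simp_all add: mult_mat_smult)
  have fJ': "op_a N * (f * (j_1 n * Y)) = f * (j_a n * Y)"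
    "op_d N * (f * (j_1 n * Y)) = f * (j_d n * Y)"
    "op_a N * (f * (j_d n * Y)) = f * (j_ad n * Y)" if "dim_row Y = n" for Y
    using that dN df mult_mat_cong[OF fJ(3), of Y] mult_mat_cong[OF fJ(4), of Y] mult_mat_cong[OF fJ(5), of Y]
    by (simp_all add: mult_mat_assoc)
  have gX: "g * X = f * j_1 n"
  proof -
    have "g * X = (1/4) \<cdot>\<^sub>m (f * j_1 n + f * j_1 n + f * j_1 n + f * j_1 n)"
      unfolding X_def using dg dM dN dZ df
      by (simp add: mat_simps d4_hom_mult[OF g'(1) wf] gZ fJ)
    also have "\<dots> = f * j_1 n"
      by (rule eq_matI) (simp_all add: field_simps four del: index_mult_mat(1))
    finally show ?thesis .
  qed
  have e: "op_b M * X = zsgn e \<cdot>\<^sub>m X" "op_c M * X = zsgn e \<cdot>\<^sub>m X"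
    unfolding X_def
    by (rule eq_matI; simp add: mat_simps dM dZ d4_relations_mult[OF M] del: index_mult_mat(1); simp add: field_simps)+
  define h where "h = X * e_1 n + op_a M * (X * e_a n)
    + op_d M * (X * e_d n) + op_a M * (op_d M * (X * e_ad n))"
  have "d4_hom ?P M h"
    unfolding h_def using M e dX by (intro free_mod_hom) (auto intro!: carrier_matI)
  moreover have "g * h = f"
  proof -
    have "g * h = f * (j_1 n * e_1 n + j_a n * e_a n
      + j_d n * e_d n + j_ad n * e_ad n)"
      unfolding h_def using dg dM dN dX df
      by (simp add: mat_simps d4_hom_mult[OF g'(1) wf] mult_mat_cong[OF gX] fJ')
    then show ?thesis
      using df by (simp add: jn_en_sum)
  qed
  ultimately show "\<exists>h. d4_hom ?P M h \<and> g * h = f" by blast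
qed

lemma zero_add_vec:
  fixes v :: "'a::comm_ring_1 vec"
  shows "dim_vec v = n \<Longrightarrow> 0\<^sub>v n + v = v" "dim_vec v = n \<Longrightarrow> v + 0\<^sub>v n = v"
  by (auto intro: carrier_vecI)

text \<open>A form of Nakayama's lemma: the kernel of \<open>e_1 n\<close> is the part generated by
  the nilpotent elements a and d. As a d kills this kernel, a d maps everything into
  \<open>W\<close>. On the kernel, a and d reduce to multiples of a d, so they map everything into
  \<open>W\<close> as well; finally the kernel itself lies in \<open>W\<close>.\<close>

lemma free_mod_nakayama:
  assumes W: "submodule (free_mod e n :: 'k::field d4_rep) W"
    and gen: "\<And>v. v \<in> mspace (free_mod e n :: 'k d4_rep) \<Longrightarrow>
      \<exists>w\<in>W. \<exists>u. v = w + u \<and> dim_vec u = n + n + (n + n) \<and> e_1 n *\<^sub>v u = 0\<^sub>v n"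
  shows "W = mspace (free_mod e n :: 'k d4_rep)"
proof
  let ?P = "free_mod e n :: 'k d4_rep"
  have r: "rdim ?P = n + n + (n + n)" by (simp add: free_mod_def)
  note d = wf_rep_dims[OF wf_free_mod[of e n, where 'a = 'k], unfolded r]
  note cl = submodule_closed[OF W]
  show "W \<subseteq> mspace ?P" using W by (auto simp: submodule_def)
  show "mspace ?P \<subseteq> W"
  proof
    note V = mat_vec_simps zero_add_vec
    have ad: "op_a ?P * op_d ?P = j_ad n * e_1 n"
      by (rule eq_matI; simp add: free_mod_def mat_simps del: index_mult_mat(1))
    have 1: "op_a ?P *\<^sub>v (op_d ?P *\<^sub>v v) \<in> W" if v: "dim_vec v = n + n + (n + n)" for v
    proof -
      obtain w u where wu: "w \<in> W" "v = w + u" "dim_vec u = n + n + (n + n)" "e_1 n *\<^sub>v u = 0\<^sub>v n"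
        using gen[unfolded r, OF carrier_vecI[OF v]] by blast
      have "op_a ?P *\<^sub>v (op_d ?P *\<^sub>v u) = 0\<^sub>v (n + n + (n + n))"
        using d wu by (simp add: mult_mat_vec_cong[OF ad] V)
      moreover have "op_a ?P *\<^sub>v (op_d ?P *\<^sub>v w) \<in> W"
        using wu(1) cl by blast
      moreover have "dim_vec w = n + n + (n + n)" using cl(9)[OF wu(1)] r by simp
      ultimately show ?thesis
        unfolding wu(2) using d wu(3) cl(5,8) r by (simp add: V)
    qed
    have A: "op_a ?P = op_a ?P * (j_1 n * e_1 n) + op_a ?P * (op_d ?P * (j_1 n * e_d n))"
      and D: "op_d ?P = op_d ?P * (j_1 n * e_1 n) - op_a ?P * (op_d ?P * (j_1 n * e_a n))"
      by (rule eq_matI; simp add: free_mod_def mat_simps del: index_mult_mat(1))+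
    have 2: "op_a ?P *\<^sub>v v \<in> W" "op_d ?P *\<^sub>v v \<in> W" if v: "dim_vec v = n + n + (n + n)" for v
    proof -
      obtain w u where wu: "w \<in> W" "v = w + u" "dim_vec u = n + n + (n + n)" "e_1 n *\<^sub>v u = 0\<^sub>v n"
        using gen[unfolded r, OF carrier_vecI[OF v]] by blast
      have dw: "dim_vec w = n + n + (n + n)" using cl(9)[OF wu(1)] r by simp
      have "op_a ?P *\<^sub>v u = op_a ?P *\<^sub>v (op_d ?P *\<^sub>v (j_1 n *\<^sub>v (e_d n *\<^sub>v u)))"
        by (subst A) (use d wu in \<open>simp add: V\<close>)
      then have "op_a ?P *\<^sub>v u \<in> W" using 1 by simp
      moreover have "op_d ?P *\<^sub>v u = 0\<^sub>v (rdim ?P) - op_a ?P *\<^sub>v (op_d ?P *\<^sub>v (j_1 n *\<^sub>v (e_a n *\<^sub>v u)))"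
        by (subst D) (use d wu r in \<open>simp add: V\<close>)
      then have "op_d ?P *\<^sub>v u \<in> W" using 1 cl(6,8) by simp
      ultimately show "op_a ?P *\<^sub>v v \<in> W" "op_d ?P *\<^sub>v v \<in> W"
        unfolding wu(2) using d dw wu(3) cl(1,4,5) wu(1) by (simp_all add: V)
    qed
    fix v assume "v \<in> mspace ?P"
    then obtain w u where wu: "w \<in> W" "v = w + u" "dim_vec u = n + n + (n + n)" "e_1 n *\<^sub>v u = 0\<^sub>v n"
      using gen[of v] by blast
    have "j_1 n * e_1 n + op_a ?P * (j_1 n * e_a n)
      + op_d ?P * (j_1 n * e_d n)
      + op_a ?P * (op_d ?P * (j_1 n * e_ad n)) = 1\<^sub>m (n + n + (n + n))"
      using d by (simp add: jn_en_sum mult_mat_cong[OF free_mod_op_jn(1)] mult_mat_cong[OF free_mod_op_jn(2)]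
          mult_mat_cong[OF free_mod_op_jn(3)])
    then have "u = (j_1 n * e_1 n + op_a ?P * (j_1 n * e_a n)
      + op_d ?P * (j_1 n * e_d n)
      + op_a ?P * (op_d ?P * (j_1 n * e_ad n))) *\<^sub>v u"
      using wu by (simp add: one_mult_mat_vec')
    also have "\<dots> = op_a ?P *\<^sub>v (j_1 n *\<^sub>v (e_a n *\<^sub>v u))
      + op_d ?P *\<^sub>v (j_1 n *\<^sub>v (e_d n *\<^sub>v u))
      + op_a ?P *\<^sub>v (op_d ?P *\<^sub>v (j_1 n *\<^sub>v (e_ad n *\<^sub>v u)))"
      using wu d by (simp add: V)
    also have "\<dots> \<in> W"
      by (intro cl(5) 1 2) simp_all
    finally show "v \<in> W"
      unfolding wu(2) using wu(1) cl(5) by blast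
  qed
qed


text \<open>The exterior algebra is Koszul: this is the linear part of the minimal resolution of its simple
  module. With socle \<open>k\<^sup>s\<close> and top \<open>k\<^bsup>s+1\<^esup>\<close>, the operators \<open>a\<close> and \<open>d\<close> forget the first
  and the last coordinate of the top, respectively.\<close>

definition syz_mod :: "nat \<Rightarrow> bit \<Rightarrow> 'k::field d4_rep" where
  "syz_mod s e = \<lparr>rdim = s + Suc s,
     op_a = inl s (Suc s) * (prr 1 s * prr s (Suc s)),
     op_b = zsgn e \<cdot>\<^sub>m (inl s (Suc s) * prl s (Suc s) - inr s (Suc s) * prr s (Suc s)),
     op_c = zsgn e \<cdot>\<^sub>m (inl s (Suc s) * prl s (Suc s) - inr s (Suc s) * prr s (Suc s)),
     op_d = inl s (Suc s) * (prl s 1 * prr s (Suc s))\<rparr>"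

lemma wf_syz_mod: "wf_rep (syz_mod s e)"
  by (rule wf_repI) (simp_all add: syz_mod_def)

lemma d4_module_syz_mod: "d4_module (syz_mod s e :: 'k::field d4_rep)"
proof (rule d4_moduleI[OF wf_syz_mod])
  have "op_b (syz_mod s e :: 'k d4_rep) * op_b (syz_mod s e)
    = inl s (Suc s) * prl s (Suc s) + inr s (Suc s) * prr s (Suc s)"
    by (rule eq_matI; simp add: syz_mod_def mat_simps del: index_mult_mat(1))
  then show bb: "op_b (syz_mod s e :: 'k d4_rep) * op_b (syz_mod s e) = 1\<^sub>m (rdim (syz_mod s e :: 'k d4_rep))"
    by (simp add: in_pr syz_mod_def)
  have bc: "op_c (syz_mod s e :: 'k d4_rep) = op_b (syz_mod s e)"
    by (simp add: syz_mod_def)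
  show "op_c (syz_mod s e :: 'k d4_rep) * op_c (syz_mod s e) = 1\<^sub>m (rdim (syz_mod s e :: 'k d4_rep))"
    using bb bc by simp
  show "op_d (syz_mod s e :: 'k d4_rep) * op_a (syz_mod s e) + op_a (syz_mod s e) * op_d (syz_mod s e)
    = 1\<^sub>m (rdim (syz_mod s e :: 'k d4_rep)) - op_b (syz_mod s e) * op_c (syz_mod s e)"
    unfolding bc bb
    by (rule eq_matI; simp add: syz_mod_def mat_simps del: index_mult_mat(1))
qed (rule eq_matI; simp add: syz_mod_def mat_simps del: index_mult_mat(1))+

text \<open>The homomorphism of \<open>free_mod_hom\<close> that sends the generators to the top.
  There is no term with \<open>e_ad\<close> because a d acts as zero on the target.\<close>

definition syz_cover :: "nat \<Rightarrow> 'k::field mat" where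
  "syz_cover s = inr s (Suc s) * e_1 (Suc s)
    + inl s (Suc s) * (prr 1 s * e_a (Suc s))
    + inl s (Suc s) * (prl s 1 * e_d (Suc s))"

text \<open>Besides the whole \<open>ad\<close> block, the kernel of the cover contains the pairs x,
  y in the \<open>a\<close> and \<open>d\<close> blocks for which x without its first coordinate
  plus y without its last one is zero. These are - w without its last and w without its first
  coordinate, for a unique w with s + 2 coordinates. This sign also compensates that of d a = - a
  d.\<close>

definition syz_incl :: "nat \<Rightarrow> 'k::field mat" where
  "syz_incl s = j_ad (Suc s) * prl (Suc s) (Suc (Suc s))
    + j_d (Suc s) * (prr 1 (Suc s) * prr (Suc s) (Suc (Suc s)))
    - j_a (Suc s) * (prl (Suc s) 1 * prr (Suc s) (Suc (Suc s)))"

text \<open>A linear splitting only: a socle vector is lifted to the \<open>a\<close> block, with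
  first coordinate 0.\<close>

definition syz_section :: "nat \<Rightarrow> 'k::field mat" where
  "syz_section s = j_1 (Suc s) * prr s (Suc s)
    + j_a (Suc s) * (inr 1 s * prl s (Suc s))"

text \<open>All coordinates of w after the first come from the \<open>d\<close> block, and the first
  one is minus the first coordinate in the \<open>a\<close> block.\<close>

definition syz_retract :: "nat \<Rightarrow> 'k::field mat" where
  "syz_retract s = inl (Suc s) (Suc (Suc s)) * e_ad (Suc s)
    + inr (Suc s) (Suc (Suc s)) * (inr 1 (Suc s) * e_d (Suc s))
    - inr (Suc s) (Suc (Suc s)) * (inl 1 (Suc s) * (prl 1 s * e_a (Suc s)))"

lemma dim_syz_maps [simp]:
  "dim_row (syz_cover s) = s + Suc s" "dim_col (syz_cover s) = Suc s + Suc s + (Suc s + Suc s)"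
  "dim_row (syz_incl s) = Suc s + Suc s + (Suc s + Suc s)" "dim_col (syz_incl s) = Suc s + Suc (Suc s)"
  "dim_row (syz_section s) = Suc s + Suc s + (Suc s + Suc s)" "dim_col (syz_section s) = s + Suc s"
  "dim_row (syz_retract s) = Suc s + Suc (Suc s)" "dim_col (syz_retract s) = Suc s + Suc s + (Suc s + Suc s)"
  by (simp_all add: syz_cover_def syz_incl_def syz_section_def syz_retract_def)

text \<open>Dropping the first coordinate commutes with dropping the last one; this is why the cover
  kills the image of \<open>syz_incl\<close>.\<close>

lemma shift_commutes:
  "prr (Suc 0) s * prl (Suc s) (Suc 0) = (prl s (Suc 0) * prr (Suc 0) (Suc s) :: 'k::comm_ring_1 mat)"
  "prl (Suc 0) s * prl (Suc s) (Suc 0) = (prl (Suc 0) (Suc s) :: 'k mat)"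
  "prl (Suc s) (Suc 0) * inl (Suc 0) (Suc s) = (inl (Suc 0) s :: 'k mat)"
  "prl (Suc s) (Suc 0) * inr (Suc 0) (Suc s) = (inr (Suc 0) s * prl s (Suc 0) :: 'k mat)"
proof -
  have P: "(prl n m :: 'k mat) $$ (i, j) = (if i = j then 1 else 0)" if "i < n" "j < n + m" for n m i j
    using that by (auto simp: prl_def inl_def)
  have Q: "(prr n m :: 'k mat) $$ (i, j) = (if j = n + i then 1 else 0)" if "i < m" "j < n + m" for n m i j
    using that by (auto simp: prr_def inr_def)
  have R: "(inr n m :: 'k mat) $$ (i, j) = (if i = n + j then 1 else 0)" if "i < n + m" "j < m" for n m i j
    using that by (auto simp: inr_def)
  show 1: "prr (Suc 0) s * prl (Suc s) (Suc 0) = (prl s (Suc 0) * prr (Suc 0) (Suc s) :: 'k mat)"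
    by (rule eq_matI) (auto simp: index_mult_pr P Q simp del: index_mult_mat(1))
  show 2: "prl (Suc 0) s * prl (Suc s) (Suc 0) = (prl (Suc 0) (Suc s) :: 'k mat)"
    by (rule eq_matI) (auto simp: index_mult_pr P Q simp del: index_mult_mat(1))
  show "prl (Suc s) (Suc 0) * inl (Suc 0) (Suc s) = (inl (Suc 0) s :: 'k mat)"
  proof -
    have "inl (Suc s) (Suc 0) * inl (Suc 0) s = (inl (Suc 0) (Suc s) :: 'k mat)"
      using arg_cong[OF 2, of transpose_mat] by (simp add: transpose_mult_dim)
    then show ?thesis
      using pr_in_mult(1)[of "inl (Suc 0) s :: 'k mat" "Suc s" "Suc 0"] by simp
  qed
  show "prl (Suc s) (Suc 0) * inr (Suc 0) (Suc s) = (inr (Suc 0) s * prl s (Suc 0) :: 'k mat)"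
  proof -
    have L: "(prl n m * A) $$ (i, j) = A $$ (i, j)"
      if "i < n" "dim_row A = n + m" "j < dim_col A" for A :: "'k mat" and n m i j
      using that
      by (simp add: prl_def inl_def scalar_prod_def if_distrib[where f = "\<lambda>x. x * _"] sum.delta' cong: if_cong)
    show ?thesis
      by (rule eq_matI) (auto simp: L index_mult_pr index_in_mult P R simp del: index_mult_mat(1))
  qed
qed

lemma shift_commutes_mult:
  fixes X :: "'k::comm_ring_1 mat"
  shows "dim_row X = Suc (Suc s) \<Longrightarrow> prr (Suc 0) s * (prl (Suc s) (Suc 0) * X) = prl s (Suc 0) * (prr (Suc 0) (Suc s) * X)"
    "dim_row X = Suc (Suc s) \<Longrightarrow> prl (Suc 0) s * (prl (Suc s) (Suc 0) * X) = prl (Suc 0) (Suc s) * X"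
    "dim_row X = Suc 0 \<Longrightarrow> prl (Suc s) (Suc 0) * (inl (Suc 0) (Suc s) * X) = inl (Suc 0) s * X"
    "dim_row X = Suc s \<Longrightarrow> prl (Suc s) (Suc 0) * (inr (Suc 0) (Suc s) * X) = inr (Suc 0) s * (prl s (Suc 0) * X)"
  using mult_mat_cong[OF shift_commutes(1)[of s], of X] mult_mat_cong[OF shift_commutes(2)[of s], of X]
    mult_mat_cong[OF shift_commutes(3)[of s], of X] mult_mat_cong[OF shift_commutes(4)[of s], of X]
  by (simp_all add: mult_mat_assoc)

text \<open>The splitting identities of a short exact sequence of vector spaces. They contain
  surjectivity of the cover, injectivity of the inclusion and exactness in the middle.\<close>

lemma syz_split:
  "syz_cover s * syz_section s = (1\<^sub>m (s + Suc s) :: 'k::field mat)"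
  "syz_cover s * syz_incl s = (0\<^sub>m (s + Suc s) (Suc s + Suc (Suc s)) :: 'k mat)"
  "syz_retract s * syz_incl s = (1\<^sub>m (Suc s + Suc (Suc s)) :: 'k mat)"
  "syz_incl s * syz_retract s + syz_section s * syz_cover s = (1\<^sub>m (Suc s + Suc s + (Suc s + Suc s)) :: 'k mat)"
proof -
  note S = mat_simps shift_commutes shift_commutes_mult
  have "syz_cover s * syz_section s = (inl s (Suc s) * prl s (Suc s) + inr s (Suc s) * prr s (Suc s) :: 'k mat)"
    unfolding syz_cover_def syz_section_def
    by (rule eq_matI; simp add: S del: index_mult_mat(1))
  then show "syz_cover s * syz_section s = (1\<^sub>m (s + Suc s) :: 'k mat)"
    by (simp only: in_pr)
  show "syz_cover s * syz_incl s = (0\<^sub>m (s + Suc s) (Suc s + Suc (Suc s)) :: 'k mat)"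
    unfolding syz_cover_def syz_incl_def
    by (rule eq_matI; simp add: S del: index_mult_mat(1))
  have "syz_retract s * syz_incl s = (inl (Suc s) (Suc (Suc s)) * prl (Suc s) (Suc (Suc s))
    + inr (Suc s) (Suc (Suc s)) * ((inl 1 (Suc s) * prl 1 (Suc s) + inr 1 (Suc s) * prr 1 (Suc s))
      * prr (Suc s) (Suc (Suc s))) :: 'k mat)"
    unfolding syz_retract_def syz_incl_def
    by (rule eq_matI; simp add: S del: index_mult_mat(1))
  also have "\<dots> = 1\<^sub>m (Suc s + Suc (Suc s))"
    by (simp only: in_pr left_mult_one_mat' dim_in_pr plus_1_eq_Suc)
  finally show "syz_retract s * syz_incl s = (1\<^sub>m (Suc s + Suc (Suc s)) :: 'k mat)" .
  have "syz_incl s * syz_retract s + syz_section s * syz_cover s =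
     j_1 (Suc s) * e_1 (Suc s)
   + j_a (Suc s) * ((inl 1 s * prl 1 s + inr 1 s * prr 1 s) * e_a (Suc s))
   + j_d (Suc s) * e_d (Suc s) + (j_ad (Suc s) * e_ad (Suc s) :: 'k mat)"
    unfolding syz_retract_def syz_incl_def syz_section_def syz_cover_def
    by (rule eq_matI; simp add: S del: index_mult_mat(1))
  also have "\<dots> = 1\<^sub>m (Suc s + Suc s + (Suc s + Suc s))"
    by (simp only: in_pr left_mult_one_mat' dim_jn_en plus_1_eq_Suc jn_en_sum)
  finally show "syz_incl s * syz_retract s + syz_section s * syz_cover s = (1\<^sub>m (Suc s + Suc s + (Suc s + Suc s)) :: 'k mat)" .
qed

lemma zsgn_plus_one_one [simp]: "e + 1 + 1 = (e::bit)"
  by (cases e) simp_all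

lemma syz_cover_hom: "d4_hom (free_mod (e + 1) (Suc s)) (syz_mod s e) (syz_cover s :: 'k::field mat)"
  by (rule d4_homI; (rule eq_matI)?;
      simp add: free_mod_def syz_mod_def syz_cover_def mat_simps del: index_mult_mat(1))

lemma syz_incl_hom: "d4_hom (syz_mod (Suc s) (e + 1)) (free_mod (e + 1) (Suc s)) (syz_incl s :: 'k::field mat)"
  by (rule d4_homI; (rule eq_matI)?;
      simp add: free_mod_def syz_mod_def syz_incl_def mat_simps del: index_mult_mat(1))

lemma syz_projective_cover:
  assumes two: "(2::'k::field) \<noteq> 0"
  shows "projective_cover (syz_mod s e) (free_mod (e + 1) (Suc s)) (syz_cover s :: 'k mat)"
  unfolding projective_cover_def
proof (intro conjI)
  let ?P = "free_mod (e + 1) (Suc s) :: 'k d4_rep" and ?p = "syz_cover s :: 'k mat"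
  show "projective ?P" using two by (rule free_mod_projective)
  have "mat_image ?p = carrier_vec (dim_row ?p)"
    by (rule surj_if_right_inverse[of _ "syz_section s"]) (simp_all only: syz_split dim_syz_maps)
  then show "d4_epi ?P (syz_mod s e) ?p"
    unfolding d4_epi_def using syz_cover_hom[of e s] by (simp add: syz_mod_def)
  show "superfluous ?P (mat_kernel ?p)"
    unfolding superfluous_def
  proof (intro conjI allI impI; (elim conjE)?)
    show "submodule ?P (mat_kernel ?p)"
      by (rule submodule_kernel[OF syz_cover_hom wf_free_mod wf_syz_mod])
    fix W assume W: "submodule ?P W" and all: "{w + u |w u. w \<in> W \<and> u \<in> mat_kernel ?p} = mspace ?P"
    \<comment> \<open>The top coordinates of the image are the \<open>e_1\<close> component, so the
      kernel of the cover lies in the kernel of \<open>e_1\<close>, where the Nakayama argument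
      applies.\<close>
    have E: "prr s (Suc s) * ?p = e_1 (Suc s)"
      by (simp add: syz_cover_def mat_simps)
    show "W = mspace ?P"
    proof (rule free_mod_nakayama[OF W])
      fix v assume "v \<in> mspace ?P"
      then obtain w u where wu: "v = w + u" "w \<in> W" "u \<in> mat_kernel ?p"
        using all by blast
      then have u: "dim_vec u = Suc s + Suc s + (Suc s + Suc s)" "?p *\<^sub>v u = 0\<^sub>v (s + Suc s)"
        by (auto simp: mat_kernel_iff)
      have "e_1 (Suc s) *\<^sub>v u = prr s (Suc s) *\<^sub>v (?p *\<^sub>v u)"
        using u(1) by (simp add: mult_mat_vec_assoc flip: E)
      then have "e_1 (Suc s) *\<^sub>v u = 0\<^sub>v (Suc s)"
        unfolding u(2) by (simp add: mult_mat_zero_vec)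
      then show "\<exists>w\<in>W. \<exists>u. v = w + u \<and> dim_vec u = Suc s + Suc s + (Suc s + Suc s)
          \<and> e_1 (Suc s) *\<^sub>v u = 0\<^sub>v (Suc s)"
        using wu u by blast
    qed
  qed
qed

lemma syz_kernel:
  "represents_sub (free_mod (e + 1) (Suc s)) (mat_kernel (syz_cover s)) (syz_mod (Suc s) (e + 1) :: 'k::field d4_rep)"
proof -
  let ?i = "syz_incl s :: 'k mat"
  have "mat_inj ?i"
    by (rule mat_inj_if_left_inverse[of "syz_retract s"]) (simp_all add: syz_split)
  moreover have "mat_image ?i = mat_kernel (syz_cover s)"
  proof (intro equalityI subsetI)
    fix v assume "v \<in> mat_image ?i"
    then obtain u where u: "u \<in> carrier_vec (dim_col ?i)" "v = ?i *\<^sub>v u"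
      unfolding mat_image_iff by blast
    then have "syz_cover s *\<^sub>v v = 0\<^sub>v (s + Suc s)"
      by (simp add: mult_mat_vec_cong[OF syz_split(2)] zero_mat_mult_vec)
    then show "v \<in> mat_kernel (syz_cover s)"
      unfolding mat_kernel_iff using u(2) by (auto intro!: carrier_vecI)
  next
    fix v :: "'k vec" assume "v \<in> mat_kernel (syz_cover s)"
    then have v: "dim_vec v = Suc s + Suc s + (Suc s + Suc s)" "syz_cover s *\<^sub>v v = 0\<^sub>v (s + Suc s)"
      by (auto simp: mat_kernel_iff)
    have "v = (?i * syz_retract s + syz_section s * syz_cover s) *\<^sub>v v"
      unfolding syz_split using v(1) by (simp add: one_mult_mat_vec')
    also have "\<dots> = ?i *\<^sub>v (syz_retract s *\<^sub>v v)"
      using v by (simp add: mat_vec_simps zero_add_vec)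
    finally have "v = ?i *\<^sub>v (syz_retract s *\<^sub>v v)" .
    moreover have "syz_retract s *\<^sub>v v \<in> carrier_vec (dim_col ?i)"
      by (rule carrier_vecI) simp
    ultimately show "v \<in> mat_image ?i"
      unfolding mat_image_iff by blast
  qed
  ultimately show ?thesis
    unfolding represents_sub_def d4_mono_iff using syz_incl_hom d4_module_syz_mod by blast
qed

text \<open>For s = 0 only the top is left, and b acts on it by the sign opposite to that of
  \<open>e\<close>; hence the shift of \<open>r\<close>.\<close>

lemma syz_mod_0: "syz_mod 0 (r + 1) = (V1 r :: 'k::field d4_rep)"
proof -
  have "inr 0 (Suc 0) = (1\<^sub>m 1 :: 'k mat)" "prr 0 (Suc 0) = (1\<^sub>m 1 :: 'k mat)"
    by (rule eq_matI; simp add: inr_def prr_def)+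
  moreover have "inl 0 (Suc 0) * X = 0\<^sub>m 1 (dim_col X)" if "dim_row X = 0" for X :: "'k mat"
    using that by (intro eq_matI) (simp_all add: scalar_prod_def)
  ultimately show ?thesis
    by (auto simp: syz_mod_def V1_def intro!: eq_matI simp del: index_mult_mat(1))
qed

text \<open>The sign alternates: the generators of the cover have the sign of the top, which is
  opposite to \<open>e\<close>, and the \<open>ad\<close> block, which becomes the socle of the
  kernel, has the sign of the generators.\<close>

lemma Omega_power_V1:
  fixes N :: "'k::field d4_rep"
  assumes two: "(2::'k) \<noteq> 0" and N: "(is_Omega ^^ s) (V1 r) N"
  shows "d4_module N \<and> N \<cong>\<^sub>D syz_mod s (if even s then r + 1 else r)"
  using N
proof (induction s arbitrary: N)
  case 0
  then have "N = syz_mod 0 (r + 1)" by (simp only: relpowp.simps syz_mod_0)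
  moreover have "(if even (0::nat) then r + 1 else r) = r + 1" by simp
  ultimately show ?case by (simp only: d4_iso_refl wf_syz_mod d4_module_syz_mod)
next
  case (Suc s)
  define e where "e = (if even s then r + 1 else r)"
  have e': "e + 1 = (if even (Suc s) then r + 1 else r)"
    by (simp add: e_def)
  obtain M where M: "(is_Omega ^^ s) (V1 r) M" "is_Omega M N"
    using Suc.prems by auto
  have IH: "d4_module M" "M \<cong>\<^sub>D syz_mod s e"
    using Suc.IH[OF M(1)] by (auto simp: e_def)
  obtain P p where P: "projective_cover M P p" "represents_sub P (mat_kernel p) N"
    using M(2) by (auto simp: is_Omega_def)
  have "N \<cong>\<^sub>D syz_mod (Suc s) (e + 1)"
    using syzygy_unique[OF IH(2,1) d4_module_syz_mod P syz_projective_cover[OF two] syz_kernel] .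
  then show ?case
    using P(2) unfolding e' by (simp add: represents_sub_def)
qed

section \<open>Transposed modules\<close>

text \<open>The defining relations are invariant under reversal of products, so \<open>D\<^sub>4\<close> has an anti-automorphism
  fixing the four generators, and the transposed matrices again define a module.\<close>

definition dual :: "'k::field d4_rep \<Rightarrow> 'k d4_rep" where
  "dual M = \<lparr>rdim = rdim M, op_a = transpose_mat (op_a M), op_b = transpose_mat (op_b M),
     op_c = transpose_mat (op_c M), op_d = transpose_mat (op_d M)\<rparr>"

lemma dual_dual [simp]: "dual (dual M) = M"
  by (simp add: dual_def)

lemma rdim_dual [simp]: "rdim (dual M) = rdim M"
  by (simp add: dual_def)

lemma wf_dual: "wf_rep M \<Longrightarrow> wf_rep (dual M)"
  by (rule wf_repI) (simp_all add: dual_def)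

lemma transpose_uminus_mat: "transpose_mat (- A) = - transpose_mat (A :: 'a::comm_ring_1 mat)"
  by (rule eq_matI) auto

lemma transpose_add_mat:
  fixes A :: "'a::comm_ring_1 mat"
  shows "dim_row A = dim_row B \<Longrightarrow> dim_col A = dim_col B \<Longrightarrow>
    transpose_mat (A + B) = transpose_mat A + transpose_mat B"
  by (rule eq_matI) auto

lemma transpose_minus_mat:
  fixes A :: "'a::comm_ring_1 mat"
  shows "dim_row A = dim_row B \<Longrightarrow> dim_col A = dim_col B \<Longrightarrow>
    transpose_mat (A - B) = transpose_mat A - transpose_mat B"
  by (rule eq_matI) auto

lemma d4_module_dual:
  assumes M: "d4_module M"
  shows "d4_module (dual M)"
proof -
  note wf = d4_module_wf[OF M] and d = wf_rep_dims[OF d4_module_wf[OF M]]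
  have R: "op_b M * op_a M = - (op_a M * op_b M)" "op_d M * op_b M = - (op_b M * op_d M)"
    "op_c M * op_a M = - (op_a M * op_c M)" "op_d M * op_c M = - (op_c M * op_d M)"
    "op_b M * op_c M = op_c M * op_b M" "op_a M * op_a M = 0\<^sub>m (rdim M) (rdim M)"
    "op_b M * op_b M = 1\<^sub>m (rdim M)" "op_c M * op_c M = 1\<^sub>m (rdim M)"
    "op_d M * op_d M = 0\<^sub>m (rdim M) (rdim M)"
    "op_d M * op_a M + op_a M * op_d M = 1\<^sub>m (rdim M) - op_b M * op_c M"
    using M by (simp_all add: d4_module_def Let_def)
  have T: "transpose_mat X * transpose_mat Y = transpose_mat (Y * X)"
    if "dim_row X = rdim M" "dim_col Y = rdim M" for X Y :: "'a mat"
    using that by (simp add: transpose_mult_dim)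
  show ?thesis
  proof (rule d4_moduleI[OF wf_dual[OF wf]])
    have "transpose_mat (op_d M * op_a M + op_a M * op_d M) = transpose_mat (1\<^sub>m (rdim M) - op_b M * op_c M)"
      by (simp add: R)
    then have "transpose_mat (op_d M * op_a M) + transpose_mat (op_a M * op_d M)
        = 1\<^sub>m (rdim M) - transpose_mat (op_b M * op_c M)"
      using d by (simp add: transpose_add_mat transpose_minus_mat)
    moreover have "transpose_mat (op_d M * op_a M) + transpose_mat (op_a M * op_d M)
        = transpose_mat (op_a M * op_d M) + transpose_mat (op_d M * op_a M)"
      using d by (intro comm_add_mat[of _ "rdim M" "rdim M"] carrier_matI) simp_all
    ultimately show "op_d (dual M) * op_a (dual M) + op_a (dual M) * op_d (dual M)
        = 1\<^sub>m (rdim (dual M)) - op_b (dual M) * op_c (dual M)"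
      using d by (simp add: dual_def T R(5))
  qed (use d in \<open>simp_all add: dual_def T R(1-9) transpose_uminus_mat uminus_uminus_mat\<close>)
qed

lemma dual_hom:
  assumes "d4_hom M N F" "wf_rep M" "wf_rep N"
  shows "d4_hom (dual N) (dual M) (transpose_mat F)"
proof -
  note h = d4_homD[OF assms(1)]
  have *: "transpose_mat F * transpose_mat Y = transpose_mat X * transpose_mat F"
    if "F * X = Y * F" "dim_row X = rdim M" "dim_col Y = rdim N" for X Y
    using arg_cong[OF that(1), of transpose_mat] that(2,3) h by (simp add: transpose_mult_dim)
  show ?thesis
    using assms(2,3) h by (intro d4_homI) (simp_all add: dual_def *)
qed

lemma transpose_inverse:
  fixes F :: "'k::field mat"
  assumes "F * G = 1\<^sub>m n" "dim_col F = dim_row G"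
  shows "transpose_mat G * transpose_mat F = 1\<^sub>m n"
  using arg_cong[OF assms(1), of transpose_mat] assms(2) by (simp add: transpose_mult_dim)

lemma dual_epi:
  assumes "d4_epi M N F" "wf_rep M" "wf_rep N"
  shows "d4_mono (dual N) (dual M) (transpose_mat F)"
proof -
  have F: "d4_hom M N F" "mat_image F = mspace N" using assms by (auto simp: d4_epi_def)
  note d = d4_homD(1,2)[OF F(1)]
  obtain G where G: "G \<in> carrier_mat (dim_col F) (dim_row F)" "F * G = 1\<^sub>m (dim_row F)"
    using right_inverse_if_surj[of F] F(2) d by auto
  have "mat_inj (transpose_mat F)"
    by (rule mat_inj_if_left_inverse[of "transpose_mat G"]) (use G transpose_inverse[OF G(2)] in auto)
  then show ?thesis
    using dual_hom[OF F(1) assms(2,3)] by (simp add: d4_mono_iff)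
qed

lemma dual_mono:
  assumes "d4_mono M N F" "wf_rep M" "wf_rep N"
  shows "d4_epi (dual N) (dual M) (transpose_mat F)"
proof -
  have F: "d4_hom M N F" "mat_inj F" using assms by (auto simp: d4_mono_iff)
  note d = d4_homD(1,2)[OF F(1)]
  obtain G where G: "G \<in> carrier_mat (rdim M) (rdim N)" "G * F = 1\<^sub>m (rdim M)"
    by (rule left_inverse_if_inj[OF F(2) carrier_matI[OF d]])
  have "mat_image (transpose_mat F) = carrier_vec (dim_row (transpose_mat F))"
    by (rule surj_if_right_inverse[of _ "transpose_mat G"]) (use G d transpose_inverse[OF G(2)] in auto)
  then show ?thesis
    using dual_hom[OF F(1) assms(2,3)] d by (simp add: d4_epi_def)
qed

text \<open>Transposition reverses arrows and exchanges epimorphisms with monomorphisms, so a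
  lifting problem for the dual is an extension problem for \<open>I\<close>.\<close>

lemma projective_dual:
  assumes I: "injective I"
  shows "projective (dual I)"
  unfolding projective_def
proof (intro conjI allI impI; (elim conjE)?)
  have mI: "d4_module I" using I by (simp add: injective_def)
  then show "d4_module (dual I)" by (rule d4_module_dual)
  fix M N g f
  assume M: "d4_module M" and N: "d4_module N" and g: "d4_epi M N g" and f: "d4_hom (dual I) N f"
  note wf = d4_module_wf[OF M] d4_module_wf[OF N] d4_module_wf[OF mI]
  have "d4_mono (dual N) (dual M) (transpose_mat g)"
    using g wf by (intro dual_epi)
  moreover have "d4_hom (dual N) I (transpose_mat f)"
    using dual_hom[OF f wf_dual[OF wf(3)] wf(2)] by simp
  ultimately obtain h where h: "d4_hom (dual M) I h" "h * transpose_mat g = transpose_mat f"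
    using I d4_module_dual[OF M] d4_module_dual[OF N] unfolding injective_def by blast
  have "d4_hom (dual I) M (transpose_mat h)"
    using dual_hom[OF h(1) wf_dual[OF wf(1)] wf(3)] by simp
  moreover have "g * transpose_mat h = f"
  proof -
    have "dim_col g = rdim M" using g by (auto simp: d4_epi_def d4_homD)
    then show ?thesis
      using arg_cong[OF h(2), of transpose_mat] d4_homD(2)[OF h(1)] by (simp add: transpose_mult_dim)
  qed
  ultimately show "\<exists>h. d4_hom (dual I) M h \<and> g * h = f" by blast
qed

lemma transpose_scalar_prod:
  fixes A :: "'k::field mat"
  assumes "dim_vec y = dim_row A" "dim_vec x = dim_col A"
  shows "(transpose_mat A *\<^sub>v y) \<bullet> x = y \<bullet> (A *\<^sub>v x)"
  using assms by (intro transpose_vec_mult_scalar[of A "dim_row A" "dim_col A"] carrier_matI carrier_vecI) auto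

text \<open>Let \<open>U\<close> be the annihilator of \<open>W\<close>, a submodule of
  \<open>I\<close>. A vector in \<open>U\<close> and in the image of \<open>j\<close> is orthogonal
  to \<open>W\<close> and to the kernel of the transpose of \<open>j\<close>, hence to everything,
  and so it is zero. Essentiality gives \<open>U\<close> = 0, and then a separating functional shows
  that \<open>W\<close> is the whole space.\<close>

lemma superfluous_dual:
  assumes j: "d4_mono M I j" and ess: "essential I (mat_image j)" and wf: "wf_rep M" "wf_rep I"
  shows "superfluous (dual I) (mat_kernel (transpose_mat j))"
  unfolding superfluous_def
proof (intro conjI allI impI; (elim conjE)?)
  have j': "d4_hom M I j" using j by (simp add: d4_mono_def)
  note dj = d4_homD(1,2)[OF j']
  note d = wf_rep_dims[OF wf(2)]
  show "submodule (dual I) (mat_kernel (transpose_mat j))"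
    using dual_hom[OF j' wf] wf wf_dual by (blast intro: submodule_kernel)
  fix W assume W: "submodule (dual I) W"
    and all: "{w + u |w u. w \<in> W \<and> u \<in> mat_kernel (transpose_mat j)} = mspace (dual I)"
  define n where "n = rdim I"
  have dW: "dim_vec w = n" if "w \<in> W" for w
    using submodule_closed(9)[OF W that] by (simp add: n_def)
  define U where "U = {u \<in> carrier_vec n. \<forall>w\<in>W. w \<bullet> u = 0}"
  have opU: "X *\<^sub>v u \<in> U" if X: "u \<in> U" "dim_row X = n" "dim_col X = n" "\<And>w. w \<in> W \<Longrightarrow> transpose_mat X *\<^sub>v w \<in> W" for X u
  proof -
    have "w \<bullet> (X *\<^sub>v u) = 0" if w: "w \<in> W" for w
    proof -
      have "w \<bullet> (X *\<^sub>v u) = (transpose_mat X *\<^sub>v w) \<bullet> u"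
        using \<open>u \<in> U\<close> \<open>dim_row X = n\<close> \<open>dim_col X = n\<close> dW[OF w]
        by (subst transpose_scalar_prod) (auto simp: U_def)
      also have "\<dots> = 0"
        using \<open>u \<in> U\<close> X(4)[OF w] by (simp add: U_def)
      finally show ?thesis .
    qed
    then show ?thesis
      unfolding U_def using X(2) by (auto intro: carrier_vecI)
  qed
  have U: "submodule I U"
  proof (rule submoduleI)
    have "w \<bullet> (u + u') = 0" if "u \<in> U" "u' \<in> U" "w \<in> W" for u u' w
      using that scalar_prod_add_distrib[OF carrier_vecI[OF dW[OF that(3)]], of u u'] by (simp add: U_def)
    moreover have "w \<bullet> (x \<cdot>\<^sub>v u) = 0" if "u \<in> U" "w \<in> W" for u w x
      using that scalar_prod_smult_distrib[OF carrier_vecI[OF dW[OF that(2)]], of u] by (simp add: U_def)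
    moreover have "w \<bullet> 0\<^sub>v n = 0" if "w \<in> W" for w
      using dW[OF that] by (simp add: scalar_prod_def)
    ultimately show "subsp (rdim I) U"
      unfolding subsp_def by (auto simp: U_def n_def)
  qed (use d submodule_closed(1-4)[OF W] in \<open>auto simp: dual_def n_def intro!: opU\<close>)
  have "U \<inter> mat_image j = {0\<^sub>v (rdim I)}"
  proof
    show "{0\<^sub>v (rdim I)} \<subseteq> U \<inter> mat_image j"
      using submodule_closed(8)[OF U] submodule_closed(8)[OF submodule_image[OF j' wf]] by simp
    show "U \<inter> mat_image j \<subseteq> {0\<^sub>v (rdim I)}"
    proof
      fix u assume u: "u \<in> U \<inter> mat_image j"
      then have "u \<in> mat_image j" by blast
      then obtain t where "t \<in> carrier_vec (dim_col j)" "u = j *\<^sub>v t"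
        unfolding mat_image_iff by blast
      then have t: "dim_vec t = rdim M" "u = j *\<^sub>v t"
        using dj by simp_all
      have du: "dim_vec u = n" using u by (auto simp: U_def)
      have "unit_vec n i \<bullet> u = 0" if "i < n" for i
      proof -
        have "unit_vec n i \<in> mspace (dual I)" by (simp add: n_def)
        then obtain w k where wk: "unit_vec n i = w + k" "w \<in> W" "k \<in> mat_kernel (transpose_mat j)"
          using all by blast
        have k: "dim_vec k = n" "transpose_mat j *\<^sub>v k = 0\<^sub>v (rdim M)"
          using wk(3) dj by (auto simp: mat_kernel_iff n_def)
        have "k \<bullet> u = (transpose_mat j *\<^sub>v k) \<bullet> t"
          unfolding t(2) using k(1) t(1) dj by (subst transpose_scalar_prod) (auto simp: n_def)
        also have "\<dots> = 0"
          unfolding k(2) using t(1) by (simp add: scalar_prod_def)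
        finally have "k \<bullet> u = 0" .
        moreover have "w \<bullet> u = 0" using u wk(2) by (simp add: U_def)
        moreover have "(w + k) \<bullet> u = w \<bullet> u + k \<bullet> u"
          using dW[OF wk(2)] k(1) du by (intro add_scalar_prod_distrib[of _ n] carrier_vecI) auto
        ultimately show ?thesis using wk(1) by simp
      qed
      then have "u = 0\<^sub>v n"
        using du by (intro eq_vecI) (auto simp: scalar_prod_left_unit)
      then show "u \<in> {0\<^sub>v (rdim I)}" by (simp add: n_def)
    qed
  qed
  then have U0: "U = {0\<^sub>v (rdim I)}"
    using ess U by (simp add: essential_def)
  show "W = mspace (dual I)"
  proof (rule ccontr)
    assume "W \<noteq> mspace (dual I)"
    moreover have "W \<subseteq> mspace (dual I)" using W by (simp add: submodule_def)
    ultimately obtain v where v: "v \<in> carrier_vec n" "v \<notin> W"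
      by (auto simp: n_def)
    have "subsp n W" using submodule_subsp[OF W] by (simp add: n_def)
    then obtain f where f: "f \<in> carrier_vec n" "\<And>w. w \<in> W \<Longrightarrow> f \<bullet> w = 0" "f \<bullet> v = 1"
      using separating_functional v by blast
    have "w \<bullet> f = 0" if "w \<in> W" for w
      using f(2)[OF that] f(1) comm_scalar_prod[OF f(1) carrier_vecI[OF dW[OF that]]] by simp
    then have "f \<in> U" using f(1) by (simp add: U_def)
    then have "f = 0\<^sub>v n" using U0 by (simp add: n_def)
    then show False using f(3) v(1) by simp
  qed
qed

lemma is_Omega_dual:
  assumes M: "d4_module M" and N: "is_Omega_inv M N"
  shows "is_Omega (dual M) (dual N)"
proof -
  obtain I j where j: "injective I" "d4_mono M I j" "essential I (mat_image j)"
    and Q: "represents_quot I (mat_image j) N"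
    using N by (auto simp: is_Omega_inv_def injective_envelope_def)
  obtain p where p: "d4_module N" "d4_epi I N p" "mat_kernel p = mat_image j"
    using Q by (auto simp: represents_quot_def)
  have mI: "d4_module I" using j(1) by (simp add: injective_def)
  note wf = d4_module_wf[OF M] d4_module_wf[OF mI] d4_module_wf[OF p(1)]
  have j': "d4_hom M I j" and p': "d4_hom I N p" "mat_image p = mspace N"
    using j(2) p(2) by (auto simp: d4_mono_def d4_epi_def)
  note d = d4_homD(1,2)[OF j'] d4_homD(1,2)[OF p'(1)]
  have "projective_cover (dual M) (dual I) (transpose_mat j)"
    unfolding projective_cover_def
    using projective_dual[OF j(1)] dual_mono[OF j(2) wf(1,2)] superfluous_dual[OF j(2,3) wf(1,2)] by blast
  moreover have "represents_sub (dual I) (mat_kernel (transpose_mat j)) (dual N)"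
    unfolding represents_sub_def
  proof (intro conjI exI)
    show "d4_module (dual N)" using p(1) by (rule d4_module_dual)
    show "d4_mono (dual N) (dual I) (transpose_mat p)" using dual_epi[OF p(2) wf(2,3)] .
    obtain q where q: "q \<in> carrier_mat (dim_col p) (dim_row p)" "p * q = 1\<^sub>m (dim_row p)"
      using right_inverse_if_surj[of p] p'(2) d by auto
    have dq: "dim_row q = rdim I" "dim_col q = rdim N" using q(1) d by auto
    have pj: "p * j = 0\<^sub>m (rdim N) (rdim M)"
    proof (rule mat_eq_by_vec)
      fix v :: "'a vec" assume v: "v \<in> carrier_vec (dim_col (p * j))"
      then have "j *\<^sub>v v \<in> mat_kernel p"
        unfolding p(3) mat_image_def by (intro imageI) simp
      then show "p * j *\<^sub>v v = 0\<^sub>m (rdim N) (rdim M) *\<^sub>v v"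
        using v d by (simp add: mat_kernel_iff mult_mat_vec_assoc zero_mat_mult_vec)
    qed (use d in simp_all)
    \<comment> \<open>The kernel of \<open>p\<close> is the image of \<open>j\<close>, so
      \<open>1 - q * p\<close> factors as \<open>j * t\<close>. Transposing
      \<open>j * t + q * p = 1\<close> yields exactness of the dual sequence.\<close>
    have "mat_image (1\<^sub>m (rdim I) - q * p) \<subseteq> mat_image j"
    proof
      fix v assume "v \<in> mat_image (1\<^sub>m (rdim I) - q * p)"
      then obtain u where "u \<in> carrier_vec (dim_col (1\<^sub>m (rdim I) - q * p))"
        "v = (1\<^sub>m (rdim I) - q * p) *\<^sub>v u"
        unfolding mat_image_iff by blast
      then have u: "dim_vec u = rdim I" "v = (1\<^sub>m (rdim I) - q * p) *\<^sub>v u"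
        using d by simp_all
      have "p * (1\<^sub>m (rdim I) - q * p) = 0\<^sub>m (rdim N) (rdim I)"
        using d dq by (simp add: mat_simps mult_mat_cong[OF q(2)])
      then have "p *\<^sub>v v = 0\<^sub>v (rdim N)"
        unfolding u(2) using u(1) d dq by (simp add: mult_mat_vec_cong zero_mat_mult_vec)
      then show "v \<in> mat_image j"
        unfolding p(3)[symmetric] mat_kernel_iff u(2) using u(1) d dq by (auto intro!: carrier_vecI)
    qed
    then obtain t where t: "t \<in> carrier_mat (rdim M) (rdim I)" "j * t = 1\<^sub>m (rdim I) - q * p"
      using mat_image_factor[of "1\<^sub>m (rdim I) - q * p" j] d dq by auto
    have dt: "dim_row t = rdim M" "dim_col t = rdim I" using t(1) by auto
    have TT: "transpose_mat t * transpose_mat j = 1\<^sub>m (rdim I) - transpose_mat p * transpose_mat q"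
      using arg_cong[OF t(2), of transpose_mat] d dq dt by (simp add: transpose_mult_dim transpose_minus_mat)
    have JP: "transpose_mat j * transpose_mat p = 0\<^sub>m (rdim M) (rdim N)"
      using arg_cong[OF pj, of transpose_mat] d by (simp add: transpose_mult_dim)
    show "mat_image (transpose_mat p) = mat_kernel (transpose_mat j)"
    proof (intro equalityI subsetI)
      fix v assume "v \<in> mat_image (transpose_mat p)"
      then obtain u where "u \<in> carrier_vec (dim_col (transpose_mat p))" "v = transpose_mat p *\<^sub>v u"
        unfolding mat_image_iff by blast
      then have u: "dim_vec u = rdim N" "v = transpose_mat p *\<^sub>v u"
        using d by simp_all
      then show "v \<in> mat_kernel (transpose_mat j)"
        unfolding mat_kernel_iff using d
        by (auto simp: mult_mat_vec_cong[OF JP] zero_mat_mult_vec intro!: carrier_vecI)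
    next
      fix v assume "v \<in> mat_kernel (transpose_mat j)"
      then have v: "dim_vec v = rdim I" "transpose_mat j *\<^sub>v v = 0\<^sub>v (rdim M)"
        using d by (auto simp: mat_kernel_iff)
      have "(1\<^sub>m (rdim I) - transpose_mat p * transpose_mat q) *\<^sub>v v = 0\<^sub>v (rdim I)"
        unfolding TT[symmetric] using v d dt by (simp add: mult_mat_vec_assoc mult_mat_zero_vec)
      then have "v - transpose_mat p *\<^sub>v (transpose_mat q *\<^sub>v v) = 0\<^sub>v (rdim I)"
        using v(1) d dq by (simp add: mat_vec_simps)
      then have "v = transpose_mat p *\<^sub>v (transpose_mat q *\<^sub>v v)"
        by (rule minus_vec_eq_zero) (use v(1) d in simp_all)
      moreover have "transpose_mat q *\<^sub>v v \<in> carrier_vec (dim_col (transpose_mat p))"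
        using dq d by (intro carrier_vecI) simp
      ultimately show "v \<in> mat_image (transpose_mat p)"
        unfolding mat_image_iff by blast
    qed
  qed
  ultimately show ?thesis
    unfolding is_Omega_def by blast
qed

lemma Omega_power_dual:
  assumes "d4_module M" "(is_Omega_inv ^^ s) M N"
  shows "d4_module N \<and> (is_Omega ^^ s) (dual M) (dual N)"
  using assms(2)
proof (induction s arbitrary: N)
  case 0
  then show ?case using assms(1) by simp
next
  case (Suc s)
  then obtain L where L: "(is_Omega_inv ^^ s) M L" "is_Omega_inv L N" by auto
  have "d4_module L" "(is_Omega ^^ s) (dual M) (dual L)"
    using Suc.IH[OF L(1)] by auto
  moreover have "d4_module N"
    using L(2) by (auto simp: is_Omega_inv_def represents_quot_def)
  ultimately show ?case
    using is_Omega_dual[OF _ L(2)] by auto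
qed

lemma dual_V1: "dual (V1 r) = V1 r"
  by (auto simp: dual_def V1_def intro!: eq_matI)

lemma iso_syz_mod:
  fixes N :: "'k::field d4_rep"
  assumes N: "d4_module N" "N \<cong>\<^sub>D syz_mod s e"
  obtains F G where "op_c N = op_b N"
    "F \<in> carrier_mat (rdim N) (s + Suc s)" "G \<in> carrier_mat (s + Suc s) (rdim N)"
    "G * F = 1\<^sub>m (s + Suc s)" "F * G = 1\<^sub>m (rdim N)"
    "op_b N * F = F * block_diag (zsgn e \<cdot>\<^sub>m 1\<^sub>m s) (zsgn (e + 1) \<cdot>\<^sub>m 1\<^sub>m (Suc s))"
proof -
  obtain G F where h: "d4_hom N (syz_mod s e) G" "d4_hom (syz_mod s e) N F"
    "F * G = 1\<^sub>m (rdim N)" "G * F = 1\<^sub>m (rdim (syz_mod s e :: 'k d4_rep))"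
    using N(2) by (auto simp: d4_iso_def)
  have r: "rdim (syz_mod s e :: 'k d4_rep) = s + Suc s" by (simp add: syz_mod_def)
  note d = d4_homD(1,2)[OF h(1), unfolded r] d4_homD(1,2)[OF h(2), unfolded r]
  note dN = wf_rep_dims[OF d4_module_wf[OF N(1)]]
  have bc: "op_c (syz_mod s e :: 'k d4_rep) = op_b (syz_mod s e)"
    by (simp add: syz_mod_def)
  have B: "op_b (syz_mod s e) = (block_diag (zsgn e \<cdot>\<^sub>m 1\<^sub>m s) (zsgn (e + 1) \<cdot>\<^sub>m 1\<^sub>m (Suc s)) :: 'k mat)"
    by (rule eq_matI; simp add: syz_mod_def block_diag_in_pr mat_simps del: index_mult_mat(1))
  have "op_c N * F = op_b N * F"
    using d4_homD(4,5)[OF h(2)] bc by simp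
  then have "op_c N * (F * G) = op_b N * (F * G)"
    using d dN by (simp flip: mult_mat_assoc)
  then have "op_c N = op_b N" using dN by (simp add: h(3))
  then show ?thesis
    using that[OF _ carrier_matI[OF d(3,4)] carrier_matI[OF d(1,2)]] h(3,4) d4_homD(4)[OF h(2)]
    unfolding r B by simp
qed

lemma tensor_V2_Omega_power:
  fixes N :: "'k::field d4_rep"
  assumes two: "(2::'k) \<noteq> 0" and N: "d4_module N" "N \<cong>\<^sub>D syz_mod s e"
  shows "V2 r \<otimes>\<^sub>D N \<cong>\<^sub>D copies s (V2 (r + e)) \<oplus>\<^sub>D copies (Suc s) (V2 (r + e + 1))"
proof -
  obtain F G where "op_c N = op_b N"
    "F \<in> carrier_mat (rdim N) (s + Suc s)" "G \<in> carrier_mat (s + Suc s) (rdim N)"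
    "G * F = 1\<^sub>m (s + Suc s)" "F * G = 1\<^sub>m (rdim N)"
    "op_b N * F = F * block_diag (zsgn e \<cdot>\<^sub>m 1\<^sub>m s) (zsgn (e + 1) \<cdot>\<^sub>m 1\<^sub>m (Suc s))"
    using N by (rule iso_syz_mod)
  then show ?thesis
    using tensor_V2_decomposition two N(1) by blast
qed

text \<open>An eigenbasis for b on the dual gives one on \<open>N\<close>: the diagonal matrix is
  symmetric, so the columns of the transpose of \<open>G\<close>, the inverse of the transpose of
  \<open>F\<close>, are eigenvectors with the same signs.\<close>

lemma tensor_V2_Omega_power_dual:
  fixes N :: "'k::field d4_rep"
  assumes two: "(2::'k) \<noteq> 0" and N: "d4_module N" "dual N \<cong>\<^sub>D syz_mod s e"
  shows "V2 r \<otimes>\<^sub>D N \<cong>\<^sub>D copies s (V2 (r + e)) \<oplus>\<^sub>D copies (Suc s) (V2 (r + e + 1))"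
proof -
  let ?B = "block_diag (zsgn e \<cdot>\<^sub>m 1\<^sub>m s) (zsgn (e + 1) \<cdot>\<^sub>m 1\<^sub>m (Suc s)) :: 'k mat"
  obtain F G where FG: "op_c (dual N) = op_b (dual N)"
    "F \<in> carrier_mat (rdim (dual N)) (s + Suc s)" "G \<in> carrier_mat (s + Suc s) (rdim (dual N))"
    "G * F = 1\<^sub>m (s + Suc s)" "F * G = 1\<^sub>m (rdim (dual N))"
    "op_b (dual N) * F = F * ?B"
    using d4_module_dual[OF N(1)] N(2) by (rule iso_syz_mod)
  note dN = wf_rep_dims[OF d4_module_wf[OF N(1)]]
  have d: "dim_row F = rdim N" "dim_col F = s + Suc s" "dim_row G = s + Suc s" "dim_col G = rdim N"
    using FG(2,3) by auto
  have "op_c N = op_b N"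
    using arg_cong[OF FG(1), of transpose_mat] by (simp add: dual_def)
  moreover have "transpose_mat ?B = ?B"
    by (rule eq_matI) (auto simp: block_diag_def)
  then have "transpose_mat F * op_b N = ?B * transpose_mat F"
    using arg_cong[OF FG(6), of transpose_mat] d dN by (simp add: dual_def transpose_mult_dim)
  then have "transpose_mat G * ((transpose_mat F * op_b N) * transpose_mat G)
      = transpose_mat G * ((?B * transpose_mat F) * transpose_mat G)"
    by simp
  then have "op_b N * transpose_mat G = transpose_mat G * ?B"
    using d dN transpose_inverse[OF FG(4)] transpose_inverse[OF FG(5)]
    by (simp add: mult_mat_assoc mult_mat_cong[OF transpose_inverse[OF FG(5)]])
  moreover have "transpose_mat G \<in> carrier_mat (rdim N) (s + Suc s)" "transpose_mat F \<in> carrier_mat (s + Suc s) (rdim N)"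
    using FG(2,3) by simp_all
  moreover have "transpose_mat F * transpose_mat G = 1\<^sub>m (s + Suc s)" "transpose_mat G * transpose_mat F = 1\<^sub>m (rdim N)"
    using transpose_inverse[OF FG(4)] transpose_inverse[OF FG(5)] d by simp_all
  ultimately show ?thesis
    using tensor_V2_decomposition[OF two N(1)] by blast
qed

section \<open>Idempotent endomorphisms\<close>

text \<open>The columns of \<open>F\<close> are a basis of the image of \<open>E\<close>. As
  \<open>E\<close> fixes its image, \<open>F * G * F = F\<close>, and \<open>F\<close> can be
  cancelled.\<close>

lemma idempotent_factor:
  fixes E :: "'k::field mat"
  assumes E: "E \<in> carrier_mat n n" "E * E = E"
  obtains k F G where "F \<in> carrier_mat n k" "G \<in> carrier_mat k n" "F * G = E" "G * F = 1\<^sub>m k"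
proof -
  have dE: "dim_row E = n" "dim_col E = n" using E by auto
  obtain F where F: "mat_inj F" "dim_row F = n" "mat_image F = mat_image E"
    using subsp_mat_image[of E] dE by (auto elim: subsp_basis)
  obtain G where G: "G \<in> carrier_mat (dim_col F) n" "F * G = E"
    using mat_image_factor[of E F] F dE by auto
  obtain H where H: "H \<in> carrier_mat n (dim_col F)" "E * H = F"
    using mat_image_factor[of F E] F dE by auto
  have d: "dim_row G = dim_col F" "dim_col G = n" "dim_row H = n" using G H by auto
  have EF: "E * F = F"
  proof -
    have "E * F = (E * E) * H" unfolding H(2)[symmetric] using d dE by (simp add: mult_mat_assoc)
    then show ?thesis by (simp add: E(2) H(2))
  qed
  have "F * (G * F) = F * 1\<^sub>m (dim_col F)"
    using d F(2) EF by (simp add: mult_mat_cong[OF G(2)])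
  from mat_inj_cancel[OF F(1) this] have "G * F = 1\<^sub>m (dim_col F)"
    using d by simp
  then show ?thesis
    using that[OF carrier_matI[OF F(2) refl] G] by blast
qed

text \<open>If \<open>F * G\<close> is an idempotent endomorphism and \<open>G * F = 1\<close>, this
  is its image as a submodule, in the coordinates given by the columns of \<open>F\<close>.\<close>

definition compress :: "'k::field d4_rep \<Rightarrow> 'k mat \<Rightarrow> 'k mat \<Rightarrow> 'k d4_rep" where
  "compress M F G = \<lparr>rdim = dim_col F, op_a = G * (op_a M * F), op_b = G * (op_b M * F),
     op_c = G * (op_c M * F), op_d = G * (op_d M * F)\<rparr>"

lemma compress_props:
  assumes M: "d4_module M" and F: "F \<in> carrier_mat (rdim M) k" "G \<in> carrier_mat k (rdim M)" "G * F = 1\<^sub>m k"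
    and E: "d4_hom M M (F * G)"
  shows "d4_module (compress M F G)" "d4_hom (compress M F G) M F"
proof -
  have d: "dim_row F = rdim M" "dim_col F = k" "dim_row G = k" "dim_col G = rdim M" using F by auto
  note dM = wf_rep_dims[OF d4_module_wf[OF M]]
  \<comment> \<open>An operator that commutes with the idempotent \<open>F * G\<close> preserves the
    image of \<open>F\<close>.\<close>
  have FG: "F * (G * (X * F)) = X * F" if "F * G * X = X * (F * G)" "dim_row X = rdim M" "dim_col X = rdim M" for X
  proof -
    have "F * (G * (X * F)) = (F * G * X) * F" using d that(2,3) by (simp add: mult_mat_assoc)
    also have "\<dots> = X * (F * (G * F))" unfolding that(1) using d that(2,3) by (simp add: mult_mat_assoc)
    finally show ?thesis using d by (simp add: F(3))
  qed
  note FG' = FG[OF d4_homD(3)[OF E] dM(1,2)] FG[OF d4_homD(4)[OF E] dM(3,4)]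
    FG[OF d4_homD(5)[OF E] dM(5,6)] FG[OF d4_homD(6)[OF E] dM(7,8)]
  show "d4_hom (compress M F G) M F"
    by (rule d4_homI) (simp_all add: compress_def d dM FG')
  have wfc: "wf_rep (compress M F G)"
    by (rule wf_repI) (simp_all add: compress_def d)
  note S = mat_simps d dM FG' F(3) d4_relations[OF M] d4_relations_mult[OF M]
  show "d4_module (compress M F G)"
    by (rule d4_moduleI[OF wfc]; (rule eq_matI)?; simp add: compress_def S del: index_mult_mat(1))
qed

text \<open>\<open>M\<close> is the direct sum of the images of \<open>E\<close> and
  \<open>1 - E\<close>. The last two conclusions retain enough of this to determine \<open>E\<close>
  when one summand is zero.\<close>

lemma idempotent_split:
  assumes M: "d4_module M" and E: "d4_hom M M E" "E * E = E"
  obtains X Y where "d4_module X" "d4_module Y" "M \<cong>\<^sub>D X \<oplus>\<^sub>D Y"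
    "rdim X = 0 \<longrightarrow> E = 0\<^sub>m (rdim M) (rdim M)" "rdim Y = 0 \<longrightarrow> E = 1\<^sub>m (rdim M)"
proof -
  define n where "n = rdim M"
  have dE: "dim_row E = n" "dim_col E = n" using d4_homD(1,2)[OF E(1)] by (simp_all add: n_def)
  note wf = d4_module_wf[OF M] and dM = wf_rep_dims[OF d4_module_wf[OF M], folded n_def]
  obtain k F G where FG: "F \<in> carrier_mat n k" "G \<in> carrier_mat k n" "F * G = E" "G * F = 1\<^sub>m k"
    by (rule idempotent_factor[OF carrier_matI[OF dE] E(2)])
  have c: "1\<^sub>m n - E \<in> carrier_mat n n"
    by (rule carrier_matI) (simp_all add: dE)
  have "(1\<^sub>m n - E) * (1\<^sub>m n - E) = 1\<^sub>m n - E"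
    by (rule eq_matI; simp add: mat_simps dE E(2) del: index_mult_mat(1))
  then obtain k' F' G' where FG': "F' \<in> carrier_mat n k'" "G' \<in> carrier_mat k' n" "F' * G' = 1\<^sub>m n - E" "G' * F' = 1\<^sub>m k'"
    by (rule idempotent_factor[OF c])
  have d: "dim_row F = n" "dim_col F = k" "dim_row G = k" "dim_col G = n"
    "dim_row F' = n" "dim_col F' = k'" "dim_row G' = k'" "dim_col G' = n"
    using FG FG' by auto
  have E': "d4_hom M M (1\<^sub>m n - E)"
    using d4_homD[OF E(1)] dM by (intro d4_homI) (simp_all add: mat_simps dE n_def)
  have 0: "E * (1\<^sub>m n - E) = 0\<^sub>m n n" "(1\<^sub>m n - E) * E = 0\<^sub>m n n"
    by (rule eq_matI; simp add: mat_simps dE E(2) del: index_mult_mat(1))+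
  \<comment> \<open>Inserting \<open>G * F = 1\<close> and \<open>G' * F' = 1\<close> produces the
    factor E (1 - E), which vanishes.\<close>
  have GF': "G * F' = 0\<^sub>m k k'"
  proof -
    have "G * F' = (G * F) * (G * F' * (G' * F'))" using d by (simp add: FG FG')
    also have "\<dots> = G * ((F * G) * (F' * G')) * F'" using d by (simp add: mult_mat_assoc)
    also have "\<dots> = 0\<^sub>m k k'" unfolding FG(3) FG'(3) 0 using d by simp
    finally show ?thesis .
  qed
  have G'F: "G' * F = 0\<^sub>m k' k"
  proof -
    have "G' * F = (G' * F') * (G' * F * (G * F))" using d by (simp add: FG FG')
    also have "\<dots> = G' * ((F' * G') * (F * G)) * F" using d by (simp add: mult_mat_assoc)
    also have "\<dots> = 0\<^sub>m k' k" unfolding FG(3) FG'(3) 0 using d by simp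
    finally show ?thesis .
  qed
  let ?X = "compress M F G" and ?Y = "compress M F' G'"
  have X: "d4_module ?X" "d4_hom ?X M F"
    using compress_props[OF M FG(1,2,4)[unfolded n_def]] E(1) by (simp_all add: FG(3))
  have Y: "d4_module ?Y" "d4_hom ?Y M F'"
    using compress_props[OF M FG'(1,2,4)[unfolded n_def]] E' by (simp_all add: FG'(3))
  note wfXY = d4_module_wf[OF X(1)] d4_module_wf[OF Y(1)]
  have r: "rdim ?X = k" "rdim ?Y = k'" by (simp_all add: compress_def d)
  note dX = wf_rep_dims[OF wfXY(1), unfolded r] and dY = wf_rep_dims[OF wfXY(2), unfolded r]
  define T where "T = F * prl k k' + F' * prr k k'"
  define T' where "T' = inl k k' * G + inr k k' * G'"
  have "d4_hom (?X \<oplus>\<^sub>D ?Y) M T"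
  proof (rule d4_homI)
    show "dim_row T = rdim M" "dim_col T = rdim (?X \<oplus>\<^sub>D ?Y)"
      by (simp_all add: T_def d dsum_def r n_def)
    have *: "T * block_diag A B = Z * T"
      if "F * A = Z * F" "F' * B = Z * F'" "dim_row A = k" "dim_col A = k" "dim_row B = k'" "dim_col B = k'"
        "dim_row Z = n" "dim_col Z = n" for A B Z
      unfolding T_def using that(3-) d
      by (simp add: block_diag_in_pr mat_simps mult_mat_cong[OF that(1)] mult_mat_cong[OF that(2)])
    show "T * op_a (?X \<oplus>\<^sub>D ?Y) = op_a M * T" "T * op_b (?X \<oplus>\<^sub>D ?Y) = op_b M * T"
      "T * op_c (?X \<oplus>\<^sub>D ?Y) = op_c M * T" "T * op_d (?X \<oplus>\<^sub>D ?Y) = op_d M * T"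
      unfolding dsum_def d4_rep.simps
      using *[OF d4_homD(3)[OF X(2)] d4_homD(3)[OF Y(2)]] *[OF d4_homD(4)[OF X(2)] d4_homD(4)[OF Y(2)]]
        *[OF d4_homD(5)[OF X(2)] d4_homD(5)[OF Y(2)]] *[OF d4_homD(6)[OF X(2)] d4_homD(6)[OF Y(2)]] dX dY dM
      by simp_all
  qed
  moreover have "T' \<in> carrier_mat (rdim (?X \<oplus>\<^sub>D ?Y)) (rdim M)"
    by (rule carrier_matI) (simp_all add: T'_def d dsum_def r n_def)
  moreover have "T' * T = 1\<^sub>m (rdim (?X \<oplus>\<^sub>D ?Y))"
  proof -
    have "T' * T = inl k k' * prl k k' + inr k k' * prr k k'"
      unfolding T_def T'_def using d
      by (simp add: mat_simps mult_mat_cong[OF FG(4)] mult_mat_cong[OF FG'(4)] mult_mat_cong[OF GF'] mult_mat_cong[OF G'F])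
    then show ?thesis by (simp add: in_pr dsum_def r)
  qed
  moreover have "T * T' = 1\<^sub>m (rdim M)"
  proof -
    have "T * T' = F * G + F' * G'"
      unfolding T_def T'_def using d by (simp add: mat_simps)
    also have "\<dots> = 1\<^sub>m n"
      unfolding FG(3) FG'(3) by (rule eq_matI) (simp_all add: dE)
    finally show ?thesis by (simp add: n_def)
  qed
  ultimately have iso: "M \<cong>\<^sub>D ?X \<oplus>\<^sub>D ?Y"
    using wf wfXY by (intro d4_iso_sym[OF d4_isoI]) (auto intro: wf_dsum)
  have "E = 0\<^sub>m n n" if "k = 0"
    unfolding FG(3)[symmetric] using that d by (intro eq_matI) (simp_all add: scalar_prod_def)
  moreover have "E = 1\<^sub>m n" if "k' = 0"
  proof -
    have "F' * G' = 0\<^sub>m n n"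
      using that d by (intro eq_matI) (simp_all add: scalar_prod_def)
    then have z: "1\<^sub>m n - E = 0\<^sub>m n n" by (simp add: FG'(3))
    show ?thesis
    proof (rule eq_matI)
      fix i j assume "i < dim_row (1\<^sub>m n :: 'a mat)" "j < dim_col (1\<^sub>m n :: 'a mat)"
      then show "E $$ (i, j) = 1\<^sub>m n $$ (i, j)"
        using arg_cong[OF z, of "\<lambda>A. A $$ (i, j)"] dE by simp
    qed (simp_all add: dE)
  qed
  ultimately show ?thesis
    using that[OF X(1) Y(1) iso] by (simp add: r n_def)
qed

lemma indecomposable_idempotent:
  assumes "indecomposable M" "d4_hom M M E" "E * E = E"
  shows "E = 0\<^sub>m (rdim M) (rdim M) \<or> E = 1\<^sub>m (rdim M)"
proof -
  have m: "d4_module M" using assms(1) by (simp add: indecomposable_def)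
  obtain X Y where XY: "d4_module X" "d4_module Y" "M \<cong>\<^sub>D X \<oplus>\<^sub>D Y"
    "rdim X = 0 \<longrightarrow> E = 0\<^sub>m (rdim M) (rdim M)" "rdim Y = 0 \<longrightarrow> E = 1\<^sub>m (rdim M)"
    by (rule idempotent_split[OF m assms(2,3)])
  have "\<forall>X Y. d4_module X \<and> d4_module Y \<and> M \<cong>\<^sub>D X \<oplus>\<^sub>D Y \<longrightarrow> rdim X = 0 \<or> rdim Y = 0"
    using assms(1) unfolding indecomposable_def by (elim conjE)
  from this[rule_format, OF conjI[OF XY(1) conjI[OF XY(2,3)]]] show ?thesis
    using XY(4,5) by (elim disjE) simp_all
qed

text \<open>The central element \<open>b c\<close> acts on \<open>M\<close> as a scalar, which can be read off from the submodule.\<close>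

lemma op_c_eq_op_b_if_contains_M1:
  fixes M :: "'k::field d4_rep"
  assumes two: "(2::'k) \<noteq> 0" and M: "indecomposable M" and W: "represents_sub M W (M1 r \<eta>)"
  shows "op_c M = op_b M"
proof -
  have m: "d4_module M" using M by (simp add: indecomposable_def)
  note wf = d4_module_wf[OF m] and d = wf_rep_dims[OF d4_module_wf[OF m]]
  note S = mat_simps d d4_relations[OF m] d4_relations_mult[OF m]
  \<comment> \<open>As b c is central with square 1, this is the projection to the part on which it
    acts as 1. It fixes the image of M_1, so it is not 0, and indecomposability leaves only
    1.\<close>
  define E where "E = (1/2) \<cdot>\<^sub>m (1\<^sub>m (rdim M) + op_b M * op_c M)"
  have E: "d4_hom M M E" "E * E = E"
    unfolding E_def
    by (rule d4_homI; (rule eq_matI)?; simp add: S del: index_mult_mat(1))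
      (rule eq_matI; simp add: S del: index_mult_mat(1); simp add: field_simps two power_two_nonzero[OF two])
  have "E \<noteq> 0\<^sub>m (rdim M) (rdim M)"
  proof
    assume E0: "E = 0\<^sub>m (rdim M) (rdim M)"
    obtain i where i: "d4_module (M1 r \<eta> :: 'k d4_rep)" "d4_hom (M1 r \<eta>) M i" "mat_inj i"
      using W by (auto simp: represents_sub_def d4_mono_iff)
    note wf1 = d4_module_wf[OF i(1)]
    have r1: "rdim (M1 r \<eta> :: 'k d4_rep) = 2" by (simp add: M1_def)
    note di = d4_homD(1,2)[OF i(2), unfolded r1]
    have "op_b (M1 r \<eta> :: 'k d4_rep) * op_c (M1 r \<eta>) = 1\<^sub>m 2"
      using d4_relations(7)[OF i(1)] by (simp add: M1_def)
    then have bci: "op_b M * (op_c M * i) = i"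
      using d4_homD(4,5)[OF i(2)] d4_hom_mult(2)[OF i(2) wf1 wf, of "op_c (M1 r \<eta>)"] wf1 r1 di
      by simp
    have "E * i = i"
      unfolding E_def using di d by (intro eq_matI) (simp_all add: mat_simps bci field_simps two del: index_mult_mat(1))
    then have i0: "i = 0\<^sub>m (rdim M) 2"
      using di by (simp add: E0)
    have "unit_vec 2 0 = (0\<^sub>v 2 :: 'k vec)"
      using mat_injD[OF i(3), of "unit_vec 2 0"] di by (simp add: i0 zero_mat_mult_vec)
    then show False
      using unit_vec_nonzero[of 0 2, where 'a = 'k] by simp
  qed
  then have E1: "E = 1\<^sub>m (rdim M)"
    using indecomposable_idempotent[OF M E] by blast
  have "op_c M = (1/2) \<cdot>\<^sub>m op_c M + (1/2) \<cdot>\<^sub>m op_b M"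
  proof -
    have "E * op_c M = (1/2) \<cdot>\<^sub>m op_c M + (1/2) \<cdot>\<^sub>m op_b M"
      unfolding E_def by (simp add: S)
    then show ?thesis by (simp add: E1 d)
  qed
  then have *: "op_c M $$ (i, j) = (1/2) * op_c M $$ (i, j) + (1/2) * op_b M $$ (i, j)"
    if "i < rdim M" "j < rdim M" for i j
    using that d by (metis index_add_mat(1) index_smult_mat(1) index_smult_mat(2) index_smult_mat(3))
  show ?thesis
  proof (rule eq_matI)
    fix i j assume "i < dim_row (op_b M)" "j < dim_col (op_b M)"
    then show "op_c M $$ (i, j) = op_b M $$ (i, j)"
      using *[of i j] d two by (simp add: field_simps)
  qed (simp_all add: d)
qed

section \<open>Radical, socle and length in the principal block\<close>

lemma subsp_sum:
  assumes X: "subsp n X" and Y: "subsp n Y"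
  shows "subsp n {x + y | x y. x \<in> X \<and> y \<in> Y}"
  unfolding subsp_def
proof (intro conjI ballI allI)
  show "{x + y | x y. x \<in> X \<and> y \<in> Y} \<subseteq> carrier_vec n"
    using X Y unfolding subsp_def by (blast intro: add_carrier_vec)
  have "0\<^sub>v n + 0\<^sub>v n = (0\<^sub>v n :: 'a vec)" by simp
  then show "0\<^sub>v n \<in> {x + y | x y. x \<in> X \<and> y \<in> Y}"
    using X Y unfolding subsp_def by (metis (mono_tags, lifting) mem_Collect_eq)
  fix v assume "v \<in> {x + y | x y. x \<in> X \<and> y \<in> Y}"
  then obtain x y where v: "v = x + y" "x \<in> X" "y \<in> Y" by blast
  have c: "dim_vec x = n" "dim_vec y = n" using v X Y by (auto simp: subsp_def)
  show "t \<cdot>\<^sub>v v \<in> {x + y | x y. x \<in> X \<and> y \<in> Y}" for t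
  proof -
    have "t \<cdot>\<^sub>v v = t \<cdot>\<^sub>v x + t \<cdot>\<^sub>v y"
      unfolding v using c by (intro eq_vecI) (auto simp: algebra_simps)
    moreover have "t \<cdot>\<^sub>v x \<in> X" "t \<cdot>\<^sub>v y \<in> Y" using v X Y by (auto simp: subsp_def)
    ultimately show ?thesis by blast
  qed
  fix v' assume "v' \<in> {x + y | x y. x \<in> X \<and> y \<in> Y}"
  then obtain x' y' where v': "v' = x' + y'" "x' \<in> X" "y' \<in> Y" by blast
  have c': "dim_vec x' = n" "dim_vec y' = n" using v' X Y by (auto simp: subsp_def)
  have "v + v' = (x + x') + (y + y')"
    unfolding v v' using c c' by (intro eq_vecI) (auto simp: algebra_simps)
  moreover have "x + x' \<in> X" "y + y' \<in> Y"
    using v v' X Y by (auto simp: subsp_def)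
  ultimately show "v + v' \<in> {x + y | x y. x \<in> X \<and> y \<in> Y}" by blast
qed

lemma subsp_map:
  assumes X: "subsp n X" and A: "dim_row A = n" "dim_col A = n"
  shows "subsp n ((\<lambda>v. A *\<^sub>v v) ` X)"
proof -
  have d: "dim_vec x = n" if "x \<in> X" for x using X that by (auto simp: subsp_def)
  have "A *\<^sub>v 0\<^sub>v n = 0\<^sub>v n" "0\<^sub>v n \<in> X"
    using A X by (auto simp: mult_mat_zero_vec subsp_def)
  then have "0\<^sub>v n \<in> (\<lambda>v. A *\<^sub>v v) ` X" by (metis imageI)
  moreover have "A *\<^sub>v x + A *\<^sub>v y \<in> (\<lambda>v. A *\<^sub>v v) ` X" if "x \<in> X" "y \<in> X" for x y
  proof -
    have "A *\<^sub>v x + A *\<^sub>v y = A *\<^sub>v (x + y)" using that d A by (simp add: mult_mat_vec_add)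
    moreover have "x + y \<in> X" using that X by (simp add: subsp_def)
    ultimately show ?thesis by simp
  qed
  moreover have "t \<cdot>\<^sub>v (A *\<^sub>v x) \<in> (\<lambda>v. A *\<^sub>v v) ` X" if "x \<in> X" for x t
  proof -
    have "t \<cdot>\<^sub>v (A *\<^sub>v x) = A *\<^sub>v (t \<cdot>\<^sub>v x)" using that d A by (simp add: mult_mat_vec_smult)
    moreover have "t \<cdot>\<^sub>v x \<in> X" using that X by (simp add: subsp_def)
    ultimately show ?thesis by simp
  qed
  ultimately show ?thesis
    unfolding subsp_def using A by (auto intro: carrier_vecI)
qed

lemma submodule_sum:
  assumes wf: "wf_rep M" and X: "submodule M X" and Y: "submodule M Y"
  shows "submodule M {x + y | x y. x \<in> X \<and> y \<in> Y}"
proof (rule submoduleI)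
  show "subsp (rdim M) {x + y | x y. x \<in> X \<and> y \<in> Y}"
    by (intro subsp_sum submodule_subsp X Y)
  note cX = submodule_closed[OF X] and cY = submodule_closed[OF Y]
  have *: "A *\<^sub>v v \<in> {x + y | x y. x \<in> X \<and> y \<in> Y}"
    if v: "v \<in> {x + y | x y. x \<in> X \<and> y \<in> Y}" and A: "dim_col A = rdim M"
      "\<And>x. x \<in> X \<Longrightarrow> A *\<^sub>v x \<in> X" "\<And>y. y \<in> Y \<Longrightarrow> A *\<^sub>v y \<in> Y" for A v
  proof -
    obtain x y where xy: "x \<in> X" "y \<in> Y" "v = x + y" using v by blast
    have "A *\<^sub>v v = A *\<^sub>v x + A *\<^sub>v y"
      unfolding xy(3) using cX(9)[OF xy(1)] cY(9)[OF xy(2)] A(1) by (simp add: mult_mat_vec_add)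
    then show ?thesis using A(2)[OF xy(1)] A(3)[OF xy(2)] by blast
  qed
  show "op_a M *\<^sub>v v \<in> {x + y | x y. x \<in> X \<and> y \<in> Y}" "op_b M *\<^sub>v v \<in> {x + y | x y. x \<in> X \<and> y \<in> Y}"
    "op_c M *\<^sub>v v \<in> {x + y | x y. x \<in> X \<and> y \<in> Y}" "op_d M *\<^sub>v v \<in> {x + y | x y. x \<in> X \<and> y \<in> Y}"
    if "v \<in> {x + y | x y. x \<in> X \<and> y \<in> Y}" for v
    by (rule *[OF that]; use wf cX cY in simp)+
qed

lemma submodule_mspace: "wf_rep M \<Longrightarrow> submodule M (mspace M)"
  by (rule submoduleI) (auto simp: subsp_carrier intro!: carrier_vecI)

lemma submodule_zero: "wf_rep M \<Longrightarrow> submodule M {0\<^sub>v (rdim M)}"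
  by (rule submoduleI) (auto simp: subsp_def mult_mat_zero_vec)

text \<open>As b squares to 1, c = b says that b c acts as 1. Then a and d anticommute, and
  \<open>M\<close> is a module over the exterior algebra in a and d, graded by the two eigenspaces
  of b, with a and d odd.\<close>

locale principal =
  fixes M :: "'k::field d4_rep"
  assumes two: "(2::'k) \<noteq> 0" and module: "d4_module M" and cb: "op_c M = op_b M"
begin

abbreviation "a v \<equiv> op_a M *\<^sub>v v"
abbreviation "b v \<equiv> op_b M *\<^sub>v v"
abbreviation "d v \<equiv> op_d M *\<^sub>v v"

lemmas wf = d4_module_wf[OF module]
lemmas dims = wf_rep_dims[OF d4_module_wf[OF module]]

lemma relations:
  "op_a M * op_b M = - (op_b M * op_a M)" "op_d M * op_b M = - (op_b M * op_d M)"
  "op_a M * op_a M = 0\<^sub>m (rdim M) (rdim M)" "op_b M * op_b M = 1\<^sub>m (rdim M)"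
  "op_d M * op_d M = 0\<^sub>m (rdim M) (rdim M)" "op_d M * op_a M = - (op_a M * op_d M)"
proof -
  note R = d4_relations[OF module]
  show "op_a M * op_b M = - (op_b M * op_a M)" "op_d M * op_b M = - (op_b M * op_d M)"
    "op_a M * op_a M = 0\<^sub>m (rdim M) (rdim M)" "op_b M * op_b M = 1\<^sub>m (rdim M)"
    "op_d M * op_d M = 0\<^sub>m (rdim M) (rdim M)"
    by (fact R)+
  show "op_d M * op_a M = - (op_a M * op_d M)"
    unfolding R(10) cb R(7) by (rule eq_matI) (simp_all add: dims del: index_mult_mat(1))
qed

lemma relations_vec:
  assumes "dim_vec v = rdim M"
  shows "a (b v) = - b (a v)" "d (b v) = - b (d v)" "a (a v) = 0\<^sub>v (rdim M)" "b (b v) = v"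
    "d (d v) = 0\<^sub>v (rdim M)" "d (a v) = - a (d v)"
  using assms dims
  by (simp_all add: mult_mat_vec_cong[OF relations(1)] mult_mat_vec_cong[OF relations(2)]
      mult_mat_vec_cong[OF relations(3)] mult_mat_vec_cong[OF relations(4)]
      mult_mat_vec_cong[OF relations(5)] mult_mat_vec_cong[OF relations(6)]
      mult_mat_vec_assoc zero_mat_mult_vec one_mult_mat_vec')

lemma submoduleI':
  assumes "subsp (rdim M) W" "\<And>v. v \<in> W \<Longrightarrow> a v \<in> W" "\<And>v. v \<in> W \<Longrightarrow> b v \<in> W" "\<And>v. v \<in> W \<Longrightarrow> d v \<in> W"
  shows "submodule M W"
  using assms by (intro submoduleI) (simp_all add: cb)

text \<open>The product of \<open>W\<close> with the nilpotent ideal generated by a and d;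
  \<open>rad_eq\<close> identifies it with the radical of a submodule \<open>W\<close>.\<close>

definition rad_space :: "'k vec set \<Rightarrow> 'k vec set" where
  "rad_space W = {u + v | u v. u \<in> (\<lambda>v. a v) ` W \<and> v \<in> (\<lambda>v. d v) ` W}"

lemma rad_space_iff: "v \<in> rad_space W \<longleftrightarrow> (\<exists>x\<in>W. \<exists>y\<in>W. v = a x + d y)"
  unfolding rad_space_def by auto

lemma rad_space_subsp: "submodule M W \<Longrightarrow> subsp (rdim M) (rad_space W)"
  unfolding rad_space_def using dims by (intro subsp_sum subsp_map submodule_subsp)

lemma rad_space_subset: "submodule M W \<Longrightarrow> rad_space W \<subseteq> W"
  by (auto simp: rad_space_iff submodule_closed)

lemma uminus_vec_eq: "- v = (-1) \<cdot>\<^sub>v (v :: 'k vec)"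
  by (rule eq_vecI) auto

lemma smult_zero_vec': "t \<cdot>\<^sub>v 0\<^sub>v n = (0\<^sub>v n :: 'k vec)"
  by (rule eq_vecI) auto

lemma submodule_uminus: "submodule M W \<Longrightarrow> v \<in> W \<Longrightarrow> - v \<in> W"
  unfolding uminus_vec_eq by (rule submodule_closed(7))

lemma rad_space_ad:
  assumes W: "submodule M W" and v: "v \<in> W"
  shows "a v \<in> rad_space W" "d v \<in> rad_space W"
proof -
  have 0: "0\<^sub>v (rdim M) \<in> W" and dv: "dim_vec v = rdim M"
    using submodule_closed(8,9)[OF W] v by auto
  have "a v = a v + d (0\<^sub>v (rdim M))" "d v = a (0\<^sub>v (rdim M)) + d v"
    using dims dv by (simp_all add: mult_mat_zero_vec zero_add_vec)
  then show "a v \<in> rad_space W" "d v \<in> rad_space W"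
    unfolding rad_space_iff using v 0 by blast+
qed

lemma rad_space_b:
  assumes W: "submodule M W" and v: "v \<in> rad_space W"
  shows "b v \<in> rad_space W"
proof -
  obtain x y where v': "x \<in> W" "y \<in> W" "v = a x + d y"
    using v by (auto simp: rad_space_iff)
  note c = submodule_closed[OF W]
  have "b v = a (- b x) + d (- b y)"
    unfolding v'(3) using dims c(9)[OF v'(1)] c(9)[OF v'(2)]
    by (simp add: mat_vec_simps uminus_vec_eq relations_vec smult_smult_assoc)
  moreover have "- b x \<in> W" "- b y \<in> W"
    using c(2) v' submodule_uminus[OF W] by auto
  ultimately show ?thesis
    unfolding rad_space_iff by blast
qed

lemma rad_space_submodule: "submodule M W \<Longrightarrow> submodule M (rad_space W)"
  using rad_space_subset rad_space_subsp rad_space_ad rad_space_b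
  by (intro submoduleI') blast+

text \<open>Products of three factors a or d vanish. So a d maps \<open>W\<close> into
  \<open>X\<close>; knowing this, a and d do so too; and then \<open>W\<close> itself lies in
  \<open>X\<close>.\<close>

lemma nakayama:
  assumes X: "submodule M X" and W: "submodule M W"
    and gen: "\<And>w. w \<in> W \<Longrightarrow> \<exists>x\<in>X. \<exists>r\<in>rad_space W. w = x + r"
  shows "W \<subseteq> X"
proof -
  note cX = submodule_closed[OF X] and cW = submodule_closed[OF W]
  have split: "\<exists>x\<in>X. \<exists>u\<in>W. \<exists>v\<in>W. w = x + (a u + d v)" if w: "w \<in> W" for w
  proof -
    obtain x r where "x \<in> X" "r \<in> rad_space W" "w = x + r" using gen[OF w] by blast
    moreover then obtain u v where "u \<in> W" "v \<in> W" "r = a u + d v" by (auto simp: rad_space_iff)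
    ultimately show ?thesis by blast
  qed
  have 1: "a (d w) \<in> X" if w: "w \<in> W" for w
  proof -
    obtain x u v where xuv: "x \<in> X" "u \<in> W" "v \<in> W" "w = x + (a u + d v)" using split[OF w] by blast
    have "a (d w) = a (d x)"
      unfolding xuv(4) using dims cX(9)[OF xuv(1)] cW(9)[OF xuv(2)] cW(9)[OF xuv(3)]
      by (simp add: mat_vec_simps relations_vec zero_add_vec uminus_vec_eq)
        (rule eq_vecI; simp)
    then show ?thesis using cX(1,4) xuv(1) by simp
  qed
  have 2: "a w \<in> X" "d w \<in> X" if w: "w \<in> W" for w
  proof -
    obtain x u v where xuv: "x \<in> X" "u \<in> W" "v \<in> W" "w = x + (a u + d v)" using split[OF w] by blast
    note dd = cX(9)[OF xuv(1)] cW(9)[OF xuv(2)] cW(9)[OF xuv(3)]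
    have "a w = a x + a (d v)"
      unfolding xuv(4) using dims dd by (simp add: mat_vec_simps relations_vec zero_add_vec)
    moreover have "d w = d x - a (d u)"
      unfolding xuv(4) using dims dd
      by (simp add: mat_vec_simps relations_vec zero_add_vec) (rule eq_vecI; simp)
    ultimately show "a w \<in> X" "d w \<in> X"
      using cX(1,4,5,6) xuv(1) 1[OF xuv(2)] 1[OF xuv(3)] by auto
  qed
  show "W \<subseteq> X"
  proof
    fix w assume "w \<in> W"
    then obtain x u v where "x \<in> X" "u \<in> W" "v \<in> W" "w = x + (a u + d v)" using split by blast
    then show "w \<in> X" using 2 cX(5) by auto
  qed
qed

text \<open>The sum of \<open>X\<close> and \<open>rad_space W\<close> lies between \<open>X\<close>
  and \<open>W\<close>. By maximality it is one of them, and by Nakayama it is not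
  \<open>W\<close>.\<close>

lemma max_sub_rad_space:
  assumes "max_sub M X W"
  shows "rad_space W \<subseteq> X"
proof -
  have X: "submodule M X" and W: "submodule M W" and XW: "X \<subset> W"
    and max: "\<And>Y. submodule M Y \<Longrightarrow> X \<subseteq> Y \<Longrightarrow> Y \<subseteq> W \<Longrightarrow> Y = X \<or> Y = W"
    using assms by (auto simp: max_sub_def)
  note cX = submodule_closed[OF X] and cW = submodule_closed[OF W]
  note R = rad_space_submodule[OF W]
  note cR = submodule_closed[OF R]
  define Y where "Y = {x + r | x r. x \<in> X \<and> r \<in> rad_space W}"
  have mem: "v \<in> Y \<longleftrightarrow> (\<exists>x\<in>X. \<exists>r\<in>rad_space W. v = x + r)" for v
    by (auto simp: Y_def)
  have XY: "X \<subseteq> Y"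
  proof
    fix x assume x: "x \<in> X"
    then have "x = x + 0\<^sub>v (rdim M)" using cX(9)[OF x] by (simp add: zero_add_vec)
    then show "x \<in> Y" unfolding mem using x cR(8) by blast
  qed
  have RY: "rad_space W \<subseteq> Y"
  proof
    fix x assume x: "x \<in> rad_space W"
    then have "x = 0\<^sub>v (rdim M) + x" using cR(9)[OF x] by (simp add: zero_add_vec)
    then show "x \<in> Y" unfolding mem using x cX(8) by blast
  qed
  have "Y \<subseteq> W"
    using XW rad_space_subset[OF W] cW(5) unfolding Y_def by blast
  moreover have "submodule M Y"
    unfolding Y_def by (rule submodule_sum[OF wf X R])
  ultimately consider "Y = X" | "Y = W"
    using max XY by blast
  then show ?thesis
  proof cases
    case 1
    then show ?thesis using RY by simp
  next
    case 2
    then have "W \<subseteq> X" using mem by (intro nakayama[OF X W]) blast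
    then show ?thesis using XW by blast
  qed
qed

lemma rad_space_subset_rad:
  assumes W: "submodule M W"
  shows "rad_space W \<subseteq> rad M W"
  using max_sub_rad_space rad_space_subset[OF W] by (auto simp: rad_def)

lemma eigenvector_split:
  assumes "dim_vec v = rdim M"
  shows "v = (1/2) \<cdot>\<^sub>v ((v + b v) + (v - b v))"
  using assms dims two by (intro eq_vecI) (simp_all add: field_simps del: index_mult_mat_vec)

text \<open>For v in \<open>W\<close> outside \<open>rad_space W\<close> a maximal submodule without
  v is needed. It is the kernel in \<open>W\<close> of a functional f that vanishes on
  \<open>rad_space W\<close>, is an eigenvector for b, and has f(v) = 1: the first two properties
  make the kernel a submodule, and it has codimension one.\<close>

lemma rad_subset_rad_space:
  assumes W: "submodule M W"
  shows "rad M W \<subseteq> rad_space W"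
proof (rule subsetI, rule ccontr)
  fix v assume v: "v \<in> rad M W" and nv: "v \<notin> rad_space W"
  then have vW: "v \<in> W" by (auto simp: rad_def)
  note cW = submodule_closed[OF W]
  note R = rad_space_submodule[OF W]
  note cR = submodule_closed[OF R]
  \<comment> \<open>A functional that vanishes on \<open>S \<sigma>\<close> kills
    \<open>rad_space W\<close> and satisfies f(b w) = \<sigma> f(w) on \<open>W\<close>. It remains
    to find a sign \<sigma> with v outside \<open>S \<sigma>\<close>.\<close>
  define S where "S \<sigma> = {r + t | r t. r \<in> rad_space W \<and> t \<in> (\<lambda>w. (1\<^sub>m (rdim M) - \<sigma> \<cdot>\<^sub>m op_b M) *\<^sub>v w) ` W}" for \<sigma>
  have S_subsp: "subsp (rdim M) (S \<sigma>)" for \<sigma>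
    unfolding S_def using dims by (intro subsp_sum subsp_map submodule_subsp W R) simp_all
  have op: "(1\<^sub>m (rdim M) - \<sigma> \<cdot>\<^sub>m op_b M) *\<^sub>v w = w - \<sigma> \<cdot>\<^sub>v b w" if "w \<in> W" for w \<sigma>
    using cW(9)[OF that] dims by (simp add: mat_vec_simps)
  have S_iff: "x \<in> S \<sigma> \<longleftrightarrow> (\<exists>r\<in>rad_space W. \<exists>w\<in>W. x = r + (w - \<sigma> \<cdot>\<^sub>v b w))" for x \<sigma>
    unfolding S_def using op by auto
  \<comment> \<open>Here (1 + \<sigma> b) (1 - \<sigma> b) = 0 is used. If v were in
    \<open>S \<sigma>\<close> for both signs, both v + b v and v - b v would be in
    \<open>rad_space W\<close>, and so would v.\<close>
  have key: "v + \<sigma> \<cdot>\<^sub>v b v \<in> rad_space W" if vS: "v \<in> S \<sigma>" and s: "\<sigma> * \<sigma> = 1" for \<sigma>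
  proof -
    obtain r w where rw: "r \<in> rad_space W" "w \<in> W" "v = r + (w - \<sigma> \<cdot>\<^sub>v b w)"
      using vS unfolding S_iff by blast
    have "v + \<sigma> \<cdot>\<^sub>v b v = r + \<sigma> \<cdot>\<^sub>v b r"
      unfolding rw(3) using dims cR(9)[OF rw(1)] cW(9)[OF rw(2)]
      by (simp add: mat_vec_simps relations_vec smult_smult_assoc s)
        (rule eq_vecI; simp add: algebra_simps s del: index_mult_mat_vec)
    then show ?thesis using cR(2,5,7) rw(1) by simp
  qed
  have "\<exists>\<sigma>. \<sigma> * \<sigma> = 1 \<and> v \<notin> S \<sigma>"
  proof (rule ccontr)
    assume "\<nexists>\<sigma>. \<sigma> * \<sigma> = 1 \<and> v \<notin> S \<sigma>"
    then have S: "v \<in> S 1" "v \<in> S (-1)" by auto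
    have "v + 1 \<cdot>\<^sub>v b v \<in> rad_space W" "v + (-1) \<cdot>\<^sub>v b v \<in> rad_space W"
      by (rule key[OF S(1)], simp) (rule key[OF S(2)], simp)
    then have "(1/2) \<cdot>\<^sub>v ((v + 1 \<cdot>\<^sub>v b v) + (v + (-1) \<cdot>\<^sub>v b v)) \<in> rad_space W"
      using cR(5,7) by blast
    moreover have "v = (1/2) \<cdot>\<^sub>v ((v + 1 \<cdot>\<^sub>v b v) + (v + (-1) \<cdot>\<^sub>v b v))"
      using cW(9)[OF vW] dims two by (intro eq_vecI) (simp_all add: field_simps del: index_mult_mat_vec)
    ultimately show False using nv by simp
  qed
  then obtain \<sigma> where s: "\<sigma> * \<sigma> = 1" "v \<notin> S \<sigma>" by blast
  obtain f where f: "f \<in> carrier_vec (rdim M)" "\<And>w. w \<in> S \<sigma> \<Longrightarrow> f \<bullet> w = 0" "f \<bullet> v = 1"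
    using separating_functional[OF S_subsp carrier_vecI[OF cW(9)[OF vW]] s(2)] by blast
  have fadd: "f \<bullet> (x + y) = f \<bullet> x + f \<bullet> y" "f \<bullet> (t \<cdot>\<^sub>v x) = t * (f \<bullet> x)" "f \<bullet> (x - y) = f \<bullet> x - f \<bullet> y"
    if "dim_vec x = rdim M" "dim_vec y = rdim M" for x y t
    using scalar_prod_add_distrib[OF f(1) carrier_vecI[OF that(1)] carrier_vecI[OF that(2)]]
      scalar_prod_smult_distrib[OF f(1) carrier_vecI[OF that(1)]]
      scalar_prod_minus_distrib[OF f(1) carrier_vecI[OF that(1)] carrier_vecI[OF that(2)]] by auto
  have fR: "f \<bullet> r = 0" if "r \<in> rad_space W" for r
  proof -
    have b0: "b (0\<^sub>v (rdim M)) = 0\<^sub>v (rdim M)" using dims by (simp add: mult_mat_zero_vec)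
    have "r = r + (0\<^sub>v (rdim M) - \<sigma> \<cdot>\<^sub>v b (0\<^sub>v (rdim M)))"
      using cR(9)[OF that] by (intro eq_vecI) (simp_all add: b0 del: index_mult_mat_vec)
    then have "r \<in> S \<sigma>" unfolding S_iff using that cW(8) by blast
    then show ?thesis by (rule f(2))
  qed
  have fb: "f \<bullet> b w = \<sigma> * (f \<bullet> w)" if w: "w \<in> W" for w
  proof -
    have "w - \<sigma> \<cdot>\<^sub>v b w = 0\<^sub>v (rdim M) + (w - \<sigma> \<cdot>\<^sub>v b w)"
      using cW(9)[OF w] dims by (simp add: zero_add_vec)
    then have "w - \<sigma> \<cdot>\<^sub>v b w \<in> S \<sigma>" unfolding S_iff using w cR(8) by blast
    then have "f \<bullet> (w - \<sigma> \<cdot>\<^sub>v b w) = 0" by (rule f(2))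
    then have "f \<bullet> w - \<sigma> * (f \<bullet> b w) = 0"
      using cW(9)[OF w] dims by (simp add: fadd)
    then have "\<sigma> * (f \<bullet> w) = \<sigma> * \<sigma> * (f \<bullet> b w)" by simp
    then show ?thesis using s(1) by simp
  qed
  define X where "X = {x \<in> W. f \<bullet> x = 0}"
  have X: "submodule M X"
  proof (rule submoduleI')
    show "subsp (rdim M) X"
      unfolding subsp_def
    proof (intro conjI ballI allI)
      show "X \<subseteq> mspace M" using cW(9) by (auto simp: X_def intro: carrier_vecI)
      show "0\<^sub>v (rdim M) \<in> X" using cW(8) f(1) by (simp add: X_def)
      fix x assume "x \<in> X"
      then have x: "x \<in> W" "f \<bullet> x = 0" by (simp_all add: X_def)
      show "t \<cdot>\<^sub>v x \<in> X" for t
        using cW(7)[OF x(1)] fadd(2)[OF cW(9)[OF x(1)] cW(9)[OF x(1)]] x(2) by (simp add: X_def)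
      fix y assume "y \<in> X"
      then have y: "y \<in> W" "f \<bullet> y = 0" by (simp_all add: X_def)
      show "x + y \<in> X"
        using cW(5)[OF x(1) y(1)] fadd(1)[OF cW(9)[OF x(1)] cW(9)[OF y(1)]] x(2) y(2) by (simp add: X_def)
    qed
    show "a x \<in> X" "b x \<in> X" "d x \<in> X" if "x \<in> X" for x
      using that cW(1,2,4) fR rad_space_ad[OF W] fb by (auto simp: X_def)
  qed
  have "max_sub M X W"
    unfolding max_sub_def
  proof (intro conjI allI impI; (elim conjE)?)
    have "v \<notin> X" "X \<subseteq> W" using f(3) by (auto simp: X_def)
    then show "X \<subset> W" using vW by blast
    fix Y assume Y: "submodule M Y" "X \<subseteq> Y" "Y \<subseteq> W"
    show "Y = X \<or> Y = W"
    proof (rule disjCI)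
      assume "Y \<noteq> W"
      show "Y = X"
      proof (rule ccontr)
        assume "Y \<noteq> X"
        then obtain y where y: "y \<in> Y" "y \<notin> X" using Y by blast
        then have yW: "y \<in> W" and fy: "f \<bullet> y \<noteq> 0" using Y by (auto simp: X_def)
        have "w \<in> Y" if w: "w \<in> W" for w
        proof -
          define t where "t = (f \<bullet> w) / (f \<bullet> y)"
          have "w - t \<cdot>\<^sub>v y \<in> X"
            unfolding X_def using cW(6,7,9) w yW fy by (simp add: fadd(1,3) fadd(2)[OF cW(9)[OF yW] cW(9)[OF yW]] t_def)
          then have "(w - t \<cdot>\<^sub>v y) + t \<cdot>\<^sub>v y \<in> Y"
            using Y(2) y(1) submodule_closed(5,7)[OF Y(1)] by blast
          moreover have "(w - t \<cdot>\<^sub>v y) + t \<cdot>\<^sub>v y = w"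
            using cW(9)[OF w] cW(9)[OF yW] by (intro eq_vecI) auto
          ultimately show ?thesis by simp
        qed
        then show False using \<open>Y \<noteq> W\<close> Y(3) by blast
      qed
    qed
  qed (use X W in auto)
  then have "v \<in> X" using v by (auto simp: rad_def)
  then show False using f(3) by (simp add: X_def)
qed

lemma rad_eq: "submodule M W \<Longrightarrow> rad M W = rad_space W"
  using rad_subset_rad_space rad_space_subset_rad by blast

text \<open>The \<open>LEAST\<close> in the definition of the Loewy length says something only because the third radical vanishes.\<close>

lemma ad_zero_if_loewy_length_2:
  assumes "loewy_length M = 2" and v: "dim_vec v = rdim M"
  shows "a (d v) = 0\<^sub>v (rdim M)"
proof -
  define W1 where "W1 = rad_space (mspace M)"
  define W2 where "W2 = rad_space W1"
  have m: "submodule M (mspace M)" using submodule_mspace[OF wf] .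
  have W1: "submodule M W1" unfolding W1_def by (rule rad_space_submodule[OF m])
  have W2: "submodule M W2" unfolding W2_def by (rule rad_space_submodule[OF W1])
  have r2: "(rad M ^^ 2) (mspace M) = W2"
    by (simp add: numeral_2_eq_2 rad_eq m W1_def[symmetric] W1 W2_def)
  have r3: "(rad M ^^ 3) (mspace M) = rad_space W2"
    by (simp add: numeral_3_eq_3 rad_eq m W1_def[symmetric] W1 W2_def[symmetric] W2)
  have "a z = 0\<^sub>v (rdim M) \<and> d z = 0\<^sub>v (rdim M)" if z: "z \<in> W2" for z
  proof -
    obtain u v where uv: "u \<in> W1" "v \<in> W1" "z = a u + d v"
      using z by (auto simp: W2_def rad_space_iff)
    obtain u1 u2 where "u1 \<in> mspace M" "u2 \<in> mspace M" and u3: "u = a u1 + d u2"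
      using uv(1) unfolding W1_def rad_space_iff by blast
    then have u: "dim_vec u1 = rdim M" "dim_vec u2 = rdim M" by auto
    obtain v1 v2 where "v1 \<in> mspace M" "v2 \<in> mspace M" and v3: "v = a v1 + d v2"
      using uv(2) unfolding W1_def rad_space_iff by blast
    then have v: "dim_vec v1 = rdim M" "dim_vec v2 = rdim M" by auto
    \<comment> \<open>Since a and d square to zero, the second radical consists of vectors of the
      form a (d x), and these are killed by a and d.\<close>
    have "a (- a (d x)) = 0\<^sub>v (rdim M)" "d (- a (d x)) = 0\<^sub>v (rdim M)" if "dim_vec x = rdim M" for x
      using that dims
      by (simp_all add: uminus_vec_eq mult_mat_vec_smult relations_vec mult_mat_zero_vec smult_zero_vec')
    then show ?thesis
      unfolding uv(3) u3 v3 using u v dims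
      by (simp add: mat_vec_simps relations_vec zero_add_vec)
  qed
  then have "rad_space W2 \<subseteq> {0\<^sub>v (rdim M)}"
    by (auto simp: rad_space_iff)
  then have "(rad M ^^ 3) (mspace M) = {0\<^sub>v (rdim M)}"
    unfolding r3 using submodule_closed(8)[OF rad_space_submodule[OF W2]] by blast
  then have "(rad M ^^ loewy_length M) (mspace M) = {0\<^sub>v (rdim M)}"
    unfolding loewy_length_def by (rule LeastI[of "\<lambda>n. (rad M ^^ n) (mspace M) = {0\<^sub>v (rdim M)}"])
  then have "W2 = {0\<^sub>v (rdim M)}" using assms(1) r2 by simp
  moreover have "d v \<in> W1"
    unfolding W1_def using v by (intro rad_space_ad[OF m] carrier_vecI)
  then have "a (d v) \<in> W2"
    unfolding W2_def by (rule rad_space_ad[OF W1])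
  ultimately show ?thesis by simp
qed

lemma simple_line:
  assumes u: "dim_vec u = rdim M" "u \<noteq> 0\<^sub>v (rdim M)" "a u = 0\<^sub>v (rdim M)" "d u = 0\<^sub>v (rdim M)" "b u = \<sigma> \<cdot>\<^sub>v u"
  shows "simple_sub M {t \<cdot>\<^sub>v u | t. True}"
  unfolding simple_sub_def max_sub_def
proof (intro conjI allI impI; (elim conjE)?)
  let ?L = "{t \<cdot>\<^sub>v u | t. True}"
  show "submodule M {0\<^sub>v (rdim M)}" by (rule submodule_zero[OF wf])
  have 0: "0\<^sub>v (rdim M) = 0 \<cdot>\<^sub>v u"
    using u(1) by (intro eq_vecI) auto
  have "t \<cdot>\<^sub>v u + t' \<cdot>\<^sub>v u = (t + t') \<cdot>\<^sub>v u" for t t'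
    by (intro eq_vecI) (auto simp: algebra_simps)
  then have "subsp (rdim M) ?L"
    unfolding subsp_def using u(1) 0 by (auto simp: smult_smult_assoc intro!: carrier_vecI)
  then show "submodule M ?L"
  proof (rule submoduleI')
    have "a (t \<cdot>\<^sub>v u) = 0 \<cdot>\<^sub>v u" "d (t \<cdot>\<^sub>v u) = 0 \<cdot>\<^sub>v u" "b (t \<cdot>\<^sub>v u) = (t * \<sigma>) \<cdot>\<^sub>v u" for t
      using u dims 0 by (simp_all add: mult_mat_vec_smult smult_smult_assoc)
    then show "a v \<in> ?L" "b v \<in> ?L" "d v \<in> ?L" if "v \<in> ?L" for v
      using that by blast+
  qed
  have "u = 1 \<cdot>\<^sub>v u" by simp
  then have "u \<in> ?L" by blast
  then show "{0\<^sub>v (rdim M)} \<subset> ?L"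
    using 0 u(2) by blast
  fix Y assume Y: "submodule M Y" "{0\<^sub>v (rdim M)} \<subseteq> Y" "Y \<subseteq> ?L"
  show "Y = {0\<^sub>v (rdim M)} \<or> Y = ?L"
  proof (rule disjCI)
    assume "Y \<noteq> ?L"
    show "Y = {0\<^sub>v (rdim M)}"
    proof (rule ccontr)
      assume "Y \<noteq> {0\<^sub>v (rdim M)}"
      then obtain y where y: "y \<in> Y" "y \<noteq> 0\<^sub>v (rdim M)" using Y(2) by blast
      then obtain t where t: "y = t \<cdot>\<^sub>v u" using Y(3) by blast
      then have "t \<noteq> 0" using y(2) 0 by auto
      have "s \<cdot>\<^sub>v u \<in> Y" for s
      proof -
        have "(s / t) \<cdot>\<^sub>v y \<in> Y" using y(1) submodule_closed(7)[OF Y(1)] by blast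
        then show ?thesis using \<open>t \<noteq> 0\<close> by (simp add: t smult_smult_assoc)
      qed
      then show False using \<open>Y \<noteq> ?L\<close> Y(3) by blast
    qed
  qed
qed

text \<open>A simple submodule meets the common kernel K of a and d in zero or lies in it. In the
  first case a s and d s, which belong to K as a d = 0, vanish for every s in it, so that s is in K
  after all. Conversely K is spanned by eigenvectors of b, and each of these spans a simple
  submodule.\<close>

lemma soc_eq:
  assumes ad: "\<And>v. dim_vec v = rdim M \<Longrightarrow> a (d v) = 0\<^sub>v (rdim M)"
  shows "soc M = {v \<in> mspace M. a v = 0\<^sub>v (rdim M) \<and> d v = 0\<^sub>v (rdim M)}" (is "_ = ?K")
proof (rule equalityI)
  have K: "submodule M ?K"
  proof (rule submoduleI')
    show "subsp (rdim M) ?K"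
      unfolding subsp_def using dims by (auto simp: mat_vec_simps zero_add_vec intro!: eq_vecI)
    show "a v \<in> ?K" "d v \<in> ?K" if "v \<in> ?K" for v
      using that dims by (auto simp: mult_mat_zero_vec)
    show "b v \<in> ?K" if "v \<in> ?K" for v
      using that dims by (auto simp: relations_vec mult_mat_zero_vec intro!: carrier_vecI)
  qed
  have "S \<subseteq> ?K" if S: "simple_sub M S" for S
  proof -
    have S': "submodule M S" "{0\<^sub>v (rdim M)} \<subset> S"
      and max: "\<And>Y. submodule M Y \<Longrightarrow> {0\<^sub>v (rdim M)} \<subseteq> Y \<Longrightarrow> Y \<subseteq> S \<Longrightarrow> Y = {0\<^sub>v (rdim M)} \<or> Y = S"
      using S by (auto simp: simple_sub_def max_sub_def)
    note cS = submodule_closed[OF S'(1)] and cK = submodule_closed[OF K]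
    have "submodule M (S \<inter> ?K)"
    proof (rule submoduleI')
      show "subsp (rdim M) (S \<inter> ?K)"
        using submodule_subsp[OF S'(1)] submodule_subsp[OF K] unfolding subsp_def by blast
    qed (use cS(1,2,4) cK(1,2,4) in blast)+
    then consider "S \<inter> ?K = {0\<^sub>v (rdim M)}" | "S \<inter> ?K = S"
      using max[of "S \<inter> ?K"] cS(8) cK(8) by blast
    then show ?thesis
    proof cases
      case 1
      obtain s where s: "s \<in> S" "s \<noteq> 0\<^sub>v (rdim M)" using S'(2) by blast
      have ds: "dim_vec s = rdim M" using cS(9)[OF s(1)] .
      have "a s \<in> ?K" "d s \<in> ?K"
        using ds dims ad by (auto simp: relations_vec intro!: carrier_vecI)
      then have "a s = 0\<^sub>v (rdim M)" "d s = 0\<^sub>v (rdim M)"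
        using 1 cS(1,4) s(1) by blast+
      then have "s \<in> S \<inter> ?K" using s(1) ds by (auto intro: carrier_vecI)
      then show ?thesis using 1 s(2) by blast
    next
      case 2
      then show ?thesis by blast
    qed
  qed
  then show "soc M \<subseteq> ?K"
    unfolding soc_def using K by blast
  show "?K \<subseteq> soc M"
    unfolding soc_def
  proof (intro subsetI InterI)
    fix v W assume v: "v \<in> ?K" and "W \<in> {W. submodule M W \<and> (\<forall>S. simple_sub M S \<longrightarrow> S \<subseteq> W)}"
    then have W: "submodule M W" "\<forall>S. simple_sub M S \<longrightarrow> S \<subseteq> W" by auto
    note cW = submodule_closed[OF W(1)] and cK = submodule_closed[OF K]
    have dv: "dim_vec v = rdim M" using v by auto
    have line: "u \<in> W" if "u \<in> ?K" "b u = \<sigma> \<cdot>\<^sub>v u" for u \<sigma>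
    proof (cases "u = 0\<^sub>v (rdim M)")
      case True
      then show ?thesis using cW(8) by simp
    next
      case False
      then have "simple_sub M {t \<cdot>\<^sub>v u | t. True}"
        using that by (intro simple_line) auto
      then have "{t \<cdot>\<^sub>v u | t. True} \<subseteq> W" using W(2) by blast
      moreover have "u = 1 \<cdot>\<^sub>v u" by simp
      ultimately show ?thesis by blast
    qed
    have "v + b v \<in> ?K" "v - b v \<in> ?K" using v cK(2,5,6) by blast+
    moreover have "b (v + b v) = 1 \<cdot>\<^sub>v (v + b v)" "b (v - b v) = (-1) \<cdot>\<^sub>v (v - b v)"
      using dv dims by (auto simp: mat_vec_simps relations_vec intro!: eq_vecI simp del: index_mult_mat_vec)
    ultimately have "v + b v \<in> W" "v - b v \<in> W" using line by blast+
    then have "(1/2) \<cdot>\<^sub>v ((v + b v) + (v - b v)) \<in> W" using cW(5,7) by blast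
    then show "v \<in> W" using eigenvector_split[OF dv] by simp
  qed
qed

end

text \<open>One of the two b-components of a vector in \<open>W\<close> outside \<open>X\<close> is
  outside \<open>X\<close> as well. With a = d = 0 it spans a submodule, and maximality of
  \<open>X\<close> leaves nothing else in \<open>W\<close>.\<close>

lemma (in principal) max_sub_step:
  assumes 0: "op_a M = 0\<^sub>m (rdim M) (rdim M)" "op_d M = 0\<^sub>m (rdim M) (rdim M)" and max: "max_sub M X W"
  obtains u where "dim_vec u = rdim M" "u \<notin> X" "W = {x + y | x y. x \<in> X \<and> y \<in> {t \<cdot>\<^sub>v u | t. True}}"
proof -
  have X: "submodule M X" and W: "submodule M W" and XW: "X \<subset> W"
    and mx: "\<And>Y. submodule M Y \<Longrightarrow> X \<subseteq> Y \<Longrightarrow> Y \<subseteq> W \<Longrightarrow> Y = X \<or> Y = W"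
    using max by (auto simp: max_sub_def)
  note cX = submodule_closed[OF X] and cW = submodule_closed[OF W]
  obtain v where v: "v \<in> W" "v \<notin> X" using XW by blast
  have dv: "dim_vec v = rdim M" using cW(9)[OF v(1)] .
  have "v + b v \<notin> X \<or> v - b v \<notin> X"
  proof (rule ccontr)
    assume "\<not> ?thesis"
    then have "(1/2) \<cdot>\<^sub>v ((v + b v) + (v - b v)) \<in> X" using cX(5,7) by blast
    then show False using v(2) eigenvector_split[OF dv] by simp
  qed
  moreover have "b (v + b v) = 1 \<cdot>\<^sub>v (v + b v)" "b (v - b v) = (-1) \<cdot>\<^sub>v (v - b v)"
    using dv dims by (auto simp: mat_vec_simps relations_vec intro!: eq_vecI simp del: index_mult_mat_vec)
  moreover have "v + b v \<in> W" "v - b v \<in> W" using v(1) cW(2,5,6) by blast+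
  ultimately obtain u \<sigma> where u: "u \<notin> X" "u \<in> W" "b u = \<sigma> \<cdot>\<^sub>v u" by metis
  have du: "dim_vec u = rdim M" using cW(9)[OF u(2)] .
  let ?L = "{t \<cdot>\<^sub>v u | t. True}"
  have "simple_sub M ?L"
  proof (rule simple_line[OF du _ _ _ u(3)])
    show "u \<noteq> 0\<^sub>v (rdim M)" using u(1) cX(8) by blast
  qed (simp_all add: 0 du zero_mat_mult_vec)
  then have L: "submodule M ?L" by (simp add: simple_sub_def max_sub_def)
  note cL = submodule_closed[OF L]
  define Y where "Y = {x + y | x y. x \<in> X \<and> y \<in> ?L}"
  have "submodule M Y" unfolding Y_def by (rule submodule_sum[OF wf X L])
  moreover have "X \<subseteq> Y"
  proof
    fix x assume x: "x \<in> X"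
    then have "x = x + 0\<^sub>v (rdim M)" using cX(9)[OF x] by (simp add: zero_add_vec)
    then show "x \<in> Y" unfolding Y_def using x cL(8) by blast
  qed
  moreover have "Y \<subseteq> W"
  proof
    fix y assume "y \<in> Y"
    then obtain x t where "x \<in> X" "y = x + t \<cdot>\<^sub>v u" unfolding Y_def by blast
    then show "y \<in> W" using XW cW(5,7) u(2) by blast
  qed
  moreover have "u \<in> Y"
  proof -
    have "u = 0\<^sub>v (rdim M) + 1 \<cdot>\<^sub>v u" using du by (simp add: zero_add_vec)
    then show ?thesis unfolding Y_def using cX(8) by blast
  qed
  ultimately have "Y = W" using mx u(1) by blast
  then show ?thesis using that[OF du u(1)] by (simp add: Y_def)
qed

lemma mat_image_append_col:
  fixes F :: "'k::field mat"
  assumes "dim_row F = dim_vec u"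
  shows "mat_image (append_col F u) = {x + y | x y. x \<in> mat_image F \<and> y \<in> {t \<cdot>\<^sub>v u | t. True}}"
proof (intro equalityI subsetI)
  fix v assume "v \<in> mat_image (append_col F u)"
  then obtain z where z: "z \<in> carrier_vec (dim_col (append_col F u))" "v = append_col F u *\<^sub>v z"
    unfolding mat_image_iff by blast
  have "v = F *\<^sub>v (prl (dim_col F) (Suc 0) *\<^sub>v z) + (prr (dim_col F) (Suc 0) *\<^sub>v z) $ 0 \<cdot>\<^sub>v u"
    unfolding z(2) using z(1) assms append_col_mult_vec[of z F u] by simp
  moreover have "F *\<^sub>v (prl (dim_col F) (Suc 0) *\<^sub>v z) \<in> mat_image F"
    unfolding mat_image_def by (intro imageI carrier_vecI) simp
  ultimately show "v \<in> {x + y | x y. x \<in> mat_image F \<and> y \<in> {t \<cdot>\<^sub>v u | t. True}}" by blast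
next
  fix v assume "v \<in> {x + y | x y. x \<in> mat_image F \<and> y \<in> {t \<cdot>\<^sub>v u | t. True}}"
  then obtain x t where "x \<in> mat_image F" and v: "v = x + t \<cdot>\<^sub>v u" by blast
  then obtain y where y: "y \<in> carrier_vec (dim_col F)" "x = F *\<^sub>v y" unfolding mat_image_iff by blast
  define w where "w = vec 1 (\<lambda>_. t)"
  define z where "z = inl (dim_col F) (Suc 0) *\<^sub>v y + inr (dim_col F) (Suc 0) *\<^sub>v w"
  have "append_col F u *\<^sub>v z = append_col F u *\<^sub>v (inl (dim_col F) (Suc 0) *\<^sub>v y)
      + append_col F u *\<^sub>v (inr (dim_col F) (Suc 0) *\<^sub>v w)"
    unfolding z_def by (rule mult_mat_vec_add) simp_all
  also have "\<dots> = F *\<^sub>v y + colmat u *\<^sub>v w"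
    using y(1) append_col_in[OF assms]
    by (simp add: mult_mat_vec_cong w_def)
  also have "\<dots> = v"
    by (simp add: colmat_mult_vec w_def v y(2))
  finally have "append_col F u *\<^sub>v z = v" .
  moreover have "z \<in> carrier_vec (dim_col (append_col F u))"
    unfolding z_def by (rule carrier_vecI) simp
  ultimately show "v \<in> mat_image (append_col F u)"
    unfolding mat_image_iff by metis
qed

text \<open>By \<open>max_sub_step\<close> each step of a composition series appends one column to a
  basis. This is applied to the socle of M_s and to the quotient by it, turning the two lengths into
  dimensions.\<close>

lemma (in principal) length_eq_rdim:
  assumes 0: "op_a M = 0\<^sub>m (rdim M) (rdim M)" "op_d M = 0\<^sub>m (rdim M) (rdim M)" and len: "has_length M l"
  shows "rdim M = l"
proof -
  obtain W where W: "W 0 = {0\<^sub>v (rdim M)}" "W l = mspace M" "\<And>i. i < l \<Longrightarrow> max_sub M (W i) (W (Suc i))"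
    using len by (auto simp: has_length_def)
  have "\<exists>F. dim_row F = rdim M \<and> dim_col F = i \<and> mat_inj F \<and> mat_image F = W i" if "i \<le> l" for i
    using that
  proof (induction i)
    case 0
    have "mat_inj (0\<^sub>m (rdim M) 0 :: 'k mat)"
      by (auto simp: mat_inj_def intro!: eq_vecI)
    moreover have "mat_image (0\<^sub>m (rdim M) 0 :: 'k mat) = W 0"
    proof (intro equalityI subsetI)
      fix v assume "v \<in> mat_image (0\<^sub>m (rdim M) 0 :: 'k mat)"
      then obtain u where "u \<in> carrier_vec (dim_col (0\<^sub>m (rdim M) 0 :: 'k mat))" "v = 0\<^sub>m (rdim M) 0 *\<^sub>v u"
        unfolding mat_image_iff by blast
      then show "v \<in> W 0" by (simp add: W zero_mat_mult_vec)
    next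
      fix v assume "v \<in> W 0"
      then have "v = 0\<^sub>v (rdim M)" by (simp add: W)
      then show "v \<in> mat_image (0\<^sub>m (rdim M) 0)"
        using subsp_mat_image[of "0\<^sub>m (rdim M) 0 :: 'k mat"] unfolding subsp_def by (metis index_zero_mat(2))
    qed
    ultimately show ?case by (intro exI[of _ "0\<^sub>m (rdim M) 0"]) simp
  next
    case (Suc i)
    then obtain F where F: "dim_row F = rdim M" "dim_col F = i" "mat_inj F" "mat_image F = W i" by auto
    obtain u where u: "dim_vec u = rdim M" "u \<notin> W i" "W (Suc i) = {x + y | x y. x \<in> W i \<and> y \<in> {t \<cdot>\<^sub>v u | t. True}}"
      by (rule max_sub_step[OF 0 W(3)[OF Suc_le_lessD[OF Suc.prems]]])
    have "mat_inj (append_col F u)" "mat_image (append_col F u) = W (Suc i)"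
      using F u by (simp_all add: mat_inj_append_col mat_image_append_col)
    then show ?case using F u(1) by (intro exI[of _ "append_col F u"]) simp
  qed
  then obtain F where F: "dim_row F = rdim M" "dim_col F = l" "mat_inj F" "mat_image F = mspace M"
    using W(2) by blast
  then show ?thesis
    using mat_inj_dim[of F] surj_dim[of F] by simp
qed


section \<open>The tensor product with \<open>M\<^sub>s(r,\<eta>)\<close>\<close>

text \<open>The inclusions \<open>i\<close>, \<open>j\<close> of complementary eigenspaces of b and
  the coordinate maps \<open>X\<close>, \<open>Y\<close> are put side by side to form a basis and
  its inverse.\<close>

lemma tensor_V2_eigenspaces:
  fixes M :: "'k::field d4_rep"
  assumes two: "(2::'k) \<noteq> 0" and M: "d4_module M" "op_c M = op_b M"
    and i: "i \<in> carrier_mat (rdim M) p" "X \<in> carrier_mat p (rdim M)" "X * i = 1\<^sub>m p" "op_b M * i = zsgn e \<cdot>\<^sub>m i"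
    and j: "j \<in> carrier_mat (rdim M) q" "Y \<in> carrier_mat q (rdim M)" "Y * j = 1\<^sub>m q" "op_b M * j = zsgn (e + 1) \<cdot>\<^sub>m j"
    and ij: "X * j = 0\<^sub>m p q" "Y * i = 0\<^sub>m q p" "i * X + j * Y = 1\<^sub>m (rdim M)"
  shows "V2 r \<otimes>\<^sub>D M \<cong>\<^sub>D copies p (V2 (r + e)) \<oplus>\<^sub>D copies q (V2 (r + e + 1))"
proof (rule tensor_V2_decomposition[OF two M])
  have d: "dim_row i = rdim M" "dim_col i = p" "dim_row X = p" "dim_col X = rdim M"
    "dim_row j = rdim M" "dim_col j = q" "dim_row Y = q" "dim_col Y = rdim M"
    using i j by auto
  note dM = wf_rep_dims[OF d4_module_wf[OF M(1)]]
  let ?F = "i * prl p q + j * prr p q" and ?G = "inl p q * X + inr p q * Y"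
  show "?F \<in> carrier_mat (rdim M) (p + q)" "?G \<in> carrier_mat (p + q) (rdim M)"
    by (rule carrier_matI; simp add: d)+
  have "?G * ?F = inl p q * prl p q + inr p q * prr p q"
    using d by (simp add: mat_simps mult_mat_cong[OF i(3)] mult_mat_cong[OF j(3)] mult_mat_cong[OF ij(1)] mult_mat_cong[OF ij(2)])
  then show "?G * ?F = 1\<^sub>m (p + q)" by (simp add: in_pr)
  show "?F * ?G = 1\<^sub>m (rdim M)"
    using d ij(3) by (simp add: mat_simps)
  show "op_b M * ?F = ?F * block_diag (zsgn e \<cdot>\<^sub>m 1\<^sub>m p) (zsgn (e + 1) \<cdot>\<^sub>m 1\<^sub>m q)"
    using d dM by (simp add: block_diag_in_pr mat_simps mult_mat_cong[OF i(4)] mult_mat_cong[OF j(4)])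
qed

text \<open>Let \<open>\<pi>\<close> be a projection onto the socle that commutes with \<open>b\<close>. Since \<open>a\<close> and \<open>d\<close> map into the
  socle and annihilate it, \<open>(1 + b) / 2 - b \<pi>\<close> is an idempotent endomorphism. By indecomposability it is
  \<open>0\<close> or \<open>1\<close>, so \<open>b\<close> acts by a sign on the socle and by the opposite sign on a complement.\<close>

lemma tensor_V2_Ms:
  fixes M :: "'k::field d4_rep"
  assumes two: "(2::'k) \<noteq> 0" and Ms: "is_Ms s r \<eta> M"
  shows "V2 r' \<otimes>\<^sub>D M \<cong>\<^sub>D copies s (V2 0) \<oplus>\<^sub>D copies s (V2 1)"
proof -
  obtain Q S W where ind: "indecomposable M" and loewy: "loewy_length M = 2"
    and Q: "represents_quot M (soc M) Q" "has_length Q s"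
    and S: "represents_sub M (soc M) S" "has_length S s"
    and W: "represents_sub M W (M1 r \<eta>)"
    using Ms by (auto simp: is_Ms_def st_type_def)
  have m: "d4_module M" using ind by (simp add: indecomposable_def)
  have cb: "op_c M = op_b M" using op_c_eq_op_b_if_contains_M1[OF two ind W] .
  interpret principal M using two m cb by unfold_locales
  define n where "n = rdim M"
  note dM = dims[folded n_def]
  have ad: "op_a M *\<^sub>v (op_d M *\<^sub>v v) = 0\<^sub>v n" if "dim_vec v = n" for v
    using ad_zero_if_loewy_length_2[OF loewy] that by (simp add: n_def)
  have soc: "soc M = {v \<in> carrier_vec n. op_a M *\<^sub>v v = 0\<^sub>v n \<and> op_d M *\<^sub>v v = 0\<^sub>v n}"
    using soc_eq ad by (simp add: n_def)
  obtain i where i: "d4_module S" "d4_hom S M i" "mat_inj i" "mat_image i = soc M"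
    using S(1) by (auto simp: represents_sub_def d4_mono_iff)
  obtain p where p: "d4_module Q" "d4_hom M Q p" "mat_image p = mspace Q" "mat_kernel p = soc M"
    using Q(1) by (auto simp: represents_quot_def d4_epi_def)
  note wfS = d4_module_wf[OF i(1)] and wfQ = d4_module_wf[OF p(1)]
  note dS = wf_rep_dims[OF wfS] and dQ = wf_rep_dims[OF wfQ]
  note di = d4_homD(1,2)[OF i(2), folded n_def] and dp = d4_homD(1,2)[OF p(2), folded n_def]
  have in_soc: "i *\<^sub>v v \<in> soc M" if "dim_vec v = rdim S" for v
    unfolding i(4)[symmetric] mat_image_def using that di by (intro imageI carrier_vecI) simp
  have ai: "op_a M * i = 0\<^sub>m n (rdim S)" and di0: "op_d M * i = 0\<^sub>m n (rdim S)"
    by (rule mat_eq_by_vec; use in_soc di dM in \<open>simp add: soc zero_mat_mult_vec mult_mat_vec_assoc\<close>)+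
  have pi: "p * i = 0\<^sub>m (rdim Q) (rdim S)"
  proof (rule mat_eq_by_vec)
    fix v :: "'k vec" assume "v \<in> carrier_vec (dim_col (p * i))"
    then have v: "dim_vec v = rdim S" using di by simp
    then have "i *\<^sub>v v \<in> mat_kernel p" using in_soc p(4) by simp
    then show "(p * i) *\<^sub>v v = 0\<^sub>m (rdim Q) (rdim S) *\<^sub>v v"
      using v di dp by (simp add: mat_kernel_iff mult_mat_vec_assoc zero_mat_mult_vec)
  qed (use di dp in simp_all)
  have factor: "\<exists>Z. Z \<in> carrier_mat (rdim S) (dim_col A) \<and> i * Z = A" if A: "dim_row A = n" "p * A = 0\<^sub>m (rdim Q) (dim_col A)" for A
  proof -
    have "mat_image A \<subseteq> mat_image i"
    proof
      fix v assume "v \<in> mat_image A"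
      then obtain u where u: "u \<in> carrier_vec (dim_col A)" "v = A *\<^sub>v u" unfolding mat_image_iff by blast
      then have "p *\<^sub>v v = 0\<^sub>v (rdim Q)"
        using A dp by (simp add: mult_mat_vec_cong[OF A(2)] zero_mat_mult_vec)
      then have "v \<in> mat_kernel p"
        unfolding mat_kernel_iff using A u dp by (auto intro!: carrier_vecI)
      then show "v \<in> mat_image i" using p(4) i(4) by simp
    qed
    then obtain Z where "Z \<in> carrier_mat (dim_col i) (dim_col A)" "i * Z = A"
      by (rule mat_image_factor) (use A di in simp)
    then show ?thesis using di by auto
  qed
  have pa: "p * op_a M = 0\<^sub>m (rdim Q) n" and pd: "p * op_d M = 0\<^sub>m (rdim Q) n"
  proof -
    have *: "p * A = 0\<^sub>m (rdim Q) n" if A: "dim_row A = n" "dim_col A = n" "\<And>v. dim_vec v = n \<Longrightarrow> A *\<^sub>v v \<in> soc M" for A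
    proof (rule mat_eq_by_vec)
      fix v :: "'k vec" assume "v \<in> carrier_vec (dim_col (p * A))"
      then have v: "dim_vec v = n" using A by simp
      then have "A *\<^sub>v v \<in> mat_kernel p" using A(3) p(4) by simp
      then show "(p * A) *\<^sub>v v = 0\<^sub>m (rdim Q) n *\<^sub>v v"
        using v A dp by (simp add: mat_kernel_iff mult_mat_vec_assoc zero_mat_mult_vec)
    qed (use A dp in simp_all)
    have K: "op_a M *\<^sub>v v \<in> soc M" "op_d M *\<^sub>v v \<in> soc M" if "dim_vec v = n" for v
      unfolding soc using that ad[OF that] dM relations_vec[of v] by (auto simp: n_def intro!: carrier_vecI)
    show "p * op_a M = 0\<^sub>m (rdim Q) n" "p * op_d M = 0\<^sub>m (rdim Q) n"
      by (rule *[OF dM(1,2) K(1)], assumption) (rule *[OF dM(7,8) K(2)], assumption)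
  qed
  have S0: "op_a S = 0\<^sub>m (rdim S) (rdim S)" "op_d S = 0\<^sub>m (rdim S) (rdim S)" "op_c S = op_b S"
  proof -
    have "i * op_a S = i * 0\<^sub>m (rdim S) (rdim S)" "i * op_d S = i * 0\<^sub>m (rdim S) (rdim S)" "i * op_c S = i * op_b S"
      using d4_homD(3-6)[OF i(2)] ai di0 cb di by simp_all
    from this[THEN mat_inj_cancel[OF i(3)]]
    show "op_a S = 0\<^sub>m (rdim S) (rdim S)" "op_d S = 0\<^sub>m (rdim S) (rdim S)" "op_c S = op_b S"
      using di dS by simp_all
  qed
  obtain p1 where p1: "p1 \<in> carrier_mat n (rdim Q)" "p * p1 = 1\<^sub>m (rdim Q)"
    using right_inverse_if_surj[of p] p(3) dp by auto
  have dp1: "dim_row p1 = n" "dim_col p1 = rdim Q" using p1(1) by auto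
  have Q0: "op_a Q = 0\<^sub>m (rdim Q) (rdim Q)" "op_d Q = 0\<^sub>m (rdim Q) (rdim Q)" "op_c Q = op_b Q"
  proof -
    have *: "B = (p * A) * p1" if "p * A = B * p" "dim_row B = rdim Q" "dim_col B = rdim Q" for A B
      unfolding that(1) using that(2,3) dp dp1 by (simp add: mult_mat_assoc p1(2))
    show "op_a Q = 0\<^sub>m (rdim Q) (rdim Q)" "op_d Q = 0\<^sub>m (rdim Q) (rdim Q)"
      using *[OF d4_homD(3)[OF p(2)]] *[OF d4_homD(6)[OF p(2)]] dQ dp1 by (simp_all add: pa pd)
    show "op_c Q = op_b Q"
      using *[OF d4_homD(4)[OF p(2)]] *[OF d4_homD(5)[OF p(2)]] dQ cb by simp
  qed
  have rS: "rdim S = s"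
    using principal.length_eq_rdim[OF principal.intro[OF two i(1) S0(3)] S0(1,2) S(2)] .
  have rQ: "rdim Q = s"
    using principal.length_eq_rdim[OF principal.intro[OF two p(1) Q0(3)] Q0(1,2) Q(2)] .
  obtain X0 where X0: "X0 \<in> carrier_mat s n" "X0 * i = 1\<^sub>m s"
    using left_inverse_if_inj[OF i(3) carrier_matI[OF di]] rS by metis
  have dX0: "dim_row X0 = s" "dim_col X0 = n" using X0(1) by auto
  note d = dM di dp dp1 dX0 dS[unfolded rS] rS rQ
  \<comment> \<open>A linear retraction of the inclusion \<open>i\<close>, averaged over the group
    generated by b. It commutes with b, so \<open>i * X\<close> is the projection to the
    socle.\<close>
  define X where "X = (1/2) \<cdot>\<^sub>m (X0 + op_b S * (X0 * op_b M))"
  have dX: "dim_row X = s" "dim_col X = n" by (simp_all add: X_def d)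
  have bS: "op_b S * op_b S = 1\<^sub>m s" using d4_relations(7)[OF i(1)] by (simp add: rS)
  have bi: "op_b M * i = i * op_b S" using d4_homD(4)[OF i(2)] by simp
  have Xi: "X * i = 1\<^sub>m s"
    unfolding X_def
    by (rule eq_matI; simp add: mat_simps d X0(2) bi mult_mat_cong[OF X0(2)] bS del: index_mult_mat(1);
        simp add: field_simps two)
  have Xb: "X * op_b M = op_b S * X"
    unfolding X_def
    by (rule eq_matI; simp add: mat_simps d mult_mat_cong[OF bS] relations(4)[folded n_def] del: index_mult_mat(1))
  \<comment> \<open>The section \<open>p1\<close> of \<open>p\<close>, freed of its socle component:
    the columns of \<open>q\<close> are a basis of the kernel of \<open>X\<close>, the complement of
    the socle.\<close>
  define q where "q = p1 - i * (X * p1)"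
  have dq: "dim_row q = n" "dim_col q = s" by (simp_all add: q_def d)
  have pq: "p * q = 1\<^sub>m s"
    unfolding q_def using d dX by (simp add: mat_simps p1(2)[unfolded rQ] mult_mat_cong[OF pi])
  have Xq: "X * q = 0\<^sub>m s s"
    unfolding q_def using d dX by (simp add: mat_simps mult_mat_cong[OF Xi])
  have res: "i * X + q * p = 1\<^sub>m n"
  proof -
    \<comment> \<open>As \<open>1 - p1 * p\<close> maps into the kernel of \<open>p\<close>, it
      factors through \<open>i\<close>; applying \<open>X\<close> identifies the factor.\<close>
    have "p * (1\<^sub>m n - p1 * p) = 0\<^sub>m (rdim Q) (dim_col (1\<^sub>m n - p1 * p))"
      using d by (simp add: mat_simps mult_mat_cong[OF p1(2)])
    then obtain Z where Z: "Z \<in> carrier_mat (rdim S) (dim_col (1\<^sub>m n - p1 * p))" "i * Z = 1\<^sub>m n - p1 * p"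
      using factor[of "1\<^sub>m n - p1 * p"] d by auto
    have dZ: "dim_row Z = s" "dim_col Z = n" using Z(1) d by auto
    have "X * (i * Z) = Z" using d dX dZ by (simp add: mult_mat_cong[OF Xi])
    then have XZ: "X - X * (p1 * p) = Z"
      unfolding Z(2) using d dX by (simp add: mat_simps)
    have "i * X + q * p = i * (X - X * (p1 * p)) + p1 * p"
      unfolding q_def using d dX
      by (intro eq_matI; simp add: mat_simps del: index_mult_mat(1))
    also have "\<dots> = 1\<^sub>m n"
      unfolding XZ Z(2) by (rule eq_matI) (simp_all add: d)
    finally show ?thesis .
  qed
  have proj: "i * (X * A) = A" if "dim_row A = n" "p * A = 0\<^sub>m s (dim_col A)" for A
  proof -
    have "A = (i * X + q * p) * A" using that(1) by (simp add: res)
    also have "\<dots> = i * (X * A) + q * 0\<^sub>m s (dim_col A)"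
      using that d dX dq by (simp add: mat_simps)
    finally show ?thesis using d dq dX by (simp add: zero_add_mat)
  qed
  \<comment> \<open>\<open>E\<close> commutes with a: in a E the projection term vanishes since a
    kills the socle, in E a the projection acts as the identity since a maps into the socle, and
    both products are (a - b a) / 2. The same holds for d.\<close>
  define E where "E = (1/2) \<cdot>\<^sub>m 1\<^sub>m n + (1/2) \<cdot>\<^sub>m op_b M - op_b M * (i * X)"
  have iXa: "i * (X * op_a M) = op_a M" and iXd: "i * (X * op_d M) = op_d M"
    using proj[of "op_a M"] proj[of "op_d M"] pa pd d by simp_all
  have iXb: "i * (X * op_b M) = op_b M * (i * X)"
    unfolding Xb using d dX by (simp add: bi flip: mult_mat_assoc)
  have iXb': "i * (X * (op_b M * A)) = op_b M * (i * (X * A))" if "dim_row A = n" for A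
    using mult_mat_cong[OF iXb, of A] that d dX by (simp add: mult_mat_assoc)
  note rel = relations(1,2,4)[folded n_def] mult_mat_cong[OF relations(1), folded n_def]
    mult_mat_cong[OF relations(2), folded n_def] mult_mat_cong[OF relations(4), folded n_def]
  have E: "d4_hom M M E"
  proof (rule d4_homI)
    show "dim_row E = rdim M" "dim_col E = rdim M" by (simp_all add: E_def d dX n_def)
    show "E * op_a M = op_a M * E" "E * op_d M = op_d M * E" "E * op_b M = op_b M * E"
      unfolding E_def
      by (rule eq_matI; simp add: mat_simps d dX rel iXa iXd iXb mult_mat_cong[OF ai] mult_mat_cong[OF di0]
            del: index_mult_mat(1); simp add: field_simps two)+
    then show "E * op_c M = op_c M * E" by (simp add: cb)
  qed
  have EE: "E * E = E"
    unfolding E_def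
    by (rule eq_matI; simp add: mat_simps d dX rel iXb' mult_mat_cong[OF Xi] iXb
          del: index_mult_mat(1); simp add: field_simps two power_two_nonzero[OF two])
  have Ei: "E * i = (1/2) \<cdot>\<^sub>m (i - op_b M * i)" and Eq: "E * q = (1/2) \<cdot>\<^sub>m (q + op_b M * q)"
    unfolding E_def
    by (rule eq_matI; simp add: mat_simps d dX dq Xi Xq del: index_mult_mat(1); simp add: field_simps two)+
  obtain e where e: "op_b M * i = zsgn e \<cdot>\<^sub>m i" "op_b M * q = zsgn (e + 1) \<cdot>\<^sub>m q"
  proof -
    have half: "y = - z * x" if "(1/2) * (x + y) = ((1 - z) / 2) * x" for x y z :: 'k
    proof -
      have "x + y = 2 * ((1/2) * (x + y))" using two by simp
      also have "\<dots> = x + - z * x" unfolding that using two by (simp add: left_diff_distrib)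
      finally show ?thesis by (simp only: add_left_cancel)
    qed
    \<comment> \<open>The scalar (1 - (-1)^e) / 2 is 0 for e = 0 and 1 for e = 1, so the two
      possible values of \<open>E\<close> are treated together.\<close>
    have *: "op_b M * i = zsgn e \<cdot>\<^sub>m i \<and> op_b M * q = zsgn (e + 1) \<cdot>\<^sub>m q"
      if e: "(1/2) \<cdot>\<^sub>m (i - op_b M * i) = ((1 - zsgn e) / 2) \<cdot>\<^sub>m i" "(1/2) \<cdot>\<^sub>m (q + op_b M * q) = ((1 - zsgn e) / 2) \<cdot>\<^sub>m q" for e
    proof
      show "op_b M * i = zsgn e \<cdot>\<^sub>m i"
      proof (rule eq_matI)
        fix k l assume "k < dim_row (zsgn e \<cdot>\<^sub>m i)" "l < dim_col (zsgn e \<cdot>\<^sub>m i)"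
        then show "(op_b M * i) $$ (k, l) = (zsgn e \<cdot>\<^sub>m i) $$ (k, l)"
          using arg_cong[OF e(1), of "\<lambda>A. A $$ (k, l)"] d two
          by (simp del: index_mult_mat(1)) (simp add: field_simps)
      qed (simp_all add: d)
      show "op_b M * q = zsgn (e + 1) \<cdot>\<^sub>m q"
      proof (rule eq_matI)
        fix k l assume "k < dim_row (zsgn (e + 1) \<cdot>\<^sub>m q)" "l < dim_col (zsgn (e + 1) \<cdot>\<^sub>m q)"
        then have kl: "k < n" "l < s" using dq by simp_all
        then have "(1/2) * (q $$ (k, l) + (op_b M * q) $$ (k, l)) = ((1 - zsgn e) / 2) * q $$ (k, l)"
          using arg_cong[OF e(2), of "\<lambda>A. A $$ (k, l)"] d dq by (simp del: index_mult_mat(1))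
        then have "(op_b M * q) $$ (k, l) = - zsgn e * q $$ (k, l)"
          by (rule half)
        then show "(op_b M * q) $$ (k, l) = (zsgn (e + 1) \<cdot>\<^sub>m q) $$ (k, l)"
          using kl dq by (simp del: index_mult_mat(1))
      qed (simp_all add: d dq)
    qed
    from indecomposable_idempotent[OF ind E EE] show ?thesis
    proof
      assume "E = 0\<^sub>m (rdim M) (rdim M)"
      then have "E * i = 0\<^sub>m n s" "E * q = 0\<^sub>m n s" using d dq by (simp_all add: n_def)
      then show ?thesis
        using *[of 0] that[of 0] d dq unfolding Ei Eq by (simp add: zero_smult_mat)
    next
      assume "E = 1\<^sub>m (rdim M)"
      then have "E * i = i" "E * q = q" using d dq by (simp_all add: n_def)
      then show ?thesis
        using *[of 1] that[of 1] two unfolding Ei Eq by (simp add: smult_one_mat)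
    qed
  qed
  have c: "i \<in> carrier_mat (rdim M) s" "X \<in> carrier_mat s (rdim M)" "q \<in> carrier_mat (rdim M) s" "p \<in> carrier_mat s (rdim M)"
    by (rule carrier_matI; simp add: d dX dq flip: n_def)+
  have pi0: "p * i = 0\<^sub>m s s" using pi rS rQ by simp
  have res': "q * p + i * X = 1\<^sub>m (rdim M)"
  proof -
    have "q * p + i * X = i * X + q * p"
      by (rule comm_add_mat[of _ n n]; rule carrier_matI; simp add: d dX dq)
    then show ?thesis using res by (simp add: n_def)
  qed
  show ?thesis
  \<comment> \<open>If the sum is zero, the socle contributes the copies of V(2,0); otherwise the
    complement does, and the two eigenspaces exchange their roles. Both have dimension s.\<close>
  proof (cases "r' + e = 0")
    case True
    then show ?thesis
      using tensor_V2_eigenspaces[OF two m cb c(1,2) Xi e(1) c(3,4) pq e(2) Xq pi0 res[unfolded n_def], of r'] by simp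
  next
    case False
    then have "r' + (e + 1) = 0" by (cases r'; cases e) simp_all
    moreover have "op_b M * i = zsgn (e + 1 + 1) \<cdot>\<^sub>m i" by (simp only: e(1) zsgn_plus_one_one)
    ultimately show ?thesis
      using tensor_V2_eigenspaces[OF two m cb c(3,4) pq e(2) c(1,2) Xi _ pi0 Xq res', of r'] by simp
  qed
qed


theorem corollary2p7:
  fixes r r' :: bit and s :: nat and \<eta> :: "('k::alg_closed_field) proj_line"
  assumes "CHAR('k) \<noteq> 2" and "s \<ge> 1"
  shows
    "(odd s \<longrightarrow> (\<forall>N N' :: 'k d4_rep. (is_Omega ^^ s) (V1 r) N \<and> (is_Omega_inv ^^ s) (V1 r) N' \<longrightarrow>
        V2 r' \<otimes>\<^sub>D N \<cong>\<^sub>D V2 r' \<otimes>\<^sub>D N' \<and>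
        V2 r' \<otimes>\<^sub>D N' \<cong>\<^sub>D copies s (V2 (r + r')) \<oplus>\<^sub>D copies (s + 1) (V2 (r + r' + 1)))) \<and>
     (even s \<longrightarrow> (\<forall>N N' :: 'k d4_rep. (is_Omega ^^ s) (V1 r) N \<and> (is_Omega_inv ^^ s) (V1 r) N' \<longrightarrow>
        V2 r' \<otimes>\<^sub>D N \<cong>\<^sub>D V2 r' \<otimes>\<^sub>D N' \<and>
        V2 r' \<otimes>\<^sub>D N' \<cong>\<^sub>D copies s (V2 (r + r' + 1)) \<oplus>\<^sub>D copies (s + 1) (V2 (r + r')))) \<and>
     (\<forall>M :: 'k d4_rep. is_Ms s r \<eta> M \<longrightarrow>
        V2 r' \<otimes>\<^sub>D M \<cong>\<^sub>D copies s (V2 0) \<oplus>\<^sub>D copies s (V2 1))"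
proof -
  have two: "(2::'k) \<noteq> 0"
  proof
    assume "(2::'k) = 0"
    then have "CHAR('k) dvd 2"
      using of_nat_eq_0_iff_char_dvd[of 2, where 'a = 'k] by simp
    then have "CHAR('k) = 1 \<or> CHAR('k) = 2"
      using prime_nat_iff[of 2] two_is_prime_nat by blast
    then show False using assms(1) by simp
  qed
  have Omega: "V2 r' \<otimes>\<^sub>D N \<cong>\<^sub>D V2 r' \<otimes>\<^sub>D N' \<and>
      V2 r' \<otimes>\<^sub>D N' \<cong>\<^sub>D copies s (V2 (r' + e)) \<oplus>\<^sub>D copies (Suc s) (V2 (r' + e + 1))"
    if N: "(is_Omega ^^ s) (V1 r) N" and N': "(is_Omega_inv ^^ s) (V1 r) N'"
      and e: "e = (if even s then r + 1 else r)" for N N' :: "'k d4_rep" and e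
  proof -
    have mV: "d4_module (V1 r :: 'k d4_rep)"
      unfolding syz_mod_0[symmetric] by (rule d4_module_syz_mod)
    have mN: "d4_module N" "N \<cong>\<^sub>D syz_mod s e"
      using Omega_power_V1[OF two N] e by auto
    \<comment> \<open>V(r) is its own transpose, so the transpose of \<open>N'\<close> is an s-th
      syzygy of V(r) again.\<close>
    have mN': "d4_module N'" "dual N' \<cong>\<^sub>D syz_mod s e"
      using Omega_power_dual[OF mV N'] Omega_power_V1[OF two, of s r "dual N'"] e by (auto simp: dual_V1)
    have 1: "V2 r' \<otimes>\<^sub>D N \<cong>\<^sub>D copies s (V2 (r' + e)) \<oplus>\<^sub>D copies (Suc s) (V2 (r' + e + 1))"
      using two mN by (rule tensor_V2_Omega_power)
    have 2: "V2 r' \<otimes>\<^sub>D N' \<cong>\<^sub>D copies s (V2 (r' + e)) \<oplus>\<^sub>D copies (Suc s) (V2 (r' + e + 1))"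
      using two mN' by (rule tensor_V2_Omega_power_dual)
    have "V2 r' \<otimes>\<^sub>D N \<cong>\<^sub>D V2 r' \<otimes>\<^sub>D N'"
      by (rule d4_iso_trans[OF 1 d4_iso_sym[OF 2]])
        (intro wf_tensor wf_V2 wf_dsum wf_copies d4_module_wf mN(1) mN'(1))+
    with 2 show ?thesis by blast
  qed
  show ?thesis
  proof (intro conjI impI allI; (elim conjE)?)
    fix N N' :: "'k d4_rep"
    assume N: "(is_Omega ^^ s) (V1 r) N" "(is_Omega_inv ^^ s) (V1 r) N'"
    {
      assume "odd s"
      then have e: "r = (if even s then r + 1 else r)" by simp
      have "r' + r = r + r'" by (rule add.commute)
      then show "V2 r' \<otimes>\<^sub>D N \<cong>\<^sub>D V2 r' \<otimes>\<^sub>D N'"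
        "V2 r' \<otimes>\<^sub>D N' \<cong>\<^sub>D copies s (V2 (r + r')) \<oplus>\<^sub>D copies (s + 1) (V2 (r + r' + 1))"
        using Omega[OF N e] unfolding Suc_eq_plus1 by simp_all
    next
      assume "even s"
      then have e: "r + 1 = (if even s then r + 1 else r)" by simp
      have "r' + (r + 1) = r + r' + 1" "r + r' + 1 + 1 = r + r'"
        by (cases r; cases r'; simp)+
      then show "V2 r' \<otimes>\<^sub>D N \<cong>\<^sub>D V2 r' \<otimes>\<^sub>D N'"
        "V2 r' \<otimes>\<^sub>D N' \<cong>\<^sub>D copies s (V2 (r + r' + 1)) \<oplus>\<^sub>D copies (s + 1) (V2 (r + r'))"
        using Omega[OF N e] unfolding Suc_eq_plus1 by (simp_all only: )
    }
  next
    fix M :: "'k d4_rep" assume "is_Ms s r \<eta> M"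
    then show "V2 r' \<otimes>\<^sub>D M \<cong>\<^sub>D copies s (V2 0) \<oplus>\<^sub>D copies s (V2 1)"
      using two by (rule tensor_V2_Ms[rotated])
  qed
qed

end
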